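(* Let $D\subset\mathbb{R}^{n}$ be a domain, let $\lambda_D$ be the first eigenvalue of $\frac12\Delta$ (i.e. of $-\frac12\Delta$ with the usual positive sign convention) in $D$ with Dirichlet boundary conditions, and let $\psi$ be its corresponding eigenfunction. Suppose that, for every $z\in D$, the first exit time $\tau_D$ of $n$-dimensional Brownian motion from $D$ satisfies $$\lim_{t\to\infty}e^{\lambda_D t}P_z[\tau_D>t]=\psi(z)\int_D\psi(y)\,dy .$$ Let $\tau_D(Z)$ be the first exit time from $D$ of iterated Brownian motion $Z$ started at $z$. Then for every $z\in D$, $$\lim_{t\to\infty}t^{-1/2}\exp\Big(\tfrac32\pi^{2/3}\lambda_D^{2/3}t^{1/3}\Big)P_z[\tau_D(Z)>t]=\frac{2^{7/2}\lambda_D}{\sqrt{3\pi}}\Big(\psi(z)\int_D\psi(y)\,dy\Big)^2 .$$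
   Context: Iterated Brownian motion (IBM) in $\mathbb{R}^n$ started at $z\in\mathbb{R}^n$: let $X^+,X^-$ be standard $n$-dimensional Brownian motions and $Y$ a standard one-dimensional Brownian motion, all three independent and started at $0$. Put $X_t=X^+_t$ for $t\ge 0$ and $X_t=X^-_{-t}$ for $t<0$, and $Z_t=z+X(Y_t)$, $t\ge 0$. The first exit time is $\tau_D(Z)=\inf\{t\ge 0: Z_t\notin D\}$, and $P_z$ denotes probability for the process started at $z$. Similarly $\tau_D$ is the first exit time from $D$ of standard Brownian motion (generator $\frac12\Delta$) started at $z$. The displayed hypothesis fixes the normalization of $\psi$ (in the standard case $\psi>0$ with $L^2(D)$-norm $1$). *)

theory Defs
  imports "HOL-Probability.Probability"
begin

section \<open>Brownian motion\<close>

text \<open>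
  Standard Brownian motion started at the origin (generator one half of the Laplacian).
  Increments over \<open>[s, t]\<close> have the law \<open>N(0, (t - s) I)\<close>, whose density is the product of the
  one-dimensional densities over the coordinates; the instance at type \<^typ>\<open>real\<close> is
  one-dimensional Brownian motion. Starting point and continuity hold for every sample point,
  so that exit events from open sets are measurable. The values at negative times are
  irrelevant.
\<close>

locale brownian_motion = prob_space M for M :: "'w measure" +
  fixes B :: "real \<Rightarrow> 'w \<Rightarrow> 'a :: euclidean_space"
  assumes measurable_BM: "0 \<le> t \<Longrightarrow> random_variable borel (B t)"
    and start_BM: "\<omega> \<in> space M \<Longrightarrow> B 0 \<omega> = 0"
    and continuous_BM: "\<omega> \<in> space M \<Longrightarrow> continuous_on {0..} (\<lambda>t. B t \<omega>)"
    and gaussian_increments_BM: "0 \<le> s \<Longrightarrow> s < t \<Longrightarrow>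
      distributed M lborel (\<lambda>\<omega>. B t \<omega> - B s \<omega>)
        (\<lambda>x. ennreal (\<Prod>b\<in>Basis. normal_density 0 (sqrt (t - s)) (x \<bullet> b)))"
    and indep_increments_BM: "0 \<le> r 0 \<Longrightarrow> strict_mono r \<Longrightarrow>
      indep_vars (\<lambda>_. borel) (\<lambda>i \<omega>. B (r (Suc i)) \<omega> - B (r i) \<omega>) {..<k::nat}"

definition process_events :: "'w measure \<Rightarrow> (real \<Rightarrow> 'w \<Rightarrow> 'a :: topological_space) \<Rightarrow> 'w set set" where
  "process_events M B =
     sigma_sets (space M) {B t -` A \<inter> space M | t A. 0 \<le> t \<and> A \<in> sets borel}"

definition independent_processes ::
  "'w measure \<Rightarrow> (real \<Rightarrow> 'w \<Rightarrow> 'a :: topological_space) \<Rightarrow> (real \<Rightarrow> 'w \<Rightarrow> 'b :: topological_space) \<Rightarrow>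
    (real \<Rightarrow> 'w \<Rightarrow> 'c :: topological_space) \<Rightarrow> bool" where
  "independent_processes M A B C \<longleftrightarrow>
     prob_space.indep_sets M
       (\<lambda>i. [process_events M A, process_events M B, process_events M C] ! i) {0, 1, 2}"

definition two_sided :: "(real \<Rightarrow> 'w \<Rightarrow> 'a) \<Rightarrow> (real \<Rightarrow> 'w \<Rightarrow> 'a) \<Rightarrow> real \<Rightarrow> 'w \<Rightarrow> 'a" where
  "two_sided Xp Xm t \<omega> = (if 0 \<le> t then Xp t \<omega> else Xm (- t) \<omega>)"

definition iterated_process ::
  "'a \<Rightarrow> (real \<Rightarrow> 'w \<Rightarrow> 'a) \<Rightarrow> (real \<Rightarrow> 'w \<Rightarrow> 'a) \<Rightarrow> (real \<Rightarrow> 'w \<Rightarrow> real) \<Rightarrow> real \<Rightarrow> 'w \<Rightarrow> 'a :: plus" where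
  "iterated_process z Xp Xm Y t \<omega> = z + two_sided Xp Xm (Y t \<omega>) \<omega>"

text \<open>The value is \<open>\<infinity>\<close> when the path never leaves \<open>D\<close>.\<close>

definition exit_time :: "'a set \<Rightarrow> (real \<Rightarrow> 'a) \<Rightarrow> ereal" where
  "exit_time D f = (INF t\<in>{t. 0 \<le> t \<and> f t \<notin> D}. ereal t)"


section \<open>The Dirichlet problem for one half of the Laplacian\<close>

definition grad :: "('a :: euclidean_space \<Rightarrow> real) \<Rightarrow> 'a \<Rightarrow> 'a" where
  "grad f x = (\<Sum>b\<in>Basis. frechet_derivative f (at x) b *\<^sub>R b)"

text \<open>
  Coinductively: all iterated partial derivatives exist and are differentiable
  (hence continuous), that is, the function is of class \<open>C\<^sup>\<infinity>\<close> on the whole space.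
\<close>

coinductive smooth :: "('a :: euclidean_space \<Rightarrow> real) \<Rightarrow> bool" where
  "(\<forall>x. f differentiable (at x)) \<Longrightarrow>
   (\<forall>b\<in>Basis. smooth (\<lambda>x. frechet_derivative f (at x) b)) \<Longrightarrow> smooth f"

definition test_function :: "'a :: euclidean_space set \<Rightarrow> ('a \<Rightarrow> real) \<Rightarrow> bool" where
  "test_function D \<phi> \<longleftrightarrow>
     smooth \<phi> \<and> compact (closure {x. \<phi> x \<noteq> 0}) \<and> closure {x. \<phi> x \<noteq> 0} \<subseteq> D"

text \<open>
  \<open>u\<close> belongs to \<open>H\<^sub>0\<^sup>1(D)\<close>, the closure of the test functions in the Sobolev norm, and \<open>g\<close> is
  its weak gradient. Square integrability of \<open>u\<close> and \<open>g\<close> over \<open>D\<close> follows.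
\<close>

definition H10_with_gradient ::
  "'a :: euclidean_space set \<Rightarrow> ('a \<Rightarrow> real) \<Rightarrow> ('a \<Rightarrow> 'a) \<Rightarrow> bool" where
  "H10_with_gradient D u g \<longleftrightarrow>
     set_borel_measurable lborel D u \<and> set_borel_measurable lborel D g \<and>
     (\<exists>\<phi> :: nat \<Rightarrow> 'a \<Rightarrow> real. (\<forall>k. test_function D (\<phi> k)) \<and>
       (\<lambda>k. \<integral>\<^sup>+x\<in>D. ennreal ((\<phi> k x - u x)\<^sup>2) \<partial>lborel) \<longlonglongrightarrow> 0 \<and>
       (\<lambda>k. \<integral>\<^sup>+x\<in>D. ennreal ((norm (grad (\<phi> k) x - g x))\<^sup>2) \<partial>lborel) \<longlonglongrightarrow> 0)"

text \<open>
  The weak (form) definition of \<open>- \<Delta>u / 2 = \<mu> u\<close> with Dirichlet boundary condition on an arbitrary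
  open set. Weak solutions agree almost everywhere with a smooth function on \<open>D\<close>; requiring
  continuity selects this representative, so that \<open>u z\<close> is meaningful for every \<open>z \<in> D\<close>.
\<close>

definition dirichlet_eigenfunction ::
  "'a :: euclidean_space set \<Rightarrow> real \<Rightarrow> ('a \<Rightarrow> real) \<Rightarrow> bool" where
  "dirichlet_eigenfunction D \<mu> u \<longleftrightarrow>
     continuous_on D u \<and> (\<exists>x\<in>D. u x \<noteq> 0) \<and>
     (\<exists>g. H10_with_gradient D u g \<and>
       (\<forall>\<phi>. test_function D \<phi> \<longrightarrow>
         1 / 2 * (LINT x:D|lborel. g x \<bullet> grad \<phi> x) = \<mu> * (LINT x:D|lborel. u x * \<phi> x)))"

definition first_dirichlet_eigenvalue :: "'a :: euclidean_space set \<Rightarrow> real \<Rightarrow> bool" where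
  "first_dirichlet_eigenvalue D \<mu> \<longleftrightarrow>
     (\<exists>u. dirichlet_eigenfunction D \<mu> u) \<and>
     (\<forall>\<nu> u. dirichlet_eigenfunction D \<nu> u \<longrightarrow> \<mu> \<le> \<nu>)"

end

theory Submission
  imports Defs "HOL-Real_Asymp.Real_Asymp"
begin

text \<open>
  Let \<open>hi t\<close> and \<open>lo t\<close> be the maxima of \<open>Y\<close> and \<open>- Y\<close> on \<open>[0, t]\<close>, and let \<open>G u = P[\<tau>\<^sub>D > u]\<close>.
  The path of \<open>Z\<close> up to time \<open>t\<close> is the image under the two-sided motion of the whole interval
  \<open>[- lo t, hi t]\<close>, so by independence \<open>P[\<tau>\<^sub>D(Z) > t] = E[G (hi t) * G (lo t)]\<close>, which is compared with
  \<open>c\<^sup>2 * E[exp (- \<lambda> R)]\<close>, where \<open>R = hi t + lo t\<close> is the range of \<open>Y\<close> and \<open>c = \<psi> z * (\<integral> \<psi>)\<close>.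

  Since \<open>exp (- \<lambda> R)\<close> is the integral of \<open>\<lambda>\<^sup>2 exp (- \<lambda> r) (r - R)\<^sup>+\<close> over \<open>r\<close>, and \<open>E[(r - R)\<^sup>+]\<close> is the
  integral over \<open>v \<in> [0, r]\<close> of the probability that \<open>v + Y\<close> stays in \<open>[0, r]\<close> up to time \<open>t\<close>, the sine
  expansion of that probability reduces everything to Laplace integrals of
  \<open>r exp (- \<lambda> r - \<pi>\<^sup>2 t / (2 r\<^sup>2))\<close>. The sine expansion itself comes from stopping the martingales
  \<open>exp (k\<^sup>2 \<pi>\<^sup>2 s / (2 r\<^sup>2)) sin (k \<pi> (v + Y\<^sub>s) / r)\<close> at the exit from \<open>[0, r]\<close>.
\<close>

section \<open>Nonnegativity of Dirichlet eigenvalues\<close>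

text \<open>The sign of \<open>lam\<close> is not assumed, while the Laplace step works for
  \<open>lam > 0\<close>. Negative values are excluded by inserting the approximating test functions
  into the weak equation; for \<open>lam = 0\<close> the scaled probability tends to
  \<open>0\<close>, which is then the claimed limit.

  The obstacle in comparing \<open>G (hi t) * G (lo t)\<close> with \<open>exp (- lam R)\<close> is
  that the asymptotics of \<open>G\<close> speak only of large arguments, so paths with one maximum
  below a fixed \<open>K\<close> must be negligible on the scale of the theorem. They are, because
  bounding one side fixes the starting point in the interval: it is the integral over
  \<open>v\<close> that supplies the factor \<open>r\<close> of the Laplace integrand, and its
  absence costs a factor of order \<open>t^(1/3)\<close>.

  The constant collects \<open>lam^2\<close> from the exponential mixture, \<open>8 / pi^2\<close>
  from the first sine mode integrated over its starting points, and the Gaussian integral around the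
  saddle point \<open>r = s T\<close>.

  The sine series of the constant \<open>1\<close> enters only through its convergence in L1: the
  density of \<open>Y t\<close> is bounded, so an L1 error on \<open>[0, r]\<close> becomes an error
  of probabilities that is uniform in the starting point.\<close>

lemma smooth_continuous: "smooth f \<Longrightarrow> continuous_on A f"
  by (erule smooth.cases)
     (auto intro!: continuous_at_imp_continuous_on differentiable_imp_continuous_within)

lemma grad_continuous:
  fixes f :: "'a :: euclidean_space \<Rightarrow> real"
  assumes "smooth f" shows "continuous_on A (grad f)"
proof -
  have "smooth (\<lambda>x. frechet_derivative f (at x) b)" if "b \<in> Basis" for b
    using assms that by (cases rule: smooth.cases) auto
  then show ?thesis unfolding grad_def[abs_def] by (intro continuous_intros smooth_continuous) auto
qed

lemma grad_eq_0_outside_support: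
  fixes f :: "'a :: euclidean_space \<Rightarrow> real"
  assumes "x \<notin> closure {x. f x \<noteq> 0}" shows "grad f x = 0"
proof -
  have "(f has_derivative (\<lambda>_. 0)) (at x)"
  proof (rule has_derivative_transform_within_open)
    show "((\<lambda>_. 0) has_derivative (\<lambda>_. 0)) (at x)" by simp
    show "open (- closure {x. f x \<noteq> 0})" "x \<in> - closure {x. f x \<noteq> 0}" using assms by auto
    show "0 = f y" if "y \<in> - closure {x. f x \<noteq> 0}" for y
      using that closure_subset[of "{x. f x \<noteq> 0}"] by auto
  qed
  from frechet_derivative_at[OF this] show ?thesis by (simp add: grad_def fun_eq_iff)
qed

lemma integrable_norm_square_compact_support:
  fixes f :: "'a :: euclidean_space \<Rightarrow> 'b :: euclidean_space"
  assumes "continuous_on UNIV f" "compact K" "\<And>x. x \<notin> K \<Longrightarrow> f x = 0"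
  shows "integrable lborel (\<lambda>x. (norm (f x))\<^sup>2)"
proof -
  have "integrable lborel (\<lambda>x. indicator K x *\<^sub>R (norm (f x))\<^sup>2)"
    using assms(2) by (rule borel_integrable_compact)
      (intro continuous_intros continuous_on_subset[OF assms(1)], auto)
  also have "(\<lambda>x. indicator K x *\<^sub>R (norm (f x))\<^sup>2) = (\<lambda>x. (norm (f x))\<^sup>2)"
    using assms(3) by (auto simp: indicator_def fun_eq_iff)
  finally show ?thesis .
qed

lemma norm_diff_square: "(norm (a - b))\<^sup>2 = (norm a)\<^sup>2 + (norm b)\<^sup>2 - 2 * (b \<bullet> a)" for a b :: "'a :: real_inner"
  by (simp add: power2_norm_eq_inner inner_diff_left inner_diff_right inner_commute)

text \<open>The inner product is half of the two squares minus the square of the difference. Hence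
  smallness of the last term, which is what convergence in the Sobolev norm provides, gives an exact
  formula for the pairing of the limit with its approximant.\<close>

lemma L2_polarization:
  fixes p u :: "'a \<Rightarrow> 'b :: euclidean_space"
  assumes [measurable]: "p \<in> borel_measurable M" "u \<in> borel_measurable M"
    and p: "integrable M (\<lambda>x. (norm (p x))\<^sup>2)"
    and fin: "(\<integral>\<^sup>+x. ennreal ((norm (p x - u x))\<^sup>2) \<partial>M) < \<infinity>"
  shows "integrable M (\<lambda>x. (norm (u x))\<^sup>2)"
    and "2 * (LINT x|M. u x \<bullet> p x) =
      (LINT x|M. (norm (u x))\<^sup>2) + (LINT x|M. (norm (p x))\<^sup>2) - enn2real (\<integral>\<^sup>+x. ennreal ((norm (p x - u x))\<^sup>2) \<partial>M)"
proof -
  have d: "integrable M (\<lambda>x. (norm (p x - u x))\<^sup>2)"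
    using fin by (intro integrableI_nonneg) auto
  show u: "integrable M (\<lambda>x. (norm (u x))\<^sup>2)"
  proof (rule Bochner_Integration.integrable_bound)
    show "integrable M (\<lambda>x. 2 * (norm (p x))\<^sup>2 + 2 * (norm (p x - u x))\<^sup>2)" using p d by auto
    have "(norm b)\<^sup>2 \<le> 2 * (norm a)\<^sup>2 + 2 * (norm (a - b))\<^sup>2" for a b :: 'b
    proof -
      have "0 \<le> (norm (a + (a - b)))\<^sup>2" by simp
      then show ?thesis
        by (simp add: power2_norm_eq_inner inner_diff_left inner_diff_right inner_add_left inner_add_right inner_commute)
    qed
    then show "AE x in M. norm ((norm (u x))\<^sup>2) \<le> norm (2 * (norm (p x))\<^sup>2 + 2 * (norm (p x - u x))\<^sup>2)"
      by (intro AE_I2) simp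
  qed simp
  have up: "u x \<bullet> p x = ((norm (u x))\<^sup>2 + (norm (p x))\<^sup>2 - (norm (p x - u x))\<^sup>2) / 2" for x
    by (simp add: norm_diff_square)
  have "(LINT x|M. (norm (p x - u x))\<^sup>2) = enn2real (\<integral>\<^sup>+x. ennreal ((norm (p x - u x))\<^sup>2) \<partial>M)"
    by (intro integral_eq_nn_integral) auto
  then show "2 * (LINT x|M. u x \<bullet> p x) =
      (LINT x|M. (norm (u x))\<^sup>2) + (LINT x|M. (norm (p x))\<^sup>2) - enn2real (\<integral>\<^sup>+x. ennreal ((norm (p x - u x))\<^sup>2) \<partial>M)"
    unfolding up using u p d by simp
qed

text \<open>Continuity spreads one nonzero value to a nonempty open set, and such a set is never
  negligible.\<close>

lemma L2_norm_pos_of_continuous: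
  fixes u :: "'a :: euclidean_space \<Rightarrow> real"
  assumes D: "open D" and u: "continuous_on D u" "x \<in> D" "u x \<noteq> 0"
    and int: "integrable lborel (\<lambda>x. (norm (indicator D x *\<^sub>R u x))\<^sup>2)"
  shows "(LINT x|lborel. (norm (indicator D x *\<^sub>R u x))\<^sup>2) > 0"
proof (rule ccontr)
  assume "\<not> ?thesis"
  then have "(LINT x|lborel. (norm (indicator D x *\<^sub>R u x))\<^sup>2) = 0"
    by (intro antisym integral_nonneg_AE) auto
  then have "AE x in lborel. (norm (indicator D x *\<^sub>R u x))\<^sup>2 = 0"
    using integral_nonneg_eq_0_iff_AE[OF int] by simp
  then have AE: "AE x in lborel. x \<notin> D \<inter> u -` (- {0})"
    by eventually_elim (auto simp: indicator_def)
  have op: "open (D \<inter> u -` (- {0}))" using continuous_open_preimage[OF u(1) D, of "- {0}"] by auto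
  have "D \<inter> u -` (- {0}) \<in> null_sets lborel"
    using AE op by (subst (asm) AE_iff_null_sets[symmetric]) auto
  then have "negligible (D \<inter> u -` (- {0}))"
    by (simp add: negligible_iff_null_sets null_sets_completionI)
  then show False using open_not_negligible[OF op] u(2,3) by blast
qed

text \<open>The weak equation may be tested only with test functions, so instead of \<open>u\<close>
  itself an approximant \<open>\<phi> k\<close> is inserted. The gradient pairing is then
  nonnegative up to \<open>e2 k\<close>, while the pairing of \<open>u\<close> with
  \<open>\<phi> k\<close> is bounded below by a multiple of the squared norm of \<open>u\<close>; a
  negative \<open>\<mu>\<close> makes these two incompatible.\<close>

lemma dirichlet_eigenvalue_nonneg:
  fixes D :: "'a :: euclidean_space set"
  assumes D: "open D" and eig: "dirichlet_eigenfunction D \<mu> u"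
  shows "\<mu> \<ge> 0"
proof (rule ccontr)
  assume neg: "\<not> \<mu> \<ge> 0"
  from eig obtain x0 g where cont: "continuous_on D u" and x0: "x0 \<in> D" "u x0 \<noteq> 0"
    and H: "H10_with_gradient D u g"
    and weak: "\<And>\<phi>. test_function D \<phi> \<Longrightarrow>
         1 / 2 * (LINT x:D|lborel. g x \<bullet> grad \<phi> x) = \<mu> * (LINT x:D|lborel. u x * \<phi> x)"
    unfolding dirichlet_eigenfunction_def by blast
  from H obtain \<phi> where \<phi>: "\<And>k. test_function D (\<phi> k)"
    and lim_u: "(\<lambda>k. \<integral>\<^sup>+x\<in>D. ennreal ((\<phi> k x - u x)\<^sup>2) \<partial>lborel) \<longlonglongrightarrow> 0"
    and lim_g: "(\<lambda>k. \<integral>\<^sup>+x\<in>D. ennreal ((norm (grad (\<phi> k) x - g x))\<^sup>2) \<partial>lborel) \<longlonglongrightarrow> 0"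
    and meas: "set_borel_measurable lborel D u" "set_borel_measurable lborel D g"
    unfolding H10_with_gradient_def by blast
  \<comment> \<open>Extension by zero: test functions and their gradients vanish outside
    \<open>D\<close>, so all integrals over \<open>D\<close> become integrals over the whole
    space.\<close>
  define U where "U x = indicator D x *\<^sub>R u x" for x
  define G where "G x = indicator D x *\<^sub>R g x" for x
  define e1 where "e1 k = (\<integral>\<^sup>+x. ennreal ((norm (\<phi> k x - U x))\<^sup>2) \<partial>lborel)" for k
  define e2 where "e2 k = (\<integral>\<^sup>+x. ennreal ((norm (grad (\<phi> k) x - G x))\<^sup>2) \<partial>lborel)" for k
  have [measurable]: "U \<in> borel_measurable borel" "G \<in> borel_measurable borel"
    using meas unfolding set_borel_measurable_def U_def[abs_def] G_def[abs_def] by auto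
  have sm: "smooth (\<phi> k)" and cpt: "compact (closure {x. \<phi> k x \<noteq> 0})" and sub: "closure {x. \<phi> k x \<noteq> 0} \<subseteq> D" for k
    using \<phi>[of k] by (auto simp: test_function_def)
  have [measurable]: "\<phi> k \<in> borel_measurable borel" "grad (\<phi> k) \<in> borel_measurable borel" for k
    using smooth_continuous[OF sm] grad_continuous[OF sm] by (auto intro: borel_measurable_continuous_onI)
  have out: "\<phi> k x = 0" "grad (\<phi> k) x = 0" if "x \<notin> D" for k x
    using that sub[of k] grad_eq_0_outside_support[of x "\<phi> k"] closure_subset[of "{x. \<phi> k x \<noteq> 0}"] by auto
  have int: "integrable lborel (\<lambda>x. (norm (\<phi> k x))\<^sup>2)" "integrable lborel (\<lambda>x. (norm (grad (\<phi> k) x))\<^sup>2)" for k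
    by (rule integrable_norm_square_compact_support[OF smooth_continuous[OF sm] cpt[of k]],
        use closure_subset[of "{x. \<phi> k x \<noteq> 0}"] in blast)
       (rule integrable_norm_square_compact_support[OF grad_continuous[OF sm] cpt[of k] grad_eq_0_outside_support])
  have e1: "e1 \<longlonglongrightarrow> 0"
    by (rule Lim_transform_eventually[OF lim_u])
       (auto intro!: always_eventually nn_integral_cong simp: e1_def U_def indicator_def out)
  have e2: "e2 \<longlonglongrightarrow> 0"
    by (rule Lim_transform_eventually[OF lim_g])
       (auto intro!: always_eventually nn_integral_cong simp: e2_def G_def indicator_def out)
  have "\<forall>\<^sub>F k in sequentially. e1 k < \<infinity>" by (rule order_tendstoD(2)[OF e1]) simp
  then obtain k0 where "e1 k0 < \<infinity>" by (auto simp: eventually_sequentially)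
  then have intU: "integrable lborel (\<lambda>x. (norm (U x))\<^sup>2)"
    unfolding e1_def by (intro L2_polarization(1)[OF _ _ int(1)]) auto
  define A where "A = (LINT x|lborel. (norm (U x))\<^sup>2)"
  have A: "A > 0" unfolding A_def U_def
    by (rule L2_norm_pos_of_continuous[OF D cont x0]) (use intU in \<open>simp add: U_def\<close>)
  have "\<forall>\<^sub>F k in sequentially. e1 k < ennreal (A / 2)" by (rule order_tendstoD(2)[OF e1]) (use A in simp)
  moreover have "\<forall>\<^sub>F k in sequentially. e2 k < ennreal (- \<mu> * A)"
    by (rule order_tendstoD(2)[OF e2]) (use A neg in \<open>simp add: mult_neg_pos\<close>)
  ultimately have "\<forall>\<^sub>F k in sequentially. e1 k < ennreal (A / 2) \<and> e2 k < ennreal (- \<mu> * A)"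
    by (rule eventually_conj)
  \<comment> \<open>The tolerances are chosen so that both estimates meet at the same number: the
    doubled gradient pairing comes out strictly above \<open>\<mu> * A\<close> by the second and,
    through the weak equation, at most \<open>\<mu> * A\<close> by the first.\<close>
  then obtain k where k: "e1 k < ennreal (A / 2)" "e2 k < ennreal (- \<mu> * A)"
    by (auto simp: eventually_sequentially)
  have fin: "e1 k < \<infinity>" "e2 k < \<infinity>" using k by (auto intro: less_trans)
  have r1: "enn2real (e1 k) < A / 2" 
    using k(1) A fin(1) by (cases "e1 k") (auto simp: ennreal_less_iff)
  have r2: "enn2real (e2 k) < - \<mu> * A"
  proof -
    have "0 \<le> - \<mu> * A" using A neg by (simp add: mult_nonpos_nonneg)
    then show ?thesis using k(2) fin(2) by (cases "e2 k") (auto simp: ennreal_less_iff)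
  qed
  have "2 * (LINT x|lborel. U x \<bullet> \<phi> k x) = A + (LINT x|lborel. (norm (\<phi> k x))\<^sup>2) - enn2real (e1 k)"
    unfolding A_def e1_def by (rule L2_polarization(2)[OF _ _ int(1)]) (use fin in \<open>auto simp: e1_def\<close>)
  moreover have "0 \<le> (LINT x|lborel. (norm (\<phi> k x))\<^sup>2)" by (intro integral_nonneg_AE) auto
  ultimately have u1: "2 * (LINT x|lborel. U x \<bullet> \<phi> k x) \<ge> A / 2" using r1 by linarith
  have "2 * (LINT x|lborel. G x \<bullet> grad (\<phi> k) x) =
      (LINT x|lborel. (norm (G x))\<^sup>2) + (LINT x|lborel. (norm (grad (\<phi> k) x))\<^sup>2) - enn2real (e2 k)"
    unfolding e2_def by (rule L2_polarization(2)[OF _ _ int(2)]) (use fin in \<open>auto simp: e2_def\<close>)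
  moreover have "0 \<le> (LINT x|lborel. (norm (grad (\<phi> k) x))\<^sup>2)" "0 \<le> (LINT x|lborel. (norm (G x))\<^sup>2)"
    by (auto intro!: integral_nonneg_AE)
  ultimately have g1: "2 * (LINT x|lborel. G x \<bullet> grad (\<phi> k) x) > \<mu> * A" using r2 by linarith
  have "1 / 2 * (LINT x|lborel. G x \<bullet> grad (\<phi> k) x) = \<mu> * (LINT x|lborel. U x \<bullet> \<phi> k x)"
    using weak[OF \<phi>[of k]] by (simp add: set_lebesgue_integral_def U_def G_def mult.assoc)
  then have "2 * (LINT x|lborel. G x \<bullet> grad (\<phi> k) x) = 2 * (\<mu> * (2 * (LINT x|lborel. U x \<bullet> \<phi> k x)))" by simp
  also have "\<dots> \<le> 2 * (\<mu> * (A / 2))" using u1 neg by (intro mult_left_mono mult_left_mono_neg) auto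
  finally show False using g1 by simp
qed

section \<open>Laplace asymptotics\<close>

lemma gaussian_integral:
  fixes b :: real assumes "b > 0"
  shows "(LINT x|lborel. exp (- (b * x\<^sup>2))) = sqrt (pi / b)"
proof -
  have 1: "(LINT x|lborel. normal_density 0 (sqrt (1 / (2 * b))) x) = 1"
    using assms by (intro integral_normal_density) auto
  have 2: "normal_density 0 (sqrt (1 / (2 * b))) x = exp (- (b * x\<^sup>2)) / sqrt (pi / b)" for x
    using assms by (simp add: normal_density_def field_simps)
  have "(LINT x|lborel. exp (- (b * x\<^sup>2)) / sqrt (pi / b)) = 1" using 1 unfolding 2 .
  then have "(LINT x|lborel. exp (- (b * x\<^sup>2))) / sqrt (pi / b) = 1"
    by (simp only: integral_divide_zero)
  then show ?thesis using assms by (metis divide_eq_1_iff)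
qed

lemma integrable_power_exp:
  fixes u :: real assumes "0 < u"
  shows "set_integrable lborel {0<..} (\<lambda>x. x ^ k * exp (- (u * x)))"
proof -
  have "integrable lborel (\<lambda>x. indicator {0<..} x *\<^sub>R (x ^ k * exp (- x)) :: real)"
    using has_bochner_integral_I0i_power_exp_m[of k]
    by (auto simp: has_bochner_integral_iff set_integrable_def mult.commute)
  from lborel_integrable_real_affine[OF this, of u 0] assms
  have "integrable lborel (\<lambda>x. (1 / u ^ k) * (indicator {0<..} (u * x) * ((u * x) ^ k * exp (- (u * x)))))"
    by (intro integrable_mult_right) auto
  then show ?thesis unfolding set_integrable_def
    by (rule Bochner_Integration.integrable_cong[THEN iffD1, rotated -1])
       (use assms in \<open>auto simp: indicator_def power_mult_distrib zero_less_mult_iff\<close>)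
qed

lemma integrable_abs_power_exp:
  fixes u :: real assumes "0 < u"
  shows "integrable lborel (\<lambda>x. \<bar>x\<bar> ^ k * exp (- (u * \<bar>x\<bar>)))"
proof -
  let ?f = "\<lambda>x. indicator {0<..} x *\<^sub>R (x ^ k * exp (- (u * x))) :: real"
  have 1: "integrable lborel ?f" using integrable_power_exp[OF assms] by (simp add: set_integrable_def)
  from lborel_integrable_real_affine[OF this, of "-1" 0]
  have 2: "integrable lborel (\<lambda>x. ?f (- x))" by simp
  have "integrable lborel (\<lambda>x. ?f x + ?f (- x))" using 1 2 by (rule Bochner_Integration.integrable_add)
  then show ?thesis
    by (rule integrable_cong_AE[THEN iffD1, rotated -1])
       (auto intro!: AE_I[of _ _ "{0}"] simp: indicator_def)
qed

text \<open>
  The exponent of \<open>exit_kernel\<close> at time \<open>T\<^sup>3\<close> is minimal at \<open>r = s T\<close> with \<open>\<lambda> s\<^sup>3 = \<pi>\<^sup>2\<close>. Substituting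
  \<open>r = s T w\<close>, \<open>w = 1 + x / \<surd>T\<close>, and \<open>w + 1 / (2 w\<^sup>2) - 3 / 2 = (w - 1)\<^sup>2 (1 / w + 1 / (2 w\<^sup>2))\<close> gives this
  integrand with \<open>a = \<lambda> s\<close>.
\<close>

definition laplace_integrand :: "real \<Rightarrow> real \<Rightarrow> real \<Rightarrow> real" where
  "laplace_integrand a T x = indicator {- sqrt T<..} x * ((1 + x / sqrt T) *
     exp (- (a * x\<^sup>2 * (1 / (1 + x / sqrt T) + 1 / (2 * (1 + x / sqrt T)\<^sup>2)))))"

lemma laplace_integrand_measurable [measurable]: "laplace_integrand a T \<in> borel_measurable borel"
  unfolding laplace_integrand_def[abs_def] by measurable

text \<open>A majorant that is uniform in \<open>T \<ge> 1\<close>, for dominated convergence. Since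
  \<open>w \<le> 1 + \<bar>x\<bar>\<close>, the exponent is at least
  \<open>a x^2 / (1 + \<bar>x\<bar>)\<close>, hence at least \<open>a (\<bar>x\<bar> - 1)\<close>.
  The Gaussian shape is only local, so the majorant has exponential tails; \<open>exp a\<close>
  comes from the \<open>- 1\<close>.\<close>

lemma laplace_integrand_bound:
  fixes a :: real assumes a: "a > 0" and T: "T \<ge> 1"
  shows "norm (laplace_integrand a T x) \<le> exp a * (exp (- (a * \<bar>x\<bar>)) + \<bar>x\<bar> * exp (- (a * \<bar>x\<bar>)))"
proof (cases "x > - sqrt T")
  case False then show ?thesis by (auto simp: laplace_integrand_def)
next
  case True
  define w where "w = 1 + x / sqrt T"
  have sT: "sqrt T \<ge> 1" using T by simp
  have w: "w > 0" using True sT by (simp add: w_def field_simps)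
  have wle: "w \<le> 1 + \<bar>x\<bar>"
  proof -
    have "x / sqrt T \<le> \<bar>x\<bar> / sqrt T" using sT by (intro divide_right_mono) auto
    also have "\<dots> \<le> \<bar>x\<bar>" using sT by (simp add: field_simps mult_le_cancel_left1)
    finally show ?thesis by (simp add: w_def)
  qed
  have "1 / (1 + \<bar>x\<bar>) \<le> 1 / w + 1 / (2 * w\<^sup>2)"
  proof -
    have "1 / (1 + \<bar>x\<bar>) \<le> 1 / w" using w wle by (intro divide_left_mono) auto
    also have "\<dots> \<le> 1 / w + 1 / (2 * w\<^sup>2)" by simp
    finally show ?thesis .
  qed
  then have "a * x\<^sup>2 * (1 / (1 + \<bar>x\<bar>)) \<le> a * x\<^sup>2 * (1 / w + 1 / (2 * w\<^sup>2))"
    using a by (intro mult_left_mono) auto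
  moreover have "a * (\<bar>x\<bar> - 1) \<le> a * x\<^sup>2 * (1 / (1 + \<bar>x\<bar>))"
  proof -
    have "(\<bar>x\<bar> - 1) * (1 + \<bar>x\<bar>) \<le> x\<^sup>2" by (simp add: algebra_simps power2_eq_square)
    then have "\<bar>x\<bar> - 1 \<le> x\<^sup>2 / (1 + \<bar>x\<bar>)" by (simp add: field_simps)
    from mult_left_mono[OF this, of a] a show ?thesis by simp
  qed
  ultimately have "exp (- (a * x\<^sup>2 * (1 / w + 1 / (2 * w\<^sup>2)))) \<le> exp (a - a * \<bar>x\<bar>)"
    by (simp add: algebra_simps)
  moreover have "exp (a - a * \<bar>x\<bar>) = exp a * exp (- (a * \<bar>x\<bar>))" by (simp add: exp_diff exp_minus divide_inverse)
  ultimately have "w * exp (- (a * x\<^sup>2 * (1 / w + 1 / (2 * w\<^sup>2)))) \<le> (1 + \<bar>x\<bar>) * (exp a * exp (- (a * \<bar>x\<bar>)))"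
    using w wle by (intro mult_mono) auto
  then show ?thesis using True w by (simp add: laplace_integrand_def w_def[symmetric] algebra_simps)
qed

lemma laplace_integrand_limit:
  "((\<lambda>T. laplace_integrand a T x) \<longlongrightarrow> exp (- (3 / 2 * a * x\<^sup>2))) at_top"
proof -
  have "((\<lambda>T::real. x / sqrt T) \<longlongrightarrow> 0) at_top" by real_asymp
  then have "((\<lambda>T. (1 + x / sqrt T) *
     exp (- (a * x\<^sup>2 * (1 / (1 + x / sqrt T) + 1 / (2 * (1 + x / sqrt T)\<^sup>2))))) \<longlongrightarrow>
     (1 + 0) * exp (- (a * x\<^sup>2 * (1 / (1 + 0) + 1 / (2 * (1 + 0)\<^sup>2))))) at_top"
    by (intro tendsto_intros) auto
  then have lim: "((\<lambda>T. (1 + x / sqrt T) *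
     exp (- (a * x\<^sup>2 * (1 / (1 + x / sqrt T) + 1 / (2 * (1 + x / sqrt T)\<^sup>2))))) \<longlongrightarrow>
     exp (- (3 / 2 * a * x\<^sup>2))) at_top" by (simp add: mult_ac)
  have "\<forall>\<^sub>F T in at_top. - sqrt T < x" by real_asymp
  then have "\<forall>\<^sub>F T in at_top. (1 + x / sqrt T) *
     exp (- (a * x\<^sup>2 * (1 / (1 + x / sqrt T) + 1 / (2 * (1 + x / sqrt T)\<^sup>2)))) = laplace_integrand a T x"
    by (rule eventually_mono) (simp add: laplace_integrand_def)
  with lim show ?thesis by (rule Lim_transform_eventually)
qed

lemma laplace_integrand_integral_limit:
  fixes a :: real assumes a: "a > 0"
  shows "((\<lambda>T. LINT x|lborel. laplace_integrand a T x) \<longlongrightarrow> sqrt (2 * pi / (3 * a))) at_top"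
proof -
  have "((\<lambda>T. LINT x|lborel. laplace_integrand a T x) \<longlongrightarrow> (LINT x|lborel. exp (- (3 / 2 * a * x\<^sup>2)))) at_top"
  proof (rule integral_dominated_convergence_at_top)
    show "integrable lborel (\<lambda>x. exp a * (exp (- (a * \<bar>x\<bar>)) + \<bar>x\<bar> * exp (- (a * \<bar>x\<bar>))))"
      using integrable_abs_power_exp[OF a, of 0] integrable_abs_power_exp[OF a, of 1] by auto
    show "\<forall>\<^sub>F T in at_top. AE x in lborel. norm (laplace_integrand a T x)
        \<le> exp a * (exp (- (a * \<bar>x\<bar>)) + \<bar>x\<bar> * exp (- (a * \<bar>x\<bar>)))"
      using eventually_ge_at_top[of 1] by eventually_elim (use a laplace_integrand_bound in auto)
    show "AE x in lborel. ((\<lambda>T. laplace_integrand a T x) \<longlongrightarrow> exp (- (3 / 2 * a * x\<^sup>2))) at_top"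
      by (intro AE_I2 laplace_integrand_limit)
  qed auto
  also have "(LINT x|lborel. exp (- (3 / 2 * a * x\<^sup>2))) = sqrt (pi / (3 / 2 * a))"
    using gaussian_integral[of "3 / 2 * a"] a by simp
  finally show ?thesis by (simp add: field_simps)
qed

text \<open>The factor \<open>exp (- pi^2 t / (2 r^2))\<close> is the ground state decay of Brownian
  motion killed on leaving an interval of length \<open>r\<close>; \<open>exp (- lam r)\<close> is
  the weight of that length in the mixture representing \<open>exp (- lam R)\<close>.\<close>

definition exit_kernel :: "real \<Rightarrow> real \<Rightarrow> real \<Rightarrow> real" where
  "exit_kernel lam t r = exp (- (lam * r) - pi\<^sup>2 * t / (2 * r\<^sup>2))"

lemma exit_kernel_measurable [measurable]: "exit_kernel lam t \<in> borel_measurable borel"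
  unfolding exit_kernel_def[abs_def] by measurable

lemma exit_kernel_pos: "exit_kernel lam t r > 0" by (simp add: exit_kernel_def)

lemma exit_kernel_integrable:
  assumes "lam > 0" "t \<ge> 0"
  shows "set_integrable lborel {0<..} (\<lambda>r. r ^ k * exit_kernel lam t r)"
proof (rule set_integrable_bound[OF integrable_power_exp[OF assms(1), of k]])
  show "set_borel_measurable lborel {0<..} (\<lambda>r. r ^ k * exit_kernel lam t r)"
    unfolding set_borel_measurable_def by measurable
qed (use assms in \<open>auto simp: exit_kernel_def intro!: mult_left_mono\<close>)

text \<open>An exact change of variables rather than an asymptotic statement, so that the only limit
  to be taken is that of the integral of \<open>laplace_integrand\<close>. Writing the time as
  \<open>T ^ 3\<close> puts the saddle point at \<open>s * T\<close>.\<close>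

lemma exit_kernel_integral_eq:
  fixes lam T s :: real
  assumes lam: "lam > 0" and T: "T > 0" and s: "s > 0" and s3: "lam * s ^ 3 = pi\<^sup>2"
  shows "(LINT r:{0<..}|lborel. r * exit_kernel lam (T ^ 3) r) =
     s\<^sup>2 * (T * sqrt T) * exp (- (3 / 2 * (lam * s * T))) * (LINT x|lborel. laplace_integrand (lam * s) T x)"
proof -
  \<comment> \<open>The width of the saddle: \<open>r = s * T + c * x\<close> equals
    \<open>s * T * w\<close> with \<open>w = 1 + x / sqrt T\<close>, and \<open>c\<close> is the
    Jacobian.\<close>
  define c where "c = s * sqrt T"
  have sT: "sqrt T > 0" "sqrt T * sqrt T = T" using T by auto
  have c: "c > 0" using s sT by (simp add: c_def)
  have "(LINT r:{0<..}|lborel. r * exit_kernel lam (T ^ 3) r) =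
     \<bar>c\<bar> *\<^sub>R (LINT x|lborel. indicator {0<..} (s * T + c * x) *\<^sub>R ((s * T + c * x) * exit_kernel lam (T ^ 3) (s * T + c * x)))"
    unfolding set_lebesgue_integral_def using c by (intro lborel_integral_real_affine) auto
  also have "(\<lambda>x. indicator {0<..} (s * T + c * x) *\<^sub>R ((s * T + c * x) * exit_kernel lam (T ^ 3) (s * T + c * x))) =
     (\<lambda>x. (s * T * exp (- (3 / 2 * (lam * s * T)))) * laplace_integrand (lam * s) T x)"
  proof
    fix x
    define w where "w = 1 + x / sqrt T"
    have eq: "s * T + c * x = s * T * w"
      using sT by (simp add: w_def c_def field_simps)
    have iff: "s * T + c * x > 0 \<longleftrightarrow> x > - sqrt T"
    proof -
      have "0 < a * b \<longleftrightarrow> 0 < b" if "0 < a" for a b :: real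
        using that by (simp add: zero_less_mult_iff)
      from this[of "s * T" w] have "s * T + c * x > 0 \<longleftrightarrow> w > 0" unfolding eq using s T by simp
      also have "\<dots> \<longleftrightarrow> x > - sqrt T" using sT by (auto simp: w_def field_simps)
      finally show ?thesis .
    qed
    show "indicator {0<..} (s * T + c * x) *\<^sub>R ((s * T + c * x) * exit_kernel lam (T ^ 3) (s * T + c * x)) =
       (s * T * exp (- (3 / 2 * (lam * s * T)))) * laplace_integrand (lam * s) T x"
    proof (cases "x > - sqrt T")
      case True
      then have w: "w > 0" using sT by (simp add: w_def field_simps)
      have xw: "x\<^sup>2 = T * (w - 1)\<^sup>2" using T by (simp add: w_def power_divide)
      have "pi\<^sup>2 * T ^ 3 / (2 * (s * T * w)\<^sup>2) = lam * s * T / (2 * w\<^sup>2)"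
        unfolding s3[symmetric] using s T w by (simp add: field_simps power2_eq_square power3_eq_cube)
      moreover have "lam * s * T * w + lam * s * T / (2 * w\<^sup>2) =
         3 / 2 * (lam * s * T) + lam * s * x\<^sup>2 * (1 / w + 1 / (2 * w\<^sup>2))"
        unfolding xw using w by (simp add: field_simps power2_eq_square)
      ultimately have "exit_kernel lam (T ^ 3) (s * T * w) =
         exp (- (3 / 2 * (lam * s * T))) * exp (- (lam * s * x\<^sup>2 * (1 / w + 1 / (2 * w\<^sup>2))))"
        unfolding exit_kernel_def exp_add[symmetric] by (intro arg_cong[where f=exp]) (simp add: mult_ac)
      then show ?thesis using True iff unfolding eq
        by (simp add: laplace_integrand_def w_def[symmetric])
    next
      case False
      then show ?thesis using iff by (simp add: laplace_integrand_def indicator_def)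
    qed
  qed
  finally show ?thesis using c sT by (simp add: c_def power2_eq_square mult_ac)
qed

section \<open>Leading asymptotics, the resulting constant, and two negligible variants\<close>

definition ibm_scale :: "real \<Rightarrow> real \<Rightarrow> real" where
  "ibm_scale lam t = t powr (- 1 / 2) * exp (3 / 2 * pi powr (2 / 3) * lam powr (2 / 3) * t powr (1 / 3))"

text \<open>With \<open>T = t^(1/3)\<close> the prefactor \<open>T * sqrt T\<close> is
  \<open>t^(1/2)\<close>, which cancels the power in \<open>ibm_scale\<close>, and
  \<open>lam * s = pi^(2/3) lam^(2/3)\<close> makes the exponentials cancel. What remains converges
  to the Gaussian integral.\<close>

lemma exit_kernel_asymptotics:
  fixes lam :: real assumes lam: "lam > 0"
  shows "((\<lambda>t. ibm_scale lam t * (lam\<^sup>2 * (8 / pi\<^sup>2) * (LINT r:{0<..}|lborel. r * exit_kernel lam t r)))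
     \<longlongrightarrow> 2 powr (7 / 2) * lam / sqrt (3 * pi)) at_top"
proof -
  define s where "s = (pi\<^sup>2 / lam) powr (1 / 3)"
  have s: "s > 0" using lam by (simp add: s_def)
  have s3: "lam * s ^ 3 = pi\<^sup>2"
    using lam by (simp add: s_def powr_power)
  have ls: "lam * s = pi powr (2 / 3) * lam powr (2 / 3)"
  proof -
    have "(pi powr 2) powr (1 / 3) = pi powr (2 / 3)" by (simp only: powr_powr) simp
    then have "s = pi powr (2 / 3) / lam powr (1 / 3)"
      using lam by (simp add: s_def powr_divide)
    then have "lam * s = pi powr (2 / 3) * (lam powr 1 / lam powr (1/3))" using lam by simp
    also have "lam powr 1 / lam powr (1/3) = lam powr (2 / 3)" by (simp only: powr_diff[symmetric]) simp
    finally show ?thesis .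
  qed
  have "((\<lambda>T. lam\<^sup>2 * (8 / pi\<^sup>2) * s\<^sup>2 * (LINT x|lborel. laplace_integrand (lam * s) T x))
     \<longlongrightarrow> lam\<^sup>2 * (8 / pi\<^sup>2) * s\<^sup>2 * sqrt (2 * pi / (3 * (lam * s)))) at_top"
    using lam s by (intro tendsto_mult_left laplace_integrand_integral_limit) simp
  moreover have "filterlim (\<lambda>t::real. t powr (1 / 3)) at_top at_top" by real_asymp
  ultimately have "((\<lambda>t. lam\<^sup>2 * (8 / pi\<^sup>2) * s\<^sup>2 * (LINT x|lborel. laplace_integrand (lam * s) (t powr (1 / 3)) x))
     \<longlongrightarrow> lam\<^sup>2 * (8 / pi\<^sup>2) * s\<^sup>2 * sqrt (2 * pi / (3 * (lam * s)))) at_top"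
    by (rule filterlim_compose)
  moreover have "\<forall>\<^sub>F t in at_top. lam\<^sup>2 * (8 / pi\<^sup>2) * s\<^sup>2 * (LINT x|lborel. laplace_integrand (lam * s) (t powr (1 / 3)) x)
     = ibm_scale lam t * (lam\<^sup>2 * (8 / pi\<^sup>2) * (LINT r:{0<..}|lborel. r * exit_kernel lam t r))"
    using eventually_gt_at_top[of 0]
  proof eventually_elim
    fix t :: real assume t: "t > 0"
    define T where "T = t powr (1 / 3)"
    have T: "T > 0" "T ^ 3 = t" using t by (auto simp: T_def powr_power)
    have half: "T * sqrt T = t powr (1 / 2)"
      using t unfolding T_def by (simp add: powr_half_sqrt[symmetric] powr_powr powr_add[symmetric])
    have eq: "(LINT r:{0<..}|lborel. r * exit_kernel lam t r) =
       s\<^sup>2 * (t powr (1 / 2)) * exp (- (3 / 2 * (lam * s * T))) * (LINT x|lborel. laplace_integrand (lam * s) T x)"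
      using exit_kernel_integral_eq[OF lam T(1) s s3] T half by simp
    have "t powr (- 1 / 2) * t powr (1 / 2) = 1" using t by (simp add: powr_add[symmetric])
    moreover have "exp (3 / 2 * (lam * s * T)) * exp (- (3 / 2 * (lam * s * T))) = 1"
      by (simp add: exp_add[symmetric])
    moreover have "ibm_scale lam t = t powr (- 1 / 2) * exp (3 / 2 * (lam * s * T))"
      by (simp add: ibm_scale_def ls T_def mult_ac)
    moreover have "(P * E) * (A * (S * Q * F * L)) = (P * Q) * (E * F) * (A * S * L)" for P E A S Q F L :: real by simp
    ultimately show "lam\<^sup>2 * (8 / pi\<^sup>2) * s\<^sup>2 * (LINT x|lborel. laplace_integrand (lam * s) (t powr (1 / 3)) x)
     = ibm_scale lam t * (lam\<^sup>2 * (8 / pi\<^sup>2) * (LINT r:{0<..}|lborel. r * exit_kernel lam t r))"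
      unfolding eq T_def[symmetric] by (simp only: mult_1)
  qed
  ultimately have lim: "((\<lambda>t. ibm_scale lam t * (lam\<^sup>2 * (8 / pi\<^sup>2) * (LINT r:{0<..}|lborel. r * exit_kernel lam t r)))
     \<longlongrightarrow> lam\<^sup>2 * (8 / pi\<^sup>2) * s\<^sup>2 * sqrt (2 * pi / (3 * (lam * s)))) at_top"
    by (rule Lim_transform_eventually)
  have "lam\<^sup>2 * (8 / pi\<^sup>2) * s\<^sup>2 * sqrt (2 * pi / (3 * (lam * s))) = 2 powr (7 / 2) * lam / sqrt (3 * pi)"
  \<comment> \<open>Both sides are nonnegative, and squaring removes the roots and the half-integer
    power of \<open>2\<close>; the common square is \<open>128 lam^2 / (3 pi)\<close>.\<close>
  proof (rule power2_eq_imp_eq)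
    have s4: "s ^ 4 = s * (pi\<^sup>2 / lam)" using s3 lam by (simp add: field_simps power_Suc numeral_eq_Suc)
    have p8: "(2 powr (7/2) :: real)\<^sup>2 = 128"
      by (simp add: powr_power)
    have "(lam\<^sup>2 * (8 / pi\<^sup>2) * s\<^sup>2 * sqrt (2 * pi / (3 * (lam * s))))\<^sup>2 =
       lam ^ 4 * (64 / pi ^ 4) * s ^ 4 * (2 * pi / (3 * (lam * s)))"
      using lam s by (simp add: power_mult_distrib power_divide flip: power_mult)
    also have "\<dots> = 128 * lam\<^sup>2 / (3 * pi)" unfolding s4
      using lam s by (simp add: field_simps numeral_eq_Suc)
    also have "\<dots> = (2 powr (7 / 2) * lam / sqrt (3 * pi))\<^sup>2"
      by (simp add: power_mult_distrib power_divide p8)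
    finally show "(lam\<^sup>2 * (8 / pi\<^sup>2) * s\<^sup>2 * sqrt (2 * pi / (3 * (lam * s))))\<^sup>2 = (2 powr (7 / 2) * lam / sqrt (3 * pi))\<^sup>2" .
  qed (use lam s in auto)
  then show ?thesis using lim by simp
qed

lemma ibm_scale_nonneg: "ibm_scale lam t \<ge> 0" by (simp add: ibm_scale_def)

lemma ibm_scale_exp_tendsto_0:
  assumes "b > 0" "lam > 0" shows "((\<lambda>t. ibm_scale lam t * exp (- (b * t))) \<longlongrightarrow> 0) at_top"
proof -
  define c where "c = 3 / 2 * pi powr (2 / 3) * lam powr (2 / 3)"
  have "c > 0" using assms by (simp add: c_def)
  then have "((\<lambda>t::real. t powr (- 1 / 2) * exp (c * t powr (1 / 3)) * exp (- (b * t))) \<longlongrightarrow> 0) at_top"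
    using assms by real_asymp
  then show ?thesis by (simp add: ibm_scale_def c_def)
qed

text \<open>The odd modes other than the first decay at least nine times as fast.\<close>

lemma exit_kernel_asymptotics_9:
  fixes lam :: real assumes lam: "lam > 0"
  shows "((\<lambda>t. ibm_scale lam t * (LINT r:{0<..}|lborel. r * exit_kernel lam (9 * t) r)) \<longlongrightarrow> 0) at_top"
proof -
  define c where "c = 3 / 2 * pi powr (2 / 3) * lam powr (2 / 3)"
  have c: "c > 0" using lam by (simp add: c_def)
  define C where "C = 2 powr (7 / 2) * lam / sqrt (3 * pi)"
  have lim9: "((\<lambda>t. ibm_scale lam (9 * t) * (lam\<^sup>2 * (8 / pi\<^sup>2) * (LINT r:{0<..}|lborel. r * exit_kernel lam (9 * t) r)))
     \<longlongrightarrow> C) at_top" unfolding C_def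
    by (rule filterlim_compose[OF exit_kernel_asymptotics[OF lam]]) real_asymp
  \<comment> \<open>Positive because \<open>9^(1/3) > 1\<close>. The scale at \<open>9 * t\<close>
    exceeds the scale at \<open>t\<close> by \<open>exp (d t^(1/3)) / 3\<close>, which is the gain
    that makes the higher modes vanish.\<close>
  define d where "d = c * (9 powr (1 / 3) - 1)"
  have d: "d > 0" using c by (simp add: d_def)
  have "((\<lambda>t::real. 9 powr (1 / 2) * exp (- (d * t powr (1 / 3)))) \<longlongrightarrow> 0) at_top"
    using d by real_asymp
  moreover have "\<forall>\<^sub>F t in at_top. 9 powr (1 / 2) * exp (- (d * t powr (1 / 3))) = ibm_scale lam t / ibm_scale lam (9 * t)"
    using eventually_gt_at_top[of 0]
  proof eventually_elim
    fix t :: real assume t: "t > 0"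
    have "ibm_scale lam t / ibm_scale lam (9 * t) =
      (t powr (- 1 / 2) / (9 * t) powr (- 1 / 2)) * (exp (c * t powr (1 / 3)) / exp (c * (9 * t) powr (1 / 3)))"
      by (simp add: ibm_scale_def c_def)
    also have "t powr (- 1 / 2) / (9 * t) powr (- 1 / 2) = 9 powr (1 / 2)"
      using t by (simp add: powr_mult powr_minus field_simps)
    also have "exp (c * t powr (1 / 3)) / exp (c * (9 * t) powr (1 / 3)) = exp (- (d * t powr (1 / 3)))"
      using t by (simp add: exp_diff[symmetric] powr_mult d_def algebra_simps)
    finally show "9 powr (1 / 2) * exp (- (d * t powr (1 / 3))) = ibm_scale lam t / ibm_scale lam (9 * t)" ..
  qed
  ultimately have "((\<lambda>t. ibm_scale lam t / ibm_scale lam (9 * t)) \<longlongrightarrow> 0) at_top"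
    by (rule Lim_transform_eventually)
  with lim9 have "((\<lambda>t. pi\<^sup>2 / (8 * lam\<^sup>2) * ((ibm_scale lam t / ibm_scale lam (9 * t)) * (ibm_scale lam (9 * t) * (lam\<^sup>2 * (8 / pi\<^sup>2) * (LINT r:{0<..}|lborel. r * exit_kernel lam (9 * t) r)))))
     \<longlongrightarrow> pi\<^sup>2 / (8 * lam\<^sup>2) * (0 * C)) at_top"
    by (intro tendsto_intros)
  then have lim: "((\<lambda>t. pi\<^sup>2 / (8 * lam\<^sup>2) * ((ibm_scale lam t / ibm_scale lam (9 * t)) * (ibm_scale lam (9 * t) * (lam\<^sup>2 * (8 / pi\<^sup>2) * (LINT r:{0<..}|lborel. r * exit_kernel lam (9 * t) r)))))
     \<longlongrightarrow> 0) at_top" by simp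
  show ?thesis
  proof (rule Lim_transform_eventually[OF lim])
    show "\<forall>\<^sub>F t in at_top. pi\<^sup>2 / (8 * lam\<^sup>2) * ((ibm_scale lam t / ibm_scale lam (9 * t)) * (ibm_scale lam (9 * t) * (lam\<^sup>2 * (8 / pi\<^sup>2) * (LINT r:{0<..}|lborel. r * exit_kernel lam (9 * t) r)))) =
      ibm_scale lam t * (LINT r:{0<..}|lborel. r * exit_kernel lam (9 * t) r)"
      using eventually_gt_at_top[of 0]
    proof eventually_elim
      fix t :: real assume "t > 0"
      then have "ibm_scale lam (9 * t) > 0" by (simp add: ibm_scale_def)
      then show "pi\<^sup>2 / (8 * lam\<^sup>2) * ((ibm_scale lam t / ibm_scale lam (9 * t)) * (ibm_scale lam (9 * t) * (lam\<^sup>2 * (8 / pi\<^sup>2) * (LINT r:{0<..}|lborel. r * exit_kernel lam (9 * t) r)))) =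
        ibm_scale lam t * (LINT r:{0<..}|lborel. r * exit_kernel lam (9 * t) r)"
        using lam by simp
    qed
  qed
qed

text \<open>The mass of the integrand sits near \<open>r = s t^(1/3)\<close>, so omitting the weight
  \<open>r\<close> makes the integral smaller by an unbounded factor. The proof splits at a fixed
  \<open>A\<close>: below it the kernel is at most \<open>exp (- b t)\<close>, which beats
  \<open>ibm_scale\<close>, and above it \<open>1 \<le> r / A\<close> reduces to the weighted
  integral, whose scaled value stays bounded.\<close>

lemma exit_kernel_integral_0_tendsto:
  fixes lam :: real assumes lam: "lam > 0"
  shows "((\<lambda>t. ibm_scale lam t * (LINT r:{0<..}|lborel. exit_kernel lam t r)) \<longlongrightarrow> 0) at_top"
proof (rule tendstoI)
  let ?I = "\<lambda>t. LINT r:{0<..}|lborel. r * exit_kernel lam t r"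
  fix e :: real assume e: "e > 0"
  define K where "K = lam\<^sup>2 * (8 / pi\<^sup>2)"
  have K: "K > 0" using lam by (simp add: K_def)
  define C where "C = (2 powr (7 / 2) * lam / sqrt (3 * pi) + 1) / K"
  have C: "C > 0" using K lam by (simp add: C_def add_pos_pos)
  \<comment> \<open>\<open>C\<close> eventually bounds the scaled integral with weight
    \<open>r\<close>, so the part above \<open>A\<close> contributes at most
    \<open>C / A = e / 2\<close>.\<close>
  define A where "A = 2 * C / e"
  have A: "A > 0" using C e by (simp add: A_def)
  define b where "b = pi\<^sup>2 / (2 * A\<^sup>2)"
  have b: "b > 0" using A by (simp add: b_def)
  have "\<forall>\<^sub>F t in at_top. ibm_scale lam t * (K * ?I t) < 2 powr (7 / 2) * lam / sqrt (3 * pi) + 1"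
    using order_tendstoD(2)[OF exit_kernel_asymptotics[OF lam]] by (simp add: K_def)
  moreover have "\<forall>\<^sub>F t in at_top. A * (ibm_scale lam t * exp (- (b * t))) < e / 2"
    using order_tendstoD(2)[OF tendsto_mult_left[OF ibm_scale_exp_tendsto_0[OF b lam], of A], of "e / 2"] e by simp
  ultimately show "\<forall>\<^sub>F t in at_top. dist (ibm_scale lam t * (LINT r:{0<..}|lborel. exit_kernel lam t r)) 0 < e"
    using eventually_gt_at_top[of 0]
  proof eventually_elim
    fix t :: real assume 1: "ibm_scale lam t * (K * ?I t) < 2 powr (7 / 2) * lam / sqrt (3 * pi) + 1"
      and 2: "A * (ibm_scale lam t * exp (- (b * t))) < e / 2" and t: "t > 0"
    have int0: "integrable lborel (\<lambda>r. indicator {0<..} r * exit_kernel lam t r)"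
      using exit_kernel_integrable[OF lam, of t 0] t by (simp add: set_integrable_def)
    have int1: "integrable lborel (\<lambda>r. indicator {0<..} r * (r * exit_kernel lam t r))"
      using exit_kernel_integrable[OF lam, of t 1] t by (simp add: set_integrable_def)
    have le: "indicator {0<..} r * exit_kernel lam t r \<le>
       exp (- (b * t)) * indicator {0..A} r + 1 / A * (indicator {0<..} r * (r * exit_kernel lam t r))" for r
    proof -
      consider "r \<le> 0" | "0 < r" "r \<le> A" | "A < r" by linarith
      then show ?thesis
      proof cases
        case 2
        have "1 / A\<^sup>2 \<le> 1 / r\<^sup>2" using 2 by (intro divide_left_mono power_mono) auto
        then have "pi\<^sup>2 * t / 2 * (1 / A\<^sup>2) \<le> pi\<^sup>2 * t / 2 * (1 / r\<^sup>2)" using t by (intro mult_left_mono) auto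
        then have "b * t \<le> pi\<^sup>2 * t / (2 * r\<^sup>2)" unfolding b_def by (simp add: mult_ac)
        moreover have "0 < lam * r" using lam 2 by simp
        ultimately have "b * t \<le> lam * r + pi\<^sup>2 * t / (2 * r\<^sup>2)" by linarith
        then have "exit_kernel lam t r \<le> exp (- (b * t))" by (simp add: exit_kernel_def)
        moreover have "0 \<le> 1 / A * (r * exit_kernel lam t r)" using 2 A exit_kernel_pos[of lam t r] by simp
        ultimately show ?thesis using 2 by simp
      next
        case 3
        have "A * exit_kernel lam t r \<le> r * exit_kernel lam t r"
          using 3 exit_kernel_pos[of lam t r] by (intro mult_right_mono) auto
        then show ?thesis using 3 A by (simp add: field_simps)
      qed auto
    qed
    have "(LINT r:{0<..}|lborel. exit_kernel lam t r) \<le>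
       (LINT r|lborel. exp (- (b * t)) * indicator {0..A} r + 1 / A * (indicator {0<..} r * (r * exit_kernel lam t r)))"
      unfolding set_lebesgue_integral_def real_scaleR_def
      using int0 int1 le
      by (intro integral_mono Bochner_Integration.integrable_add integrable_mult_right integrable_real_indicator)
         (auto simp: emeasure_lborel_Icc_eq)
    also have "\<dots> = exp (- (b * t)) * A + 1 / A * ?I t"
      unfolding set_lebesgue_integral_def real_scaleR_def using int1 A
      by (subst Bochner_Integration.integral_add) auto
    finally have "ibm_scale lam t * (LINT r:{0<..}|lborel. exit_kernel lam t r) \<le>
      ibm_scale lam t * (exp (- (b * t)) * A + 1 / A * ?I t)"
      by (rule mult_left_mono[OF _ ibm_scale_nonneg])
    also have "\<dots> = A * (ibm_scale lam t * exp (- (b * t))) + 1 / A * (ibm_scale lam t * ?I t)"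
      by (simp add: algebra_simps)
    also have "\<dots> < e / 2 + e / 2"
    proof -
      have "ibm_scale lam t * ?I t < C" using 1 K by (simp add: C_def field_simps)
      then have "1 / A * (ibm_scale lam t * ?I t) < 1 / A * C" using A by (intro mult_strict_left_mono) auto
      also have "\<dots> = e / 2" using C e by (simp add: A_def)
      finally show ?thesis using 2 by linarith
    qed
    finally have "ibm_scale lam t * (LINT r:{0<..}|lborel. exit_kernel lam t r) < e" by simp
    moreover have "0 \<le> (LINT r:{0<..}|lborel. exit_kernel lam t r)"
      unfolding set_lebesgue_integral_def using exit_kernel_pos[of lam t]
      by (intro integral_nonneg_AE AE_I2) (simp add: indicator_def less_imp_le)
    ultimately show "dist (ibm_scale lam t * (LINT r:{0<..}|lborel. exit_kernel lam t r)) 0 < e"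
      using ibm_scale_nonneg by simp
  qed
qed

section \<open>The square wave\<close>

text \<open>Dirichlet eigenfunctions of \<open>[0, r]\<close> with odd frequency
  \<open>2 * i + 1\<close>. Those of even frequency are antisymmetric about \<open>r / 2\<close> and
  do not occur in the expansion of a constant.\<close>

definition odd_sine :: "real \<Rightarrow> nat \<Rightarrow> real \<Rightarrow> real" where
  "odd_sine r i x = sin (real (2 * i + 1) * pi / r * x)"

text \<open>Partial Fourier sine sum of the constant \<open>1\<close> on
  \<open>[0, r]\<close>.\<close>

definition square_wave :: "real \<Rightarrow> nat \<Rightarrow> real \<Rightarrow> real" where
  "square_wave r n x = (\<Sum>i<n. 4 / (pi * real (2 * i + 1)) * odd_sine r i x)"

lemma odd_sine_continuous [continuous_intros]: "continuous_on A (odd_sine r i)"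
  unfolding odd_sine_def[abs_def] by (intro continuous_intros)

lemma square_wave_continuous [continuous_intros]: "continuous_on A (square_wave r i)"
  unfolding square_wave_def[abs_def] by (intro continuous_intros)

lemma odd_sine_measurable [measurable]: "odd_sine r i \<in> borel_measurable borel"
  by (intro borel_measurable_continuous_onI continuous_intros)

lemma square_wave_measurable [measurable]: "square_wave r i \<in> borel_measurable borel"
  by (intro borel_measurable_continuous_onI continuous_intros)

lemma set_integrable_continuous_interval:
  fixes f :: "real \<Rightarrow> real"
  assumes "continuous_on {0..r} f"
  shows "set_integrable lborel {0..r} f"
  unfolding set_integrable_def by (rule borel_integrable_compact) (use assms in auto)

lemma set_integral_sum:
  fixes f :: "'i \<Rightarrow> real \<Rightarrow> real"
  assumes "\<And>i. i \<in> I \<Longrightarrow> set_integrable M A (f i)"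
  shows "(LINT x:A|M. \<Sum>i\<in>I. f i x) = (\<Sum>i\<in>I. LINT x:A|M. f i x)"
  using assms unfolding set_lebesgue_integral_def set_integrable_def scaleR_sum_right
  by (rule Bochner_Integration.integral_sum)

lemma set_integral_alt:
  fixes f :: "'a \<Rightarrow> real"
  shows "(LINT x:A|M. f x) = (LINT x|M. f x * indicator A x)"
  by (simp add: set_lebesgue_integral_def mult.commute)

lemma LINT_odd_sine:
  assumes r: "r > 0"
  shows "(LINT x:{0..r}|lborel. odd_sine r i x) = 2 * r / (pi * real (2 * i + 1))"
proof -
  let ?c = "real (2 * i + 1) * pi / r"
  have c: "?c > 0" using r by simp
  have "(\<integral>x. odd_sine r i x * indicator {0..r} x \<partial>lborel) = - cos (?c * r) / ?c - - cos (?c * 0) / ?c"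
  proof (rule integral_FTC_Icc_real)
    show "DERIV (\<lambda>x. - cos (?c * x) / ?c) x :> odd_sine r i x" for x
      using c unfolding odd_sine_def by (auto intro!: derivative_eq_intros)
    show "isCont (odd_sine r i) x" for x
      using odd_sine_continuous[of UNIV] by (simp add: continuous_on_eq_continuous_at)
  qed (use r in simp)
  also have "cos (?c * r) = -1"
  proof -
    have "?c * r = 2 * real i * pi + pi" using r by (simp add: field_simps)
    then have "cos (?c * r) = 1 * (-1) - sin (2 * real i * pi) * 0"
      by (simp only: cos_add cos_2npi cos_pi sin_pi)
    then show ?thesis by simp
  qed
  finally show ?thesis using r by (simp add: set_integral_alt field_simps)
qed

lemma LINT_cos_full_period:
  assumes r: "r > 0" and k: "k > (0::nat)"
  shows "(LINT x:{0..r}|lborel. cos (real (2 * k) * pi / r * x)) = 0"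
proof -
  let ?c = "real (2 * k) * pi / r"
  have c: "?c > 0" using r k by simp
  have "(\<integral>x. cos (?c * x) * indicator {0..r} x \<partial>lborel) = sin (?c * r) / ?c - sin (?c * 0) / ?c"
  proof (rule integral_FTC_Icc_real)
    show "DERIV (\<lambda>x. sin (?c * x) / ?c) x :> cos (?c * x)" for x
      using c k r by (auto intro!: derivative_eq_intros)
    show "isCont (\<lambda>x. cos (?c * x)) x" for x by (intro continuous_intros)
  qed (use r in simp)
  also have "sin (?c * r) = 0"
  proof -
    have "?c * r = real (2 * k) * pi" using r by simp
    then show ?thesis by (simp only: sin_npi)
  qed
  finally show ?thesis by (simp add: set_integral_alt)
qed

lemma LINT_odd_sine_mult:
  assumes r: "r > 0"
  shows "(LINT x:{0..r}|lborel. odd_sine r i x * odd_sine r j x) = (if i = j then r / 2 else 0)"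
proof -
  have *: "(LINT x:{0..r}|lborel. odd_sine r i x * odd_sine r j x) = (if i = j then r / 2 else 0)" if "j \<le> i" for i j
  proof -
    let ?f = "\<lambda>k x. cos (real (2 * k) * pi / r * x) / 2"
    have prod: "odd_sine r i x * odd_sine r j x = ?f (i - j) x - ?f (i + j + 1) x" for x
    proof -
      have "real (2 * i + 1) * pi / r * x - real (2 * j + 1) * pi / r * x = (real (2 * i + 1) - real (2 * j + 1)) * pi / r * x"
        "real (2 * i + 1) * pi / r * x + real (2 * j + 1) * pi / r * x = (real (2 * i + 1) + real (2 * j + 1)) * pi / r * x"
        by (simp_all only: left_diff_distrib distrib_right diff_divide_distrib add_divide_distrib)
      moreover have "real (2 * i + 1) - real (2 * j + 1) = real (2 * (i - j))"
        "real (2 * i + 1) + real (2 * j + 1) = real (2 * (i + j + 1))"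
        using that by (simp_all add: of_nat_diff)
      ultimately show ?thesis unfolding odd_sine_def sin_times_sin by (simp only: diff_divide_distrib)
    qed
    have int: "set_integrable lborel {0..r} (?f k)" for k
      by (intro set_integrable_continuous_interval continuous_intros) simp
    have "(LINT x:{0..r}|lborel. odd_sine r i x * odd_sine r j x) =
       (LINT x:{0..r}|lborel. ?f (i - j) x) - (LINT x:{0..r}|lborel. ?f (i + j + 1) x)"
      unfolding prod by (rule set_integral_diff(2)[OF int int])
    also have "(LINT x:{0..r}|lborel. ?f (i + j + 1) x) = 0"
      using LINT_cos_full_period[OF r, of "i + j + 1"] by (simp add: set_integral_divide_zero)
    also have "(LINT x:{0..r}|lborel. ?f (i - j) x) = (if i = j then r / 2 else 0)"
    proof (cases "i = j")
      case True then show ?thesis using r by (simp add: set_lebesgue_integral_def)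
    next
      case False
      then show ?thesis using that LINT_cos_full_period[OF r, of "i - j"] by (simp add: set_integral_divide_zero)
    qed
    finally show ?thesis by simp
  qed
  show ?thesis
  proof (cases "j \<le> i")
    case True then show ?thesis by (rule *)
  next
    case False
    then have "i \<le> j" by simp
    from *[OF this] False show ?thesis by (simp add: mult.commute)
  qed
qed

text \<open>Grouping the Basel series in pairs separates odd from even denominators. The even ones
  form a quarter of the whole series, and \<open>pi^2 / 6 - pi^2 / 24 = pi^2 / 8\<close>.\<close>

lemma inverse_odd_squares_sums: "(\<lambda>i. 1 / (real (2 * i + 1))\<^sup>2) sums (pi\<^sup>2 / 8)"
proof -
  have all: "(\<lambda>n. 1 / (real n + 1)\<^sup>2) sums (pi\<^sup>2 / 6)" using inverse_squares_sums by (simp add: add_ac)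
  have "(\<lambda>n. \<Sum>i\<in>{n * 2..<n * 2 + 2}. 1 / (real i + 1)\<^sup>2) sums (pi\<^sup>2 / 6)"
    by (rule sums_group[OF all]) simp
  moreover have "{n * 2..<n * 2 + 2} = {2 * n, 2 * n + 1}" for n :: nat by auto
  ultimately have "(\<lambda>n. 1 / (real (2 * n) + 1)\<^sup>2 + 1 / (real (2 * n + 1) + 1)\<^sup>2) sums (pi\<^sup>2 / 6)"
    by (simp add: mult.commute)
  moreover have "1 / (real (2 * n + 1) + 1)\<^sup>2 = 1 / 4 * (1 / (real n + 1)\<^sup>2)" for n
  proof -
    have "real (2 * n + 1) + 1 = 2 * (real n + 1)" by simp
    then show ?thesis by (simp only: power_mult_distrib) simp
  qed
  ultimately have "(\<lambda>n. 1 / (real (2 * n) + 1)\<^sup>2 + 1 / 4 * (1 / (real n + 1)\<^sup>2)) sums (pi\<^sup>2 / 6)" by simp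
  from sums_diff[OF this sums_mult[OF all, of "1 / 4"]] show ?thesis by (simp add: add_ac)
qed

text \<open>Expanding the square and using orthogonality, the cross term contributes
  \<open>- 16 / pi^2\<close> and the diagonal \<open>8 / pi^2\<close>, each times \<open>r\<close>
  and the same partial sum.\<close>

lemma square_wave_L2:
  assumes r: "r > 0"
  shows "(LINT x:{0..r}|lborel. (1 - square_wave r n x)\<^sup>2) =
    r * (1 - 8 / pi\<^sup>2 * (\<Sum>i<n. 1 / (real (2 * i + 1))\<^sup>2))"
proof -
  define c where "c i = 4 / (pi * real (2 * i + 1))" for i :: nat
  define S where "S = (\<Sum>i<n. 1 / (real (2 * i + 1))\<^sup>2)"
  have int_os: "set_integrable lborel {0..r} (odd_sine r i)" for i
    by (intro set_integrable_continuous_interval continuous_intros)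
  have int_oss: "set_integrable lborel {0..r} (\<lambda>x. odd_sine r i x * odd_sine r j x)" for i j
    by (intro set_integrable_continuous_interval continuous_intros)
  have eq: "(1 - square_wave r n x)\<^sup>2 = 1 - 2 * (\<Sum>i<n. c i * odd_sine r i x) +
     (\<Sum>i<n. \<Sum>j<n. c i * c j * (odd_sine r i x * odd_sine r j x))" for x
    unfolding square_wave_def c_def[symmetric] power2_diff
    by (simp add: power2_eq_square sum_product mult_ac)
  have 1: "(LINT x:{0..r}|lborel. 1::real) = r" using r by (simp add: set_lebesgue_integral_def)
  have 2: "(LINT x:{0..r}|lborel. 2 * (\<Sum>i<n. c i * odd_sine r i x)) = 16 * r / pi\<^sup>2 * S"
  proof -
    have "(LINT x:{0..r}|lborel. 2 * (\<Sum>i<n. c i * odd_sine r i x)) = 2 * (\<Sum>i<n. c i * (LINT x:{0..r}|lborel. odd_sine r i x))"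
      unfolding set_integral_mult_right
      by (subst set_integral_sum) (use int_os in \<open>auto simp: set_integral_mult_right\<close>)
    also have "\<dots> = 2 * (\<Sum>i<n. 8 * r / pi\<^sup>2 * (1 / (real (2 * i + 1))\<^sup>2))"
      unfolding LINT_odd_sine[OF r] c_def by (simp add: power2_eq_square mult_ac)
    also have "\<dots> = 16 * r / pi\<^sup>2 * S" unfolding S_def sum_distrib_left by (simp add: mult_ac)
    finally show ?thesis .
  qed
  have 3: "(LINT x:{0..r}|lborel. (\<Sum>i<n. \<Sum>j<n. c i * c j * (odd_sine r i x * odd_sine r j x))) = 8 * r / pi\<^sup>2 * S"
  proof -
    have "(LINT x:{0..r}|lborel. (\<Sum>i<n. \<Sum>j<n. c i * c j * (odd_sine r i x * odd_sine r j x))) =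
      (\<Sum>i<n. (LINT x:{0..r}|lborel. \<Sum>j<n. c i * c j * (odd_sine r i x * odd_sine r j x)))"
      by (rule set_integral_sum) (auto intro!: set_integrable_continuous_interval continuous_intros)
    also have "\<dots> = (\<Sum>i<n. \<Sum>j<n. (LINT x:{0..r}|lborel. c i * c j * (odd_sine r i x * odd_sine r j x)))"
      by (intro sum.cong refl set_integral_sum) (auto intro!: set_integrable_continuous_interval continuous_intros)
    also have "\<dots> = (\<Sum>i<n. \<Sum>j<n. c i * c j * (if i = j then r / 2 else 0))"
      unfolding set_integral_mult_right LINT_odd_sine_mult[OF r] ..
    also have "\<dots> = (\<Sum>i<n. c i * c i * (r / 2))"
      by (intro sum.cong refl) (simp add: if_distrib sum.If_cases cong: if_cong)
    also have "\<dots> = 8 * r / pi\<^sup>2 * S"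
      unfolding S_def sum_distrib_left by (intro sum.cong) (auto simp: c_def power2_eq_square)
    finally show ?thesis .
  qed
  have "(LINT x:{0..r}|lborel. (1 - square_wave r n x)\<^sup>2) = r - 16 * r / pi\<^sup>2 * S + 8 * r / pi\<^sup>2 * S"
    unfolding eq
    by (subst set_integral_add(2), (intro set_integrable_continuous_interval continuous_intros)+,
        subst set_integral_diff(2), (intro set_integrable_continuous_interval continuous_intros)+)
       (simp only: 1 2 3)
  then show ?thesis by (simp add: S_def algebra_simps)
qed

text \<open>The value \<open>pi^2 / 8\<close> makes the L2 defect vanish in the limit, which is
  completeness of the sines tested on the constant \<open>1\<close>. On a bounded interval L2
  convergence passes to L1, here through
  \<open>\<bar>y\<bar> \<le> d / 2 + y^2 / (2 * d)\<close>.\<close>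

lemma square_wave_L1_tendsto:
  assumes r: "r > 0"
  shows "(\<lambda>n. LINT x:{0..r}|lborel. \<bar>1 - square_wave r n x\<bar>) \<longlonglongrightarrow> 0"
proof (rule LIMSEQ_I)
  let ?Q = "\<lambda>n. LINT x:{0..r}|lborel. (1 - square_wave r n x)\<^sup>2"
  fix e :: real assume e: "e > 0"
  \<comment> \<open>The constant term then integrates to \<open>e / 4\<close>, and an L2 defect
    below \<open>d * e\<close> contributes less than \<open>e / 2\<close>.\<close>
  define d where "d = e / (2 * r)"
  have d: "d > 0" using e r by (simp add: d_def)
  have "(\<lambda>n. r * (1 - 8 / pi\<^sup>2 * (\<Sum>i<n. 1 / (real (2 * i + 1))\<^sup>2))) \<longlonglongrightarrow> r * (1 - 8 / pi\<^sup>2 * (pi\<^sup>2 / 8))"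
    using inverse_odd_squares_sums unfolding sums_def by (intro tendsto_intros)
  then have "?Q \<longlonglongrightarrow> 0" unfolding square_wave_L2[OF r] by simp
  then have "\<forall>\<^sub>F n in sequentially. ?Q n < d * e"
    by (rule order_tendstoD) (use d e in simp)
  then obtain N where N: "\<And>n. n \<ge> N \<Longrightarrow> ?Q n < d * e"
    by (auto simp: eventually_sequentially)
  show "\<exists>N. \<forall>n\<ge>N. norm ((LINT x:{0..r}|lborel. \<bar>1 - square_wave r n x\<bar>) - 0) < e"
  proof (intro exI allI impI)
    fix n assume "n \<ge> N"
    have le: "\<bar>y\<bar> \<le> d / 2 + y\<^sup>2 * (1 / (2 * d))" for y :: real
    proof -
      have "0 \<le> (\<bar>y\<bar> - d)\<^sup>2" by simp
      then have "2 * d * \<bar>y\<bar> \<le> d\<^sup>2 + y\<^sup>2" by (simp add: power2_diff mult_ac)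
      then show ?thesis using d by (simp add: field_simps power2_eq_square)
    qed
    have "(LINT x:{0..r}|lborel. \<bar>1 - square_wave r n x\<bar>) \<le>
      (LINT x:{0..r}|lborel. d / 2 + (1 - square_wave r n x)\<^sup>2 * (1 / (2 * d)))"
      using d by (intro set_integral_mono set_integrable_continuous_interval continuous_intros le) auto
    also have "\<dots> = r * (d / 2) + ?Q n * (1 / (2 * d))"
      by (subst set_integral_add(2), (intro set_integrable_continuous_interval continuous_intros)+)
         (use r d in \<open>auto simp: set_lebesgue_integral_def\<close>)
    also have "\<dots> < r * (d / 2) + d * e * (1 / (2 * d))"
      using N[OF \<open>n \<ge> N\<close>] d by (intro add_strict_left_mono mult_strict_right_mono) auto
    also have "\<dots> \<le> e" using d e r by (simp add: d_def field_simps)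
    finally have "(LINT x:{0..r}|lborel. \<bar>1 - square_wave r n x\<bar>) < e" .
    moreover have "0 \<le> (LINT x:{0..r}|lborel. \<bar>1 - square_wave r n x\<bar>)"
      unfolding set_lebesgue_integral_def by (intro integral_nonneg_AE AE_I2) auto
    ultimately show "norm ((LINT x:{0..r}|lborel. \<bar>1 - square_wave r n x\<bar>) - 0) < e" by simp
  qed
qed

lemma inverse_odd_squares_partial_le: "(\<Sum>i<n. 8 / (pi * real (2 * i + 1))\<^sup>2) \<le> 1"
proof -
  have "(\<Sum>i<n. 1 / (real (2 * i + 1))\<^sup>2) \<le> pi\<^sup>2 / 8"
    using sum_le_suminf[OF sums_summable[OF inverse_odd_squares_sums], of "{..<n}"]
      sums_unique[OF inverse_odd_squares_sums] by simp
  then have "8 / pi\<^sup>2 * (\<Sum>i<n. 1 / (real (2 * i + 1))\<^sup>2) \<le> 8 / pi\<^sup>2 * (pi\<^sup>2 / 8)"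
    by (intro mult_left_mono) auto
  then show ?thesis by (simp add: sum_distrib_left power_mult_distrib)
qed

section \<open>Staying events of Brownian motion\<close>

text \<open>A continuous path that meets the open complement of \<open>C\<close> stays in it for a
  while, and a sufficiently fine dyadic grid has a point in that time span. This turns an
  uncountable condition into a countable one.\<close>

lemma path_in_closed_iff_grid:
  fixes f :: "real \<Rightarrow> 'a :: metric_space"
  assumes f: "continuous_on {0..u} f" and C: "closed C" and u: "u \<ge> 0"
  shows "(\<forall>s\<in>{0..u}. f s \<in> C) \<longleftrightarrow> (\<forall>m. \<forall>j\<le>2 ^ m. f (u * real j / 2 ^ m) \<in> C)"
proof
  assume L: "\<forall>s\<in>{0..u}. f s \<in> C"
  show "\<forall>m. \<forall>j\<le>2 ^ m. f (u * real j / 2 ^ m) \<in> C"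
  proof (intro allI impI)
    fix m j :: nat assume "j \<le> 2 ^ m"
    then have "real j \<le> 2 ^ m" by (metis of_nat_le_iff of_nat_numeral of_nat_power)
    then have "u * real j / 2 ^ m \<in> {0..u}"
      using u by (auto simp: field_simps mult_left_mono)
    then show "f (u * real j / 2 ^ m) \<in> C" using L by blast
  qed
next
  assume R: "\<forall>m. \<forall>j\<le>2 ^ m. f (u * real j / 2 ^ m) \<in> C"
  show "\<forall>s\<in>{0..u}. f s \<in> C"
  proof (rule ccontr)
    assume "\<not> (\<forall>s\<in>{0..u}. f s \<in> C)"
    then obtain s where s: "0 \<le> s" "s \<le> u" "f s \<notin> C" by auto
    have "u > 0"
    proof (rule ccontr)
      assume "\<not> u > 0"
      then have "s = u * real 0 / 2 ^ 0" using u s by simp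
      then show False using R s(3) by (metis zero_le)
    qed
    have "open (- C)" using C by auto
    then obtain e where e: "e > 0" "ball (f s) e \<subseteq> - C" using s(3) by (meson ComplI open_contains_ball)
    obtain d where d: "d > 0" "\<And>s'. s' \<in> {0..u} \<Longrightarrow> dist s' s < d \<Longrightarrow> dist (f s') (f s) < e"
      using f s e(1) unfolding continuous_on_iff by (metis atLeastAtMost_iff)
    obtain m where m: "u / d < 2 ^ m" using real_arch_pow[of 2 "u / d"] by auto
    \<comment> \<open>The last grid point not after \<open>s\<close>; its distance to
      \<open>s\<close> is less than one mesh width.\<close>
    define j where "j = nat \<lfloor>s * 2 ^ m / u\<rfloor>"
    have pos: "0 \<le> s * 2 ^ m / u" using s \<open>u > 0\<close> by simp
    have j1: "real j \<le> s * 2 ^ m / u" "s * 2 ^ m / u < real j + 1"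
      unfolding j_def using pos by linarith+
    have "s * 2 ^ m / u \<le> 2 ^ m" using s \<open>u > 0\<close> by (simp add: field_simps mult_left_mono)
    then have "real j \<le> 2 ^ m" using j1 by linarith
    then have j2: "j \<le> 2 ^ m" by (metis of_nat_le_iff of_nat_numeral of_nat_power)
    have le: "u * real j / 2 ^ m \<le> s" using j1(1) \<open>u > 0\<close> by (simp add: field_simps)
    have "s - u * real j / 2 ^ m < d"
    proof -
      have "s < u * real j / 2 ^ m + u / 2 ^ m" using j1(2) \<open>u > 0\<close> by (simp add: field_simps)
      moreover have "u / 2 ^ m < d" using m d(1) by (simp add: field_simps)
      ultimately show ?thesis by linarith
    qed
    then have "dist (f (u * real j / 2 ^ m)) (f s) < e"
      using le s u by (intro d(2)) (auto simp: dist_real_def)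
    then have "f (u * real j / 2 ^ m) \<in> - C" using e(2) by (metis mem_ball dist_commute subsetD)
    then show False using R j2 by blast
  qed
qed

text \<open>Dyadic grids are nested: point \<open>j\<close> of level \<open>m\<close> is point
  \<open>2 * j\<close> of the next level.\<close>

lemma grid_mono:
  assumes "\<forall>j\<le>2 ^ Suc m. P (u * real j / 2 ^ Suc m)" "j \<le> 2 ^ m"
  shows "P (u * real j / 2 ^ m)"
proof -
  have "2 * j \<le> 2 ^ Suc m" using assms(2) by simp
  with assms(1) have "P (u * real (2 * j) / 2 ^ Suc m)" by blast
  then show ?thesis by simp
qed

text \<open>Closed exhaustion of an open set by the points at distance at least
  \<open>1 / (n + 1)\<close> from the complement.\<close>

definition inner_part :: "'a :: metric_space set \<Rightarrow> nat \<Rightarrow> 'a set" where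
  "inner_part D n = {x. ball x (1 / real (Suc n)) \<subseteq> D}"

lemma closed_inner_part: "closed (inner_part D n)"
proof -
  have "- inner_part D n = (\<Union>y\<in>- D. ball y (1 / real (Suc n)))"
    by (auto simp: inner_part_def dist_commute subset_iff)
  moreover have "open (\<Union>y\<in>- D. ball y (1 / real (Suc n)))" by (intro open_UN ballI open_ball)
  ultimately have "open (- inner_part D n)" by simp
  then show ?thesis by (simp add: closed_def)
qed

lemma inner_part_subset: "inner_part D n \<subseteq> D"
  by (auto simp: inner_part_def subset_iff)

lemma inner_part_mono: "m \<le> n \<Longrightarrow> inner_part D m \<subseteq> inner_part D n"
proof -
  assume "m \<le> n"
  then have "ball x (1 / real (Suc n)) \<subseteq> ball x (1 / real (Suc m))" for x :: 'a
    by (intro subset_ball divide_left_mono) auto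
  then show ?thesis unfolding inner_part_def by blast
qed

text \<open>The path over a compact time interval is compact, so inside \<open>D\<close> it keeps a
  positive distance from the complement. This carries the grid criterion for closed sets over to
  open ones.\<close>

lemma path_in_open_iff_inner_part:
  fixes f :: "real \<Rightarrow> 'a :: euclidean_space"
  assumes f: "continuous_on {0..u} f" and D: "open D"
  shows "(\<forall>s\<in>{0..u}. f s \<in> D) \<longleftrightarrow> (\<exists>n. \<forall>s\<in>{0..u}. f s \<in> inner_part D n)"
proof
  assume L: "\<forall>s\<in>{0..u}. f s \<in> D"
  have "compact (f ` {0..u})" using f by (intro compact_continuous_image) auto
  moreover have "f ` {0..u} \<subseteq> D" using L by blast
  ultimately obtain e where e': "e > 0" "(\<Union>x\<in>f ` {0..u}. ball x e) \<subseteq> D"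
    using compact_subset_open_imp_ball_epsilon_subset[OF _ D] by metis
  then have e: "e > 0" "\<And>x. x \<in> f ` {0..u} \<Longrightarrow> ball x e \<subseteq> D" by blast+
  obtain n where n: "1 / real (Suc n) < e" using e(1) by (meson nat_approx_posE)
  have "f s \<in> inner_part D n" if "s \<in> {0..u}" for s
    using e(2)[of "f s"] that subset_ball[of "1 / real (Suc n)" e "f s"] n by (auto simp: inner_part_def)
  then show "\<exists>n. \<forall>s\<in>{0..u}. f s \<in> inner_part D n" by blast
qed (use inner_part_subset in blast)

text \<open>Continuity makes the set of exit times closed, so its infimum is attained if the set is
  nonempty. Hence the strict inequality matches the closed interval \<open>{0..t}\<close>, endpoint
  included.\<close>

lemma exit_time_gt_iff:
  fixes f :: "real \<Rightarrow> 'a :: metric_space"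
  assumes f: "continuous_on {0..} f" and D: "open D"
  shows "exit_time D f > ereal t \<longleftrightarrow> (\<forall>s\<in>{0..t}. f s \<in> D)"
proof
  assume L: "exit_time D f > ereal t"
  show "\<forall>s\<in>{0..t}. f s \<in> D"
  proof (rule ballI, rule ccontr)
    fix s assume s: "s \<in> {0..t}" "f s \<notin> D"
    then have "exit_time D f \<le> ereal s" unfolding exit_time_def by (intro INF_lower) auto
    also have "\<dots> \<le> ereal t" using s by simp
    finally show False using L by simp
  qed
next
  assume R: "\<forall>s\<in>{0..t}. f s \<in> D"
  let ?A = "{s. 0 \<le> s \<and> f s \<notin> D}"
  have "closedin (top_of_set {0..}) ({0..} \<inter> f -` (- D))"
    using f D by (intro continuous_closedin_preimage) auto
  moreover have "{0..} \<inter> f -` (- D) = ?A" by auto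
  ultimately have cl: "closed ?A" using closedin_closed_trans[of "{0::real..}" ?A] by simp
  show "exit_time D f > ereal t"
  proof (cases "?A = {}")
    case True then show ?thesis unfolding exit_time_def True by (simp add: top_ereal_def)
  next
    case False
    have bdd: "bdd_below ?A" by (rule bdd_belowI[of _ 0]) auto
    have "Inf ?A \<in> ?A" by (rule closed_contains_Inf[OF False bdd cl])
    then have "t < Inf ?A" using R by force
    moreover have "ereal (Inf ?A) \<le> exit_time D f"
      unfolding exit_time_def using bdd by (intro INF_greatest) (auto intro: cInf_lower)
    ultimately show ?thesis by (metis ereal_less_eq(3) less_ereal.simps(1) less_le_trans)
  qed
qed

section \<open>Measurability and law of the event that the motion stays in a set\<close>

context brownian_motion
begin

lemma process_events_subset: "process_events M B \<subseteq> events"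
  unfolding process_events_def
  by (rule sets.sigma_sets_subset) (use measurable_BM in \<open>auto intro: measurable_sets\<close>)

lemma sigma_algebra_process_events: "sigma_algebra (space M) (process_events M B)"
  unfolding process_events_def by (rule sigma_algebra_sigma_sets) auto

lemma sets_sigma_process_events:
  "sets (sigma (space M) (process_events M B)) = process_events M B"
  using sigma_algebra.sets_measure_of_eq[OF sigma_algebra_process_events] by simp

lemma subalgebra_process_events: "subalgebra M (sigma (space M) (process_events M B))"
  unfolding subalgebra_def sets_sigma_process_events using process_events_subset by (simp add: space_measure_of_conv)

lemma process_event_at:
  assumes "0 \<le> t" "A \<in> sets borel"
  shows "{w \<in> space M. B t w \<in> A} \<in> process_events M B"
proof -
  have "{w \<in> space M. B t w \<in> A} = B t -` A \<inter> space M" by auto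
  then show ?thesis unfolding process_events_def using assms by (intro sigma_sets.Basic) auto
qed

lemma continuous_path: "w \<in> space M \<Longrightarrow> continuous_on {0..u} (\<lambda>t. B t w)"
  by (rule continuous_on_subset[OF continuous_BM]) auto

lemma grid_process_event:
  assumes "0 \<le> t" "C \<in> sets borel"
  shows "{w \<in> space M. \<forall>j\<le>2 ^ m. B (t * real j / 2 ^ m) w \<in> C} \<in> process_events M B"
proof -
  interpret P: sigma_algebra "space M" "process_events M B" by (rule sigma_algebra_process_events)
  have "{w \<in> space M. \<forall>j\<in>{..2 ^ m}. B (t * real j / 2 ^ m) w \<in> C} \<in> process_events M B"
    using assms by (intro P.sets_Collect_finite_All process_event_at) auto
  then show ?thesis by (simp only: Ball_def atMost_iff)
qed

lemma closed_stay_eq_grid: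
  assumes "0 \<le> t" "closed C"
  shows "{w \<in> space M. \<forall>s\<in>{0..t}. B s w \<in> C} =
    (\<Inter>m. {w \<in> space M. \<forall>j\<le>2 ^ m. B (t * real j / 2 ^ m) w \<in> C})"
  using path_in_closed_iff_grid[OF continuous_path assms(2,1)] by auto

lemma open_stay_eq_Union:
  assumes "open D"
  shows "{w \<in> space M. \<forall>s\<in>{0..t}. B s w \<in> D} =
    (\<Union>n. {w \<in> space M. \<forall>s\<in>{0..t}. B s w \<in> inner_part D n})"
  using path_in_open_iff_inner_part[OF continuous_path assms] by auto

lemma closed_stay_process_event:
  assumes "0 \<le> t" "closed C"
  shows "{w \<in> space M. \<forall>s\<in>{0..t}. B s w \<in> C} \<in> process_events M B"
proof -
  interpret P: sigma_algebra "space M" "process_events M B" by (rule sigma_algebra_process_events)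
  show ?thesis unfolding closed_stay_eq_grid[OF assms]
    using assms by (intro P.countable_INT) (auto intro!: grid_process_event)
qed

lemma open_stay_process_event:
  assumes "0 \<le> t" "open D"
  shows "{w \<in> space M. \<forall>s\<in>{0..t}. B s w \<in> D} \<in> process_events M B"
proof -
  interpret P: sigma_algebra "space M" "process_events M B" by (rule sigma_algebra_process_events)
  show ?thesis unfolding open_stay_eq_Union[OF assms(2)]
    using assms by (intro P.countable_UN) (auto intro!: closed_stay_process_event closed_inner_part)
qed

lemma closed_stay_grid_tendsto:
  assumes "0 \<le> t" "closed C"
  shows "(\<lambda>m. prob {w \<in> space M. \<forall>j\<le>2 ^ m. B (t * real j / 2 ^ m) w \<in> C})
    \<longlonglongrightarrow> prob {w \<in> space M. \<forall>s\<in>{0..t}. B s w \<in> C}"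
  unfolding closed_stay_eq_grid[OF assms]
proof (rule finite_Lim_measure_decseq)
  show "range (\<lambda>m. {w \<in> space M. \<forall>j\<le>2 ^ m. B (t * real j / 2 ^ m) w \<in> C}) \<subseteq> events"
    using grid_process_event[of t C] process_events_subset assms by auto
  show "decseq (\<lambda>m. {w \<in> space M. \<forall>j\<le>2 ^ m. B (t * real j / 2 ^ m) w \<in> C})"
  proof (rule decseq_SucI, rule subsetI)
    fix m w assume "w \<in> {w \<in> space M. \<forall>j\<le>2 ^ Suc m. B (t * real j / 2 ^ Suc m) w \<in> C}"
    then have w: "w \<in> space M" "\<forall>j\<le>2 ^ Suc m. B (t * real j / 2 ^ Suc m) w \<in> C" by auto
    show "w \<in> {w \<in> space M. \<forall>j\<le>2 ^ m. B (t * real j / 2 ^ m) w \<in> C}"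
      using grid_mono[of m "\<lambda>s. B s w \<in> C" t, OF w(2)] w(1) by simp
  qed
qed

lemma open_stay_tendsto:
  assumes "0 \<le> t" "open D"
  shows "(\<lambda>n. prob {w \<in> space M. \<forall>s\<in>{0..t}. B s w \<in> inner_part D n})
    \<longlonglongrightarrow> prob {w \<in> space M. \<forall>s\<in>{0..t}. B s w \<in> D}"
  unfolding open_stay_eq_Union[OF assms(2)]
proof (rule finite_Lim_measure_incseq)
  show "range (\<lambda>n. {w \<in> space M. \<forall>s\<in>{0..t}. B s w \<in> inner_part D n}) \<subseteq> events"
    using closed_stay_process_event[OF assms(1) closed_inner_part] process_events_subset by auto
  show "incseq (\<lambda>n. {w \<in> space M. \<forall>s\<in>{0..t}. B s w \<in> inner_part D n})"
    using inner_part_mono[of _ _ D] by (auto simp: incseq_def subset_iff)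
qed

lemma sum_increments:
  assumes "w \<in> space M"
  shows "(\<Sum>i<j. B (real (Suc i) * \<delta>) w - B (real i * \<delta>) w) = B (real j * \<delta>) w"
  using sum_lessThan_telescope[of "\<lambda>i. B (real i * \<delta>) w" j] start_BM[OF assms] by simp

lemma indep_grid_increments:
  assumes "\<delta> > 0"
  shows "indep_vars (\<lambda>_. borel) (\<lambda>i w. B (real (Suc i) * \<delta>) w - B (real i * \<delta>) w) {..<k}"
  using assms by (intro indep_increments_BM) (auto simp: strict_mono_def)

text \<open>The right-hand side no longer mentions the motion: grid positions are partial sums of
  independent increments with a prescribed Gaussian law. Two motions on different probability spaces
  can therefore be compared.\<close>

lemma grid_prob_eq:
  assumes \<delta>: "\<delta> > 0" and k: "k > 0" and C: "C \<in> sets borel"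
  shows "prob {w \<in> space M. \<forall>j\<le>k. B (real j * \<delta>) w \<in> C} =
    measure (Pi\<^sub>M {..<k} (\<lambda>_. density lborel (\<lambda>x::'a. ennreal (\<Prod>b\<in>Basis. normal_density 0 (sqrt \<delta>) (x \<bullet> b)))))
      {x \<in> space (Pi\<^sub>M {..<k} (\<lambda>_. borel)). \<forall>j\<le>k. (\<Sum>i<j. x i) \<in> C}"
proof -
  let ?inc = "\<lambda>i w. B (real (Suc i) * \<delta>) w - B (real i * \<delta>) w"
  let ?P = "Pi\<^sub>M {..<k} (\<lambda>_. borel) :: (nat \<Rightarrow> 'a) measure"
  let ?E = "{x \<in> space ?P. \<forall>j\<le>k. (\<Sum>i<j. x i) \<in> C}"
  have rv: "random_variable borel (?inc i)" for i
    using measurable_BM[of "real (Suc i) * \<delta>"] measurable_BM[of "real i * \<delta>"] \<delta> by simp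
  have distr_inc: "distr M borel (?inc i) = density lborel (\<lambda>x::'a. ennreal (\<Prod>b\<in>Basis. normal_density 0 (sqrt \<delta>) (x \<bullet> b)))" for i
  proof -
    have "distributed M lborel (?inc i)
        (\<lambda>x. ennreal (\<Prod>b\<in>Basis. normal_density 0 (sqrt (real (Suc i) * \<delta> - real i * \<delta>)) (x \<bullet> b)))"
      using \<delta> by (intro gaussian_increments_BM) auto
    also have "real (Suc i) * \<delta> - real i * \<delta> = \<delta>" by (simp add: algebra_simps)
    finally have "distr M lborel (?inc i) = density lborel (\<lambda>x::'a. ennreal (\<Prod>b\<in>Basis. normal_density 0 (sqrt \<delta>) (x \<bullet> b)))"
      by (simp add: distributed_def)
    then show ?thesis by (simp cong: distr_cong)
  qed
  have ne: "{..<k} \<noteq> {}" using k by auto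
  have dist: "distr M ?P (\<lambda>w. \<lambda>i\<in>{..<k}. ?inc i w) = Pi\<^sub>M {..<k} (\<lambda>i. distr M borel (?inc i))"
    using indep_grid_increments[OF \<delta>, of k] rv
    by (subst (asm) indep_vars_iff_distr_eq_PiM'[OF ne]) auto
  have E: "?E \<in> sets ?P"
  proof -
    have "{x \<in> space ?P. (\<Sum>i<j. x i) \<in> C} \<in> sets ?P" if "j \<le> k" for j
    proof -
      have "(\<lambda>x. \<Sum>i<j. x i) \<in> borel_measurable ?P"
        using that by (intro borel_measurable_sum measurable_component_singleton) auto
      from measurable_sets[OF this C] show ?thesis by (simp add: vimage_def Int_def conj_commute)
    qed
    then have "{x \<in> space ?P. \<forall>j\<in>{..k}. (\<Sum>i<j. x i) \<in> C} \<in> sets ?P"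
      by (intro sets.sets_Collect_finite_All) auto
    then show ?thesis by (simp only: Ball_def atMost_iff)
  qed
  have X: "(\<lambda>w. \<lambda>i\<in>{..<k}. ?inc i w) \<in> measurable M ?P"
    using rv by (intro measurable_restrict) auto
  have "measure (Pi\<^sub>M {..<k} (\<lambda>i. distr M borel (?inc i))) ?E =
      prob ((\<lambda>w. \<lambda>i\<in>{..<k}. ?inc i w) -` ?E \<inter> space M)"
    unfolding dist[symmetric] by (rule measure_distr[OF X E])
  also have "(\<lambda>w. \<lambda>i\<in>{..<k}. ?inc i w) -` ?E \<inter> space M = {w \<in> space M. \<forall>j\<le>k. B (real j * \<delta>) w \<in> C}"
  proof -
    have "(\<Sum>i<j. (\<lambda>i\<in>{..<k}. ?inc i w) i) = B (real j * \<delta>) w" if "w \<in> space M" "j \<le> k" for j w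
    proof -
      have "(\<Sum>i<j. (\<lambda>i\<in>{..<k}. ?inc i w) i) = (\<Sum>i<j. ?inc i w)" using that by (intro sum.cong) auto
      then show ?thesis using sum_increments[OF that(1)] by simp
    qed
    then show ?thesis using measurable_space[OF X] by auto
  qed
  finally show ?thesis unfolding distr_inc ..
qed

end

lemma brownian_grid_law:
  fixes B :: "real \<Rightarrow> 'w \<Rightarrow> 'a :: euclidean_space" and W :: "real \<Rightarrow> 'v \<Rightarrow> 'a"
  assumes B: "brownian_motion M B" and W: "brownian_motion N W" and t: "t \<ge> 0" and C: "C \<in> sets borel"
  shows "measure M {w \<in> space M. \<forall>j\<le>2 ^ m. B (t * real j / 2 ^ m) w \<in> C} =
    measure N {w \<in> space N. \<forall>j\<le>2 ^ m. W (t * real j / 2 ^ m) w \<in> C}"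
proof -
  interpret B: brownian_motion M B by fact
  interpret W: brownian_motion N W by fact
  show ?thesis
  proof (cases "t = 0")
    case True
    then have "{w \<in> space M. \<forall>j\<le>2 ^ m. B (t * real j / 2 ^ m) w \<in> C} = (if 0 \<in> C then space M else {})"
      "{w \<in> space N. \<forall>j\<le>2 ^ m. W (t * real j / 2 ^ m) w \<in> C} = (if 0 \<in> C then space N else {})"
      by (auto simp: B.start_BM W.start_BM)
    then show ?thesis by (simp add: B.prob_space W.prob_space)
  next
    case False
    then have "t / 2 ^ m > 0" using t by simp
    moreover have "t * real j / 2 ^ m = real j * (t / 2 ^ m)" for j by simp
    ultimately show ?thesis
      using B.grid_prob_eq[of "t / 2 ^ m" "2 ^ m" C] W.grid_prob_eq[of "t / 2 ^ m" "2 ^ m" C] C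
      by (simp only: zero_less_power zero_less_numeral)
  qed
qed

text \<open>The assumption on exit times concerns a motion on \<open>N\<close>, whereas the two
  halves of the iterated process live on \<open>M\<close>. Equality of grid probabilities passes to
  closed sets as the grid is refined, and to open sets along \<open>inner_part\<close>.\<close>

lemma brownian_open_stay_law:
  fixes B :: "real \<Rightarrow> 'w \<Rightarrow> 'a :: euclidean_space" and W :: "real \<Rightarrow> 'v \<Rightarrow> 'a"
  assumes B: "brownian_motion M B" and W: "brownian_motion N W" and t: "t \<ge> 0" and D: "open D"
  shows "measure M {w \<in> space M. \<forall>s\<in>{0..t}. B s w \<in> D} = measure N {w \<in> space N. \<forall>s\<in>{0..t}. W s w \<in> D}"
proof -
  interpret B: brownian_motion M B by fact
  interpret W: brownian_motion N W by fact
  have closed: "measure M {w \<in> space M. \<forall>s\<in>{0..t}. B s w \<in> C} = measure N {w \<in> space N. \<forall>s\<in>{0..t}. W s w \<in> C}"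
    if C: "closed C" for C
    using B.closed_stay_grid_tendsto[OF t C] W.closed_stay_grid_tendsto[OF t C]
      brownian_grid_law[OF B W t borel_closed[OF C]] by (auto intro: LIMSEQ_unique)
  show ?thesis
    using B.open_stay_tendsto[OF t D] W.open_stay_tendsto[OF t D]
    unfolding closed[OF closed_inner_part] by (rule LIMSEQ_unique)
qed

section \<open>Killed one-dimensional Brownian motion\<close>

locale real_brownian_motion = brownian_motion M Y for M :: "'w measure" and Y :: "real \<Rightarrow> 'w \<Rightarrow> real"
begin

lemma distributed_increment:
  assumes "0 \<le> s" "s < t"
  shows "distributed M lborel (\<lambda>w. Y t w - Y s w) (normal_density 0 (sqrt (t - s)))"
  using gaussian_increments_BM[OF assms] by simp

lemma random_variable_increment:
  assumes "0 \<le> s" "0 \<le> t" shows "random_variable borel (\<lambda>w. Y t w - Y s w)"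
  using measurable_BM assms by simp

lemma integrable_bounded_by_1:
  fixes f :: "'w \<Rightarrow> real"
  assumes "random_variable borel f" "\<And>w. \<bar>f w\<bar> \<le> 1" shows "integrable M f"
  by (rule integrable_const_bound[of _ 1]) (use assms in auto)

lemma char_increment:
  assumes "0 \<le> s" "s < t"
  shows "(CLINT w|M. iexp (c * (Y t w - Y s w))) = of_real (exp (- (c\<^sup>2 * (t - s) / 2)))"
proof -
  let ?\<sigma> = "sqrt (t - s)"
  have \<sigma>: "?\<sigma> > 0" using assms by simp
  have "distributed M lborel (\<lambda>w. (Y t w - Y s w - 0) / ?\<sigma>) std_normal_density"
    using distributed_increment[OF assms] by (rule normal_standard_normal_convert[OF \<sigma>, THEN iffD1])
  then have d: "distr M lborel (\<lambda>w. (Y t w - Y s w) / ?\<sigma>) = std_normal_distribution"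
    by (simp add: distributed_def)
  have [measurable]: "random_variable borel (\<lambda>w. Y t w - Y s w)"
    using assms by (intro random_variable_increment) auto
  have "char std_normal_distribution (c * ?\<sigma>) = (CLINT w|M. iexp (c * ?\<sigma> * ((Y t w - Y s w) / ?\<sigma>)))"
    unfolding char_def d[symmetric] by (rule integral_distr) auto
  also have "(\<lambda>w. iexp (c * ?\<sigma> * ((Y t w - Y s w) / ?\<sigma>))) = (\<lambda>w. iexp (c * (Y t w - Y s w)))"
    using \<sigma> by simp
  finally show ?thesis using assms by (simp add: char_std_normal_distribution power_mult_distrib)
qed

text \<open>Real and imaginary parts of the Gaussian characteristic function, which is real because
  the increment is symmetric.\<close>

lemma expectation_cos_sin_increment:
  assumes "0 \<le> s" "s < t"
  shows "expectation (\<lambda>w. cos (c * (Y t w - Y s w))) = exp (- (c\<^sup>2 * (t - s) / 2))"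
    and "expectation (\<lambda>w. sin (c * (Y t w - Y s w))) = 0"
proof -
  have [measurable]: "random_variable borel (\<lambda>w. Y t w - Y s w)"
    using assms by (intro random_variable_increment) auto
  have int: "integrable M (\<lambda>w. iexp (c * (Y t w - Y s w)))"
  proof (rule integrable_const_bound[of _ 1])
    show "random_variable borel (\<lambda>w. iexp (c * (Y t w - Y s w)))" by measurable
  qed simp
  have 1: "Re (iexp x) = cos x" "Im (iexp x) = sin x" for x
    by (simp_all only: cis_conv_exp[symmetric] cis.sel)
  show "expectation (\<lambda>w. cos (c * (Y t w - Y s w))) = exp (- (c\<^sup>2 * (t - s) / 2))"
    using integral_Re[OF int] unfolding char_increment[OF assms] 1 Re_complex_of_real .
  show "expectation (\<lambda>w. sin (c * (Y t w - Y s w))) = 0"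
    using integral_Im[OF int] unfolding char_increment[OF assms] 1 Im_complex_of_real .
qed

text \<open>The first \<open>j\<close> increments and increment \<open>j\<close> form two
  independent blocks of one independent family. The bounds by \<open>1\<close> provide the
  integrability that the product formula requires.\<close>

lemma expectation_past_mult_increment:
  fixes F :: "(nat \<Rightarrow> real) \<Rightarrow> real" and H :: "real \<Rightarrow> real"
  assumes \<delta>: "\<delta> > 0" and F: "F \<in> borel_measurable (Pi\<^sub>M {..<j} (\<lambda>_. borel))" and H: "H \<in> borel_measurable borel"
    and bF: "\<And>x. \<bar>F x\<bar> \<le> 1" and bH: "\<And>x. \<bar>H x\<bar> \<le> 1"
  defines "inc \<equiv> \<lambda>i w. Y (real (Suc i) * \<delta>) w - Y (real i * \<delta>) w"
  shows "expectation (\<lambda>w. F (\<lambda>i\<in>{..<j}. inc i w) * H (inc j w)) =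
    expectation (\<lambda>w. F (\<lambda>i\<in>{..<j}. inc i w)) * expectation (\<lambda>w. H (inc j w))"
proof -
  have rv [measurable]: "random_variable borel (inc i)" for i
    unfolding inc_def using \<delta> by (intro random_variable_increment) auto
  have R: "(\<lambda>w. \<lambda>i\<in>{..<j}. inc i w) \<in> measurable M (Pi\<^sub>M {..<j} (\<lambda>_. borel))"
    by (intro measurable_restrict) auto
  have ind: "indep_vars (\<lambda>_. borel) inc {..<Suc j}"
    unfolding inc_def by (rule indep_grid_increments[OF \<delta>])
  have "indep_var (Pi\<^sub>M {..<j} (\<lambda>_. borel)) (\<lambda>w. \<lambda>i\<in>{..<j}. inc i w) (Pi\<^sub>M {j} (\<lambda>_. borel)) (\<lambda>w. \<lambda>i\<in>{j}. inc i w)"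
    by (rule indep_var_restrict[OF ind]) auto
  then have "indep_var borel (F \<circ> (\<lambda>w. \<lambda>i\<in>{..<j}. inc i w)) borel ((\<lambda>x. H (x j)) \<circ> (\<lambda>w. \<lambda>i\<in>{j}. inc i w))"
    by (rule indep_var_compose[OF _ F]) (use H in measurable)
  then have iv: "indep_var borel (\<lambda>w. F (\<lambda>i\<in>{..<j}. inc i w)) borel (\<lambda>w. H (inc j w))"
    by (simp add: comp_def)
  have FR: "random_variable borel (\<lambda>w. F (\<lambda>i\<in>{..<j}. inc i w))" 
    by (rule measurable_compose[OF R F])
  show ?thesis
    using integrable_bounded_by_1[OF FR bF] integrable_bounded_by_1[OF measurable_compose[OF rv H] bH]
    by (rule indep_var_lebesgue_integral[OF iv])
qed

section \<open>The walk on a time grid, killed when it is found outside an interval\<close>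

definition stay_upto :: "real \<Rightarrow> real \<Rightarrow> real \<Rightarrow> nat \<Rightarrow> 'w set" where
  "stay_upto \<delta> v r j = {w \<in> space M. \<forall>i\<le>j. v + Y (real i * \<delta>) w \<in> {0..r}}"

lemma stay_upto_measurable [measurable]: "\<delta> > 0 \<Longrightarrow> stay_upto \<delta> v r j \<in> events"
proof -
  assume "\<delta> > 0"
  then have "{w \<in> space M. v + Y (real i * \<delta>) w \<in> {0..r}} \<in> events" for i
  proof -
    have [measurable]: "random_variable borel (Y (real i * \<delta>))" using \<open>\<delta> > 0\<close> by (intro measurable_BM) simp
    show ?thesis by measurable
  qed
  then have "{w \<in> space M. \<forall>i\<in>{..j}. v + Y (real i * \<delta>) w \<in> {0..r}} \<in> events"
    by (intro sets.sets_Collect_finite_All) auto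
  then show ?thesis unfolding stay_upto_def by (simp only: Ball_def atMost_iff)
qed

lemma stay_upto_Suc: "stay_upto \<delta> v r (Suc j) \<subseteq> stay_upto \<delta> v r j"
  by (auto simp: stay_upto_def)

text \<open>The addition theorem splits the new sine into past times cosine of the increment and
  past times sine of the increment. By independence the second part has mean zero and the first
  produces the decay factor. The indicator still refers to time \<open>j\<close>, so the new step is
  not yet subject to killing.\<close>

lemma killed_walk_step:
  assumes \<delta>: "\<delta> > 0"
  shows "expectation (\<lambda>w. sin (c * (v + Y (real (Suc j) * \<delta>) w)) * indicator (stay_upto \<delta> v r j) w) =
    exp (- (c\<^sup>2 * \<delta> / 2)) * expectation (\<lambda>w. sin (c * (v + Y (real j * \<delta>) w)) * indicator (stay_upto \<delta> v r j) w)"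
proof -
  define inc where "inc i w = Y (real (Suc i) * \<delta>) w - Y (real i * \<delta>) w" for i w
  let ?P = "Pi\<^sub>M {..<j} (\<lambda>_. borel) :: (nat \<Rightarrow> real) measure"
  \<comment> \<open>The past as a function of the increments alone, positions being partial sums, so
    that independence of increments applies. The parameter \<open>f\<close> is used with both sine
    and cosine.\<close>
  define F where "F f x = (f (c * (v + (\<Sum>i<j. x i))) :: real) * (if \<forall>i\<le>j. v + (\<Sum>l<i. x l) \<in> {0..r} then 1 else 0)"
    for f and x :: "nat \<Rightarrow> real"
  let ?R = "\<lambda>w. \<lambda>i\<in>{..<j}. inc i w"
  have incY: "v + Y (real (Suc j) * \<delta>) w = v + Y (real j * \<delta>) w + inc j w" for w by (simp add: inc_def)
  have inc_j: "0 \<le> real j * \<delta>" "real j * \<delta> < real (Suc j) * \<delta>" "real (Suc j) * \<delta> - real j * \<delta> = \<delta>"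
    using \<delta> by (auto simp: algebra_simps)
  have ES: "expectation (\<lambda>w. cos (c * inc j w)) = exp (- (c\<^sup>2 * \<delta> / 2))" "expectation (\<lambda>w. sin (c * inc j w)) = 0"
    unfolding inc_def using expectation_cos_sin_increment[OF inc_j(1,2), of c] inc_j(3) by simp_all
  have sum_R: "(\<Sum>l<i. ?R w l) = Y (real i * \<delta>) w" if "w \<in> space M" "i \<le> j" for i w
  proof -
    have "(\<Sum>l<i. ?R w l) = (\<Sum>l<i. inc l w)" using that by (intro sum.cong) auto
    then show ?thesis using sum_increments[OF that(1)] by (simp add: inc_def)
  qed
  have FR: "F f (?R w) = f (c * (v + Y (real j * \<delta>) w)) * indicator (stay_upto \<delta> v r j) w" if "w \<in> space M" for f w
    using sum_R[OF that] that by (auto simp: F_def stay_upto_def indicator_def)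
  have sums: "(\<lambda>x. \<Sum>l<i. x l) \<in> borel_measurable ?P" if "i \<le> j" for i
    using that by (intro borel_measurable_sum measurable_component_singleton) auto
  have F_meas: "F f \<in> borel_measurable ?P" if [measurable]: "f \<in> borel_measurable borel" for f
  proof -
    have "{x \<in> space ?P. \<forall>i\<in>{..j}. v + (\<Sum>l<i. x l) \<in> {0..r}} \<in> sets ?P"
    proof (intro sets.sets_Collect_finite_All)
      fix i assume "i \<in> {..j}"
      then have [measurable]: "(\<lambda>x. \<Sum>l<i. x l) \<in> borel_measurable ?P" by (intro sums) auto
      show "{x \<in> space ?P. v + (\<Sum>l<i. x l) \<in> {0..r}} \<in> sets ?P" by measurable
    qed auto
    then have [measurable]: "Measurable.pred ?P (\<lambda>x. \<forall>i\<le>j. v + (\<Sum>l<i. x l) \<in> {0..r})"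
      unfolding pred_def by (simp only: Ball_def atMost_iff)
    have [measurable]: "(\<lambda>x. \<Sum>l<j. x l) \<in> borel_measurable ?P" by (intro sums) auto
    show ?thesis unfolding F_def by measurable
  qed
  have bF: "\<bar>F f x\<bar> \<le> 1" if "\<And>y. \<bar>f y\<bar> \<le> 1" for f x using that by (simp add: F_def)
  have prod: "expectation (\<lambda>w. F f (?R w) * h (c * inc j w)) = expectation (\<lambda>w. F f (?R w)) * expectation (\<lambda>w. h (c * inc j w))"
    if [measurable]: "f \<in> borel_measurable borel" "h \<in> borel_measurable borel" and "\<And>y. \<bar>f y\<bar> \<le> 1" "\<And>y. \<bar>h y\<bar> \<le> 1" for f h
    unfolding inc_def by (rule expectation_past_mult_increment[OF \<delta> F_meas, of f "\<lambda>x. h (c * x)"]) (use that bF in auto)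
  have [measurable]: "random_variable borel (inc i)" for i
    unfolding inc_def using \<delta> by (intro random_variable_increment) auto
  have R: "?R \<in> measurable M ?P" by (intro measurable_restrict) auto
  have FRm [measurable]: "random_variable borel (\<lambda>w. F sin (?R w))" "random_variable borel (\<lambda>w. F cos (?R w))"
    by (intro measurable_compose[OF R F_meas] borel_measurable_continuous_onI continuous_intros)+
  have int: "integrable M (\<lambda>w. F sin (?R w) * cos (c * inc j w))" "integrable M (\<lambda>w. F cos (?R w) * sin (c * inc j w))"
    by (rule integrable_bounded_by_1; auto simp: abs_mult intro!: mult_le_one bF)+
  have "expectation (\<lambda>w. sin (c * (v + Y (real (Suc j) * \<delta>) w)) * indicator (stay_upto \<delta> v r j) w) =
    expectation (\<lambda>w. F sin (?R w) * cos (c * inc j w) + F cos (?R w) * sin (c * inc j w))"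
  proof (intro Bochner_Integration.integral_cong refl)
    fix w assume "w \<in> space M"
    then show "sin (c * (v + Y (real (Suc j) * \<delta>) w)) * indicator (stay_upto \<delta> v r j) w =
        F sin (?R w) * cos (c * inc j w) + F cos (?R w) * sin (c * inc j w)"
      unfolding incY distrib_left[of c _ "inc j w"] sin_add by (simp only: FR distrib_right distrib_left mult_ac)
  qed
  also have "\<dots> = expectation (\<lambda>w. F sin (?R w)) * exp (- (c\<^sup>2 * \<delta> / 2)) + expectation (\<lambda>w. F cos (?R w)) * 0"
    unfolding Bochner_Integration.integral_add[OF int]
    by (intro arg_cong2[where f="(+)"]; subst prod) (auto simp: ES)
  also have "expectation (\<lambda>w. F sin (?R w)) = expectation (\<lambda>w. sin (c * (v + Y (real j * \<delta>) w)) * indicator (stay_upto \<delta> v r j) w)"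
    by (intro Bochner_Integration.integral_cong refl) (simp add: FR)
  finally show ?thesis by simp
qed

text \<open>A step leaving \<open>[0, r]\<close> crosses a zero of the eigenfunction at \<open>0\<close> or \<open>r\<close>.\<close>

lemma sin_overshoot:
  fixes a b c r :: real
  assumes "c \<ge> 0" "sin (c * r) = 0" "a \<in> {0..r}" "b \<notin> {0..r}"
  shows "\<bar>sin (c * b)\<bar> \<le> min 1 (c * \<bar>b - a\<bar>)"
proof -
  have lip: "\<bar>sin x - sin y\<bar> \<le> \<bar>x - y\<bar>" for x y :: real
  proof -
    have "sin x - sin y = 2 * sin ((x - y) / 2) * cos ((x + y) / 2)" by (rule sin_diff_sin)
    then have "\<bar>sin x - sin y\<bar> = 2 * \<bar>sin ((x - y) / 2)\<bar> * \<bar>cos ((x + y) / 2)\<bar>" by (simp add: abs_mult)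
    also have "\<dots> \<le> 2 * \<bar>(x - y) / 2\<bar> * 1" by (intro mult_mono abs_sin_x_le_abs_x) auto
    finally show ?thesis by simp
  qed
  consider "b < 0" | "b > r" using assms(4) by force
  then have "\<bar>sin (c * b)\<bar> \<le> c * \<bar>b - a\<bar>"
  proof cases
    case 1
    have "\<bar>sin (c * b)\<bar> \<le> c * \<bar>b\<bar>" using lip[of "c * b" 0] assms(1) by (simp add: abs_mult)
    also have "\<dots> \<le> c * \<bar>b - a\<bar>" using 1 assms by (intro mult_left_mono) auto
    finally show ?thesis .
  next
    case 2
    have "\<bar>sin (c * b)\<bar> \<le> c * \<bar>b - r\<bar>"
      using lip[of "c * b" "c * r"] assms(1,2) by (simp add: abs_mult right_diff_distrib[symmetric])
    also have "\<dots> \<le> c * \<bar>b - a\<bar>" using 2 assms by (intro mult_left_mono) auto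
    finally show ?thesis .
  qed
  then show ?thesis by simp
qed

text \<open>Each step costs the value of the sine at the overshoot of the paths killed there, which
  is at most \<open>g\<close> because the sine vanishes at both ends of the interval. The killing
  events of different steps are disjoint, so these losses add up to the expectation of a single
  \<open>g\<close> over the killed paths, however many steps there are. Stating the bound over the
  complement of \<open>stay_upto\<close> lets the induction record this.\<close>

lemma killed_walk_error:
  assumes \<delta>: "\<delta> > 0" and c: "c \<ge> 0" "sin (c * r) = 0" and v: "v \<in> {0..r}"
    and g [measurable]: "random_variable borel g" and gb: "\<And>w. 0 \<le> g w" "\<And>w. g w \<le> 1"
    and ginc: "\<And>j w. j < N \<Longrightarrow> min 1 (c * \<bar>Y (real (Suc j) * \<delta>) w - Y (real j * \<delta>) w\<bar>) \<le> g w"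
    and n: "n \<le> N"
  shows "\<bar>expectation (\<lambda>w. sin (c * (v + Y (real n * \<delta>) w)) * indicator (stay_upto \<delta> v r n) w)
      - exp (- (c\<^sup>2 * \<delta> / 2)) ^ n * sin (c * v)\<bar>
    \<le> expectation (\<lambda>w. g w * (1 - indicator (stay_upto \<delta> v r n) w))"
  using n
proof (induction n)
  case 0
  have "expectation (\<lambda>w. sin (c * (v + Y (real 0 * \<delta>) w)) * indicator (stay_upto \<delta> v r 0) w) = expectation (\<lambda>_. sin (c * v))"
    using v by (intro Bochner_Integration.integral_cong refl) (simp add: stay_upto_def start_BM)
  moreover have "0 \<le> expectation (\<lambda>w. g w * (1 - indicator (stay_upto \<delta> v r 0) w))"
    using gb by (intro integral_nonneg_AE AE_I2) (auto simp: indicator_def)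
  ultimately show ?case by (simp add: prob_space)
next
  case (Suc n)
  let ?S = "stay_upto \<delta> v r"
  let ?\<phi> = "\<lambda>k w. sin (c * (v + Y (real k * \<delta>) w))"
  let ?q = "exp (- (c\<^sup>2 * \<delta> / 2))"
  \<comment> \<open>The paths killed exactly at step \<open>Suc n\<close>.\<close>
  define Z where "Z = ?S n - ?S (Suc n)"
  have [measurable]: "?S k \<in> events" for k using \<delta> by simp
  have [measurable]: "Z \<in> events" unfolding Z_def by measurable
  have [measurable]: "random_variable borel (Y (real k * \<delta>))" for k using \<delta> by (intro measurable_BM) simp
  have int\<phi>: "integrable M (\<lambda>w. ?\<phi> k w * indicator A w)" if [measurable]: "A \<in> events" for k A
  proof (rule integrable_bounded_by_1)
    show "random_variable borel (\<lambda>w. ?\<phi> k w * indicator A w)" by measurable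
  qed (simp add: indicator_def)
  have intg: "integrable M (\<lambda>w. g w * indicator A w)" "integrable M (\<lambda>w. g w * (1 - indicator A w))"
    if [measurable]: "A \<in> events" for A
  proof -
    show "integrable M (\<lambda>w. g w * indicator A w)"
    proof (rule integrable_bounded_by_1)
      show "\<bar>g w * indicator A w\<bar> \<le> 1" for w using gb[of w] by (cases "w \<in> A") simp_all
    qed measurable
    show "integrable M (\<lambda>w. g w * (1 - indicator A w))"
    proof (rule integrable_bounded_by_1)
      show "random_variable borel (\<lambda>w. g w * (1 - indicator A w))"
        by (intro borel_measurable_times borel_measurable_diff borel_measurable_indicator g borel_measurable_const that)
      show "\<bar>g w * (1 - indicator A w)\<bar> \<le> 1" for w using gb[of w] by (cases "w \<in> A") simp_all
    qed
  qed
  have tri: "\<bar>q * x - y\<bar> \<le> q * \<bar>x\<bar> + \<bar>y\<bar>" if "0 \<le> q" for q x y :: real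
    using abs_triangle_ineq4[of "q * x" y] that by (simp add: abs_mult)
  have ind: "indicator (?S (Suc n)) w = (indicator (?S n) w - indicator Z w :: real)" for w
    using stay_upto_Suc[of \<delta> v r n] by (auto simp: Z_def indicator_def)
  define E where "E k = expectation (\<lambda>w. ?\<phi> k w * indicator (?S k) w)" for k
  define G where "G k = expectation (\<lambda>w. g w * (1 - indicator (?S k) w))" for k
  define z where "z = expectation (\<lambda>w. ?\<phi> (Suc n) w * indicator Z w)"
  define q where "q = ?q"
  have q: "0 \<le> q" "q \<le> 1" using \<delta> by (auto simp: q_def)
  have step: "E (Suc n) = q * E n - z"
  proof -
    have "E (Suc n) = expectation (\<lambda>w. ?\<phi> (Suc n) w * indicator (?S n) w) - z"
      unfolding E_def z_def ind right_diff_distrib by (intro Bochner_Integration.integral_diff int\<phi>) measurable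
    then show ?thesis unfolding killed_walk_step[OF \<delta>] E_def q_def .
  qed
  have z: "\<bar>z\<bar> \<le> expectation (\<lambda>w. g w * indicator Z w)"
  proof -
    have "\<bar>?\<phi> (Suc n) w * indicator Z w\<bar> \<le> g w * indicator Z w" for w
    proof (cases "w \<in> Z")
      case True
      then have up: "v + Y (real n * \<delta>) w \<in> {0..r}" "v + Y (real (Suc n) * \<delta>) w \<notin> {0..r}"
        unfolding Z_def stay_upto_def by (auto simp del: atLeastAtMost_iff of_nat_Suc simp: le_Suc_eq)
      have "\<bar>?\<phi> (Suc n) w\<bar> \<le> min 1 (c * \<bar>(v + Y (real (Suc n) * \<delta>) w) - (v + Y (real n * \<delta>) w)\<bar>)"
        by (rule sin_overshoot[OF c up])
      also have "(v + Y (real (Suc n) * \<delta>) w) - (v + Y (real n * \<delta>) w) = Y (real (Suc n) * \<delta>) w - Y (real n * \<delta>) w"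
        by (simp only: add_diff_cancel_left)
      also have "min 1 (c * \<bar>Y (real (Suc n) * \<delta>) w - Y (real n * \<delta>) w\<bar>) \<le> g w"
        using Suc.prems by (intro ginc) simp
      finally show ?thesis using True by (simp only: indicator_simps mult_1_right)
    qed simp
    then have "expectation (\<lambda>w. \<bar>?\<phi> (Suc n) w * indicator Z w\<bar>) \<le> expectation (\<lambda>w. g w * indicator Z w)"
      by (intro integral_mono integrable_abs int\<phi> intg) measurable
    then show ?thesis
      using integral_abs_bound[of M "\<lambda>w. ?\<phi> (Suc n) w * indicator Z w"] unfolding z_def by linarith
  qed
  have G: "G (Suc n) = G n + expectation (\<lambda>w. g w * indicator Z w)"
  proof -
    have "G (Suc n) = expectation (\<lambda>w. g w * (1 - indicator (?S n) w) + g w * indicator Z w)"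
      unfolding G_def ind by (intro Bochner_Integration.integral_cong refl) (simp only: algebra_simps)
    then show ?thesis unfolding G_def by (subst (asm) Bochner_Integration.integral_add) (auto intro!: intg)
  qed
  have IH: "\<bar>E n - q ^ n * sin (c * v)\<bar> \<le> G n" using Suc unfolding E_def G_def q_def by simp
  have "\<bar>E (Suc n) - q ^ Suc n * sin (c * v)\<bar> = \<bar>q * (E n - q ^ n * sin (c * v)) - z\<bar>"
    unfolding step by (simp add: right_diff_distrib)
  also have "\<dots> \<le> q * \<bar>E n - q ^ n * sin (c * v)\<bar> + \<bar>z\<bar>" by (rule tri[OF q(1)])
  also have "\<dots> \<le> 1 * G n + expectation (\<lambda>w. g w * indicator Z w)"
    using q IH z by (intro add_mono mult_mono) auto
  finally show ?case using G unfolding E_def G_def q_def by simp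
qed

lemma oscillation_tendsto_0:
  assumes t: "t > 0" and w: "w \<in> space M"
  shows "(\<lambda>m. MAX j\<in>{..<2 ^ m}. \<bar>Y (real (Suc j) * (t / 2 ^ m)) w - Y (real j * (t / 2 ^ m)) w\<bar>) \<longlonglongrightarrow> 0"
proof (rule LIMSEQ_I)
  fix e :: real assume e: "e > 0"
  have "uniformly_continuous_on {0..t} (\<lambda>s. Y s w)"
    by (intro compact_uniformly_continuous continuous_path[OF w]) simp
  then obtain d where d: "d > 0" "\<And>s s'. s \<in> {0..t} \<Longrightarrow> s' \<in> {0..t} \<Longrightarrow> dist s' s < d \<Longrightarrow> dist (Y s' w) (Y s w) < e"
    using e unfolding uniformly_continuous_on_def by metis
  obtain N where N: "t / d < 2 ^ N" using real_arch_pow[of 2 "t / d"] by auto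
  show "\<exists>N. \<forall>m\<ge>N. norm ((MAX j\<in>{..<2 ^ m}. \<bar>Y (real (Suc j) * (t / 2 ^ m)) w - Y (real j * (t / 2 ^ m)) w\<bar>) - 0) < e"
  proof (intro exI allI impI)
    fix m assume "m \<ge> N"
    then have "(2::real) ^ N \<le> 2 ^ m" by simp
    then have "t / 2 ^ m \<le> t / 2 ^ N" using t by (intro divide_left_mono) auto
    also have "t / 2 ^ N < d" using N d(1) by (simp add: field_simps)
    finally have small: "t / 2 ^ m < d" .
    have "\<bar>Y (real (Suc j) * (t / 2 ^ m)) w - Y (real j * (t / 2 ^ m)) w\<bar> < e" if "j < 2 ^ m" for j
    proof -
      have "Suc j \<le> 2 ^ m" using that by simp
      then have j: "real (Suc j) \<le> 2 ^ m" by (metis of_nat_le_iff of_nat_numeral of_nat_power)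
      have in1: "real (Suc j) * (t / 2 ^ m) \<in> {0..t}"
        using mult_right_mono[OF j, of "t / 2 ^ m"] t by simp
      have in0: "real j * (t / 2 ^ m) \<in> {0..t}"
        using mult_right_mono[OF j, of "t / 2 ^ m"] t by (simp add: distrib_right add_divide_distrib)
           (smt (verit) divide_pos_pos zero_less_power)
      have "dist (real (Suc j) * (t / 2 ^ m)) (real j * (t / 2 ^ m)) = t / 2 ^ m"
        using t by (simp add: dist_real_def algebra_simps add_divide_distrib)
      then show ?thesis using d(2)[OF in0 in1] small by (simp add: dist_real_def)
    qed
    note bound = this
    have ne: "{..<2 ^ m :: nat} \<noteq> {}" by (simp only: lessThan_empty_iff) simp
    have "(MAX j\<in>{..<2 ^ m}. \<bar>Y (real (Suc j) * (t / 2 ^ m)) w - Y (real j * (t / 2 ^ m)) w\<bar>) < e"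
      using bound ne by (subst Max_less_iff) (blast | simp only: finite_imageI finite_lessThan image_is_empty)+
    moreover have "0 \<le> (MAX j\<in>{..<2 ^ m}. \<bar>Y (real (Suc j) * (t / 2 ^ m)) w - Y (real j * (t / 2 ^ m)) w\<bar>)"
    proof -
      have "0 \<le> \<bar>Y (real (Suc 0) * (t / 2 ^ m)) w - Y (real 0 * (t / 2 ^ m)) w\<bar>" by (rule abs_ge_zero)
      also have "\<dots> \<le> (MAX j\<in>{..<2 ^ m}. \<bar>Y (real (Suc j) * (t / 2 ^ m)) w - Y (real j * (t / 2 ^ m)) w\<bar>)"
        by (intro Max_ge finite_imageI finite_lessThan imageI) simp
      finally show ?thesis .
    qed
    ultimately show "norm ((MAX j\<in>{..<2 ^ m}. \<bar>Y (real (Suc j) * (t / 2 ^ m)) w - Y (real j * (t / 2 ^ m)) w\<bar>) - 0) < e"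
      by simp
  qed
qed

section \<open>Passage to continuous time and the sine expansion of the staying probability\<close>

definition stay :: "real \<Rightarrow> real \<Rightarrow> real \<Rightarrow> 'w set" where
  "stay t v r = {w \<in> space M. \<forall>s\<in>{0..t}. v + Y s w \<in> {0..r}}"

lemma stay_alt: "stay t v r = {w \<in> space M. \<forall>s\<in>{0..t}. Y s w \<in> {- v..r - v}}"
proof -
  have "v + y \<in> {0..r} \<longleftrightarrow> y \<in> {- v..r - v}" for y by auto
  then show ?thesis unfolding stay_def by (simp only:)
qed

lemma stay_measurable [measurable]: "0 \<le> t \<Longrightarrow> stay t v r \<in> events"
  unfolding stay_alt using closed_stay_process_event[of t "{- v..r - v}"] process_events_subset by auto

lemma stay_eq_INT:
  assumes "t \<ge> 0" shows "stay t v r = (\<Inter>m. stay_upto (t / 2 ^ m) v r (2 ^ m))"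
proof -
  have "stay t v r = (\<Inter>m. {w \<in> space M. \<forall>j\<le>2 ^ m. Y (t * real j / 2 ^ m) w \<in> {- v..r - v}})"
    unfolding stay_alt using closed_stay_eq_grid[OF assms, of "{- v..r - v}"] by simp
  moreover have "v + y \<in> {0..r} \<longleftrightarrow> y \<in> {- v..r - v}" for y by auto
  ultimately show ?thesis unfolding stay_upto_def by (simp only: times_divide_eq_right mult.commute[of t])
qed

lemma stay_upto_decseq: "decseq (\<lambda>m. stay_upto (t / 2 ^ m) v r (2 ^ m))"
proof (rule decseq_SucI, rule subsetI)
  fix m w assume wS: "w \<in> stay_upto (t / 2 ^ Suc m) v r (2 ^ Suc m)"
  have grid: "real j * (t / 2 ^ k) = t * real j / 2 ^ k" for j k by simp
  have "w \<in> space M \<and> (\<forall>j\<le>2 ^ Suc m. v + Y (t * real j / 2 ^ Suc m) w \<in> {0..r})"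
    using wS unfolding stay_upto_def grid mem_Collect_eq .
  note w = conjunct1[OF this] conjunct2[OF this]
  show "w \<in> stay_upto (t / 2 ^ m) v r (2 ^ m)"
    using grid_mono[of m "\<lambda>s. v + Y s w \<in> {0..r}" t, OF w(2)] w(1)
    unfolding stay_upto_def grid mem_Collect_eq by (intro conjI allI impI)
qed

text \<open>The stopping argument is carried out on dyadic grids. The discrete error is at most the
  mean of the truncated largest grid increment, which tends to \<open>0\<close> by continuity of
  paths and dominated convergence, while the grid events decrease to \<open>stay\<close>.\<close>

lemma expectation_killed_sin:
  assumes t: "t > 0" and c: "c \<ge> 0" "sin (c * r) = 0" and v: "v \<in> {0..r}"
  shows "expectation (\<lambda>w. sin (c * (v + Y t w)) * indicator (stay t v r) w) = exp (- (c\<^sup>2 * t / 2)) * sin (c * v)"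
proof -
  define S where "S m = stay_upto (t / 2 ^ m) v r (2 ^ m)" for m
  \<comment> \<open>One random variable dominating the overshoot of every step. The minimum with
    \<open>1\<close> provides the integrable majorant.\<close>
  define g where "g m w = min 1 (c * (MAX j\<in>{..<2 ^ m}. \<bar>Y (real (Suc j) * (t / 2 ^ m)) w - Y (real j * (t / 2 ^ m)) w\<bar>))"
    for m :: nat and w
  define a where "a m = expectation (\<lambda>w. sin (c * (v + Y t w)) * indicator (S m) w)" for m
  have [measurable]: "random_variable borel (Y s)" if "s \<ge> 0" for s using that by (rule measurable_BM)
  have [measurable]: "random_variable borel (Y t)" using t by (intro measurable_BM) simp
  have [measurable]: "S m \<in> events" for m unfolding S_def using t by (intro stay_upto_measurable) simp
  have [measurable]: "stay t v r \<in> events" using t by (intro stay_measurable) simp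
  have g_meas [measurable]: "random_variable borel (g m)" for m
  proof -
    have "random_variable borel (\<lambda>w. MAX j\<in>{..<2 ^ m}. \<bar>Y (real (Suc j) * (t / 2 ^ m)) w - Y (real j * (t / 2 ^ m)) w\<bar>)"
      using t by (intro borel_measurable_Max borel_measurable_abs borel_measurable_diff measurable_BM) auto
    then show ?thesis unfolding g_def by measurable
  qed
  have ne: "{..<2 ^ m :: nat} \<noteq> {}" for m by (simp add: lessThan_empty_iff)
  have g_ge: "min 1 (c * \<bar>Y (real (Suc j) * (t / 2 ^ m)) w - Y (real j * (t / 2 ^ m)) w\<bar>) \<le> g m w"
    if "j < 2 ^ m" for j m w
    unfolding g_def using that c by (intro min.mono order_refl mult_left_mono Max_ge) auto
  have g01: "0 \<le> g m w" "g m w \<le> 1" for m w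
  proof -
    have "0 \<le> min 1 (c * \<bar>Y (real (Suc 0) * (t / 2 ^ m)) w - Y (real 0 * (t / 2 ^ m)) w\<bar>)" using c by simp
    also have "\<dots> \<le> g m w" by (rule g_ge) simp
    finally show "0 \<le> g m w" .
  qed (simp add: g_def)
  have err: "\<bar>a m - exp (- (c\<^sup>2 * t / 2)) * sin (c * v)\<bar> \<le> expectation (g m)" for m
  proof -
    have "\<bar>a m - exp (- (c\<^sup>2 * (t / 2 ^ m) / 2)) ^ (2 ^ m) * sin (c * v)\<bar>
        \<le> expectation (\<lambda>w. g m w * (1 - indicator (S m) w))"
      using killed_walk_error[of "t / 2 ^ m" c r v "g m" "2 ^ m" "2 ^ m"] t c v g01 g_ge
      unfolding a_def S_def by simp
    also have "exp (- (c\<^sup>2 * (t / 2 ^ m) / 2)) ^ (2 ^ m) = exp (- (c\<^sup>2 * t / 2))"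
      by (simp add: exp_of_nat_mult[symmetric])
    also have "expectation (\<lambda>w. g m w * (1 - indicator (S m) w)) \<le> expectation (g m)"
      using g01 by (intro integral_mono integrable_const_bound[of _ 1]) (auto simp: indicator_def)
    finally show ?thesis .
  qed
  have "(\<lambda>m. expectation (g m)) \<longlonglongrightarrow> expectation (\<lambda>_. 0)"
  proof (rule integral_dominated_convergence[where w="\<lambda>_. 1"])
    show "AE w in M. (\<lambda>m. g m w) \<longlonglongrightarrow> 0"
    proof (rule AE_I2)
      fix w assume "w \<in> space M"
      from oscillation_tendsto_0[OF t this]
      have "(\<lambda>m. g m w) \<longlonglongrightarrow> min 1 (c * 0)" unfolding g_def by (intro tendsto_intros)
      then show "(\<lambda>m. g m w) \<longlonglongrightarrow> 0" by simp
    qed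
  qed (use g01 in auto)
  then have g0: "(\<lambda>m. expectation (g m)) \<longlonglongrightarrow> 0" by simp
  have "(\<lambda>m. a m - exp (- (c\<^sup>2 * t / 2)) * sin (c * v)) \<longlonglongrightarrow> 0"
    by (rule Lim_null_comparison[OF _ g0]) (use err in auto)
  then have lim1: "a \<longlonglongrightarrow> exp (- (c\<^sup>2 * t / 2)) * sin (c * v)" by (rule LIM_zero_cancel)
  have "a \<longlonglongrightarrow> expectation (\<lambda>w. sin (c * (v + Y t w)) * indicator (stay t v r) w)"
    unfolding a_def
  proof (rule integral_dominated_convergence[where w="\<lambda>_. 1"])
    show "AE w in M. (\<lambda>m. sin (c * (v + Y t w)) * indicator (S m) w) \<longlonglongrightarrow> sin (c * (v + Y t w)) * indicator (stay t v r) w"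
    proof (rule AE_I2)
      fix w
      have "(\<lambda>m. indicator (S m) w :: real) \<longlonglongrightarrow> indicator (\<Inter>m. S m) w"
        unfolding S_def using stay_upto_decseq by (rule LIMSEQ_indicator_decseq)
      then show "(\<lambda>m. sin (c * (v + Y t w)) * indicator (S m) w) \<longlonglongrightarrow> sin (c * (v + Y t w)) * indicator (stay t v r) w"
        using stay_eq_INT[of t v r] t unfolding S_def by (intro tendsto_intros) simp
    qed
    show "AE w in M. norm (sin (c * (v + Y t w)) * indicator (S m) w) \<le> 1" for m
      by (intro AE_I2) (simp add: indicator_def)
  qed auto
  from LIMSEQ_unique[OF this lim1] show ?thesis .
qed

text \<open>The heat factor at time \<open>t\<close> of \<open>odd_sine r i\<close>, whose
  eigenvalue for minus half the second derivative is
  \<open>((2 * i + 1) * pi / r)^2 / 2\<close>.\<close>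

definition mode :: "real \<Rightarrow> real \<Rightarrow> nat \<Rightarrow> real" where
  "mode t r i = exp (- ((real (2 * i + 1) * pi / r)\<^sup>2 * t / 2))"

lemma expectation_killed_odd_sine:
  assumes "t > 0" "r > 0" "v \<in> {0..r}"
  shows "expectation (\<lambda>w. odd_sine r i (v + Y t w) * indicator (stay t v r) w) = mode t r i * odd_sine r i v"
proof -
  have "real (2 * i + 1) * pi / r * r = real (2 * i + 1) * pi" using assms by simp
  then have s: "sin (real (2 * i + 1) * pi / r * r) = 0" by (simp only: sin_npi)
  have c: "0 \<le> real (2 * i + 1) * pi / r" using assms by (intro divide_nonneg_pos mult_nonneg_nonneg) auto
  show ?thesis unfolding odd_sine_def mode_def by (rule expectation_killed_sin[OF assms(1) c s assms(3)])
qed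

text \<open>The Gaussian density never exceeds its value \<open>1 / sqrt (2 * pi * t)\<close> at the
  centre. Hence an error that is small in L1 is small in expectation, uniformly in
  \<open>v\<close>.\<close>

lemma expectation_density_bound:
  fixes h :: "real \<Rightarrow> real"
  assumes t: "t > 0" and int: "integrable lborel h" and h0: "\<And>x. 0 \<le> h x"
  shows "expectation (\<lambda>w. h (v + Y t w)) \<le> 1 / sqrt (2 * pi * t) * (LINT x|lborel. h x)"
proof -
  have [measurable]: "h \<in> borel_measurable borel" using borel_measurable_integrable[OF int] by simp
  have d: "distributed M lborel (\<lambda>w. Y t w - Y 0 w) (normal_density 0 (sqrt t))"
    using distributed_increment[of 0 t] t by simp
  have inth: "integrable lborel (\<lambda>x. h (v + x))"
    using lborel_integrable_real_affine[OF int, of 1 v] by simp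
  have nd: "normal_density 0 (sqrt t) x \<le> 1 / sqrt (2 * pi * t)" for x
  proof -
    have "normal_density 0 (sqrt t) x = 1 / sqrt (2 * pi * t) * exp (- x\<^sup>2 / (2 * t))"
      using t by (simp add: normal_density_def)
    also have "\<dots> \<le> 1 / sqrt (2 * pi * t) * 1" using t by (intro mult_left_mono) auto
    finally show ?thesis by simp
  qed
  have "expectation (\<lambda>w. h (v + Y t w)) = expectation (\<lambda>w. h (v + (Y t w - Y 0 w)))"
    by (intro Bochner_Integration.integral_cong refl) (simp add: start_BM)
  also have "\<dots> = (LINT x|lborel. normal_density 0 (sqrt t) x * h (v + x))"
    by (rule distributed_integral[OF d, symmetric]) auto
  also have "\<dots> \<le> (LINT x|lborel. 1 / sqrt (2 * pi * t) * h (v + x))"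
  proof (rule integral_mono)
    show "integrable lborel (\<lambda>x. 1 / sqrt (2 * pi * t) * h (v + x))" using inth by (rule integrable_mult_right)
    then show "integrable lborel (\<lambda>x. normal_density 0 (sqrt t) x * h (v + x))"
    proof (rule Bochner_Integration.integrable_bound)
      show "(\<lambda>x. normal_density 0 (sqrt t) x * h (v + x)) \<in> borel_measurable lborel" by measurable
      show "AE x in lborel. norm (normal_density 0 (sqrt t) x * h (v + x)) \<le> norm (1 / sqrt (2 * pi * t) * h (v + x))"
        using nd h0 t by (intro AE_I2) (simp add: abs_mult mult_right_mono del: times_divide_eq_left)
    qed
    show "normal_density 0 (sqrt t) x * h (v + x) \<le> 1 / sqrt (2 * pi * t) * h (v + x)" for x
      using nd h0 by (rule mult_right_mono)
  qed
  also have "\<dots> = 1 / sqrt (2 * pi * t) * (LINT x|lborel. h (v + x))" by simp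
  also have "(LINT x|lborel. h (v + x)) = (LINT x|lborel. h x)"
    using lborel_integral_real_affine[of 1 h v] by simp
  finally show ?thesis .
qed

text \<open>On the staying event the endpoint \<open>v + Y t\<close> lies in \<open>[0, r]\<close>,
  where the constant \<open>1\<close> is approximated by \<open>square_wave\<close>. Each sine has
  an exactly known killed expectation; for the remainder the killing is dropped and the density
  bound applied. The L1 norm suits this, since the partial sums vanish at \<open>0\<close> and
  \<open>r\<close> and thus cannot converge to \<open>1\<close> uniformly.\<close>

lemma stay_prob_approx:
  assumes t: "t > 0" and r: "r > 0" and v: "v \<in> {0..r}"
  shows "\<bar>prob (stay t v r) - (\<Sum>i<n. 4 / (pi * real (2 * i + 1)) * (mode t r i * odd_sine r i v))\<bar>
    \<le> 1 / sqrt (2 * pi * t) * (LINT x:{0..r}|lborel. \<bar>1 - square_wave r n x\<bar>)"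
proof -
  let ?A = "stay t v r"
  have A [measurable]: "?A \<in> events" using t by (intro stay_measurable) simp
  have [measurable]: "random_variable borel (Y t)" using t by (intro measurable_BM) simp
  define h where "h x = \<bar>1 - square_wave r n x\<bar> * indicator {0..r} x" for x
  have int_os: "integrable M (\<lambda>w. odd_sine r i (v + Y t w) * indicator ?A w)" for i
  proof (rule integrable_bounded_by_1)
    show "random_variable borel (\<lambda>w. odd_sine r i (v + Y t w) * indicator ?A w)" by measurable
  qed (simp add: odd_sine_def indicator_def)
  have int_sw: "integrable M (\<lambda>w. square_wave r n (v + Y t w) * indicator ?A w)"
    unfolding square_wave_def sum_distrib_right mult.assoc by (intro Bochner_Integration.integrable_sum integrable_mult_right int_os)
  have sw: "expectation (\<lambda>w. square_wave r n (v + Y t w) * indicator ?A w) =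
     (\<Sum>i<n. 4 / (pi * real (2 * i + 1)) * (mode t r i * odd_sine r i v))"
    unfolding square_wave_def sum_distrib_right mult.assoc
    by (subst Bochner_Integration.integral_sum)
       (intro integrable_mult_right int_os, simp only: integral_mult_right_zero expectation_killed_odd_sine[OF t r v])
  have int1: "integrable M (indicator ?A :: _ \<Rightarrow> real)" by (intro integrable_real_indicator A) (simp add: emeasure_eq_measure)
  have p: "prob ?A = expectation (indicator ?A)"
    by (simp only: Bochner_Integration.integral_indicator sets.Int_space_eq2[OF A])
  have "prob ?A - (\<Sum>i<n. 4 / (pi * real (2 * i + 1)) * (mode t r i * odd_sine r i v)) =
     expectation (\<lambda>w. indicator ?A w - square_wave r n (v + Y t w) * indicator ?A w)"
    unfolding p sw[symmetric] by (rule Bochner_Integration.integral_diff[OF int1 int_sw, symmetric])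
  then have e1: "\<bar>prob ?A - (\<Sum>i<n. 4 / (pi * real (2 * i + 1)) * (mode t r i * odd_sine r i v))\<bar> =
     \<bar>expectation (\<lambda>w. indicator ?A w - square_wave r n (v + Y t w) * indicator ?A w)\<bar>" by (rule arg_cong)
  have e2: "\<bar>expectation (\<lambda>w. indicator ?A w - square_wave r n (v + Y t w) * indicator ?A w)\<bar>
     \<le> expectation (\<lambda>w. \<bar>indicator ?A w - square_wave r n (v + Y t w) * indicator ?A w\<bar>)"
    by (rule integral_abs_bound)
  have e3: "expectation (\<lambda>w. \<bar>indicator ?A w - square_wave r n (v + Y t w) * indicator ?A w\<bar>) \<le> expectation (\<lambda>w. h (v + Y t w))"
  proof (rule integral_mono)
    show "integrable M (\<lambda>w. \<bar>indicator ?A w - square_wave r n (v + Y t w) * indicator ?A w\<bar>)"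
      by (intro integrable_abs Bochner_Integration.integrable_diff int1 int_sw)
    show "integrable M (\<lambda>w. h (v + Y t w))"
    proof (rule integrable_const_bound)
      have "\<bar>square_wave r n x\<bar> \<le> (\<Sum>i<n. 4 / (pi * real (2 * i + 1)))" for x
        unfolding square_wave_def
        by (rule order_trans[OF sum_abs]) (intro sum_mono, simp add: abs_mult odd_sine_def mult_left_le divide_right_mono)
      note sw_bound = this
      have "\<bar>h x\<bar> \<le> 1 + (\<Sum>i<n. 4 / (pi * real (2 * i + 1)))" for x
      proof -
        have "\<bar>h x\<bar> \<le> 1 + \<bar>square_wave r n x\<bar>" unfolding h_def by (cases "x \<in> {0..r}") simp_all
        then show ?thesis using sw_bound[of x] by (rule order_trans[OF _ add_left_mono])
      qed
      then show "AE w in M. norm (h (v + Y t w)) \<le> 1 + (\<Sum>i<n. 4 / (pi * real (2 * i + 1)))"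
        by (intro AE_I2) simp
      show "random_variable borel (\<lambda>w. h (v + Y t w))" unfolding h_def by measurable
    qed
    show "\<bar>indicator ?A w - square_wave r n (v + Y t w) * indicator ?A w\<bar> \<le> h (v + Y t w)" for w
    proof (cases "w \<in> ?A")
      case True
      then have "v + Y t w \<in> {0..r}" using t unfolding stay_def by simp
      then show ?thesis using True by (simp add: h_def)
    qed (simp add: h_def)
  qed
  have e4: "expectation (\<lambda>w. h (v + Y t w)) \<le> 1 / sqrt (2 * pi * t) * (LINT x|lborel. h x)"
  proof (rule expectation_density_bound[OF t])
    have "set_integrable lborel {0..r} (\<lambda>x. \<bar>1 - square_wave r n x\<bar>)"
      by (intro set_integrable_continuous_interval continuous_intros)
    then show "integrable lborel h"
      unfolding set_integrable_def h_def[abs_def] real_scaleR_def by (subst mult.commute)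
  qed (simp add: h_def)
  have e5: "(LINT x|lborel. h x) = (LINT x:{0..r}|lborel. \<bar>1 - square_wave r n x\<bar>)"
    by (simp add: set_integral_alt h_def)
  show ?thesis unfolding e1 e5[symmetric] by (rule order_trans[OF e2 order_trans[OF e3 e4]])
qed

lemma stay_prob_approx_tendsto:
  assumes "r > 0"
  shows "(\<lambda>n. 1 / sqrt (2 * pi * t) * (LINT x:{0..r}|lborel. \<bar>1 - square_wave r n x\<bar>)) \<longlonglongrightarrow> 0"
  by (rule tendsto_mult_right_zero[OF square_wave_L1_tendsto[OF assms]])

lemma mode_eq_power: "mode t r i = mode t r 0 ^ ((2 * i + 1)\<^sup>2)"
proof -
  have "- ((real (2 * i + 1) * pi / r)\<^sup>2 * t / 2) = of_nat ((2 * i + 1)\<^sup>2) * (- ((real (2 * 0 + 1) * pi / r)\<^sup>2 * t / 2))"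
    by (simp add: power_mult_distrib power_divide)
  then show ?thesis unfolding mode_def by (simp only: exp_of_nat_mult)
qed

lemma mode_pos: "mode t r i > 0" by (simp add: mode_def)

lemma mode_le_1: "t \<ge> 0 \<Longrightarrow> mode t r i \<le> 1" by (simp add: mode_def)

text \<open>A crude bound, uniform in the starting point. If the ground mode \<open>q\<close>
  exceeds \<open>1 / 2\<close>, the bound is above \<open>1\<close>; otherwise the expansion is
  dominated by a geometric series with ratio \<open>1 / 2\<close>. The \<open>4\<close> is the
  coefficient bound \<open>2\<close> times the geometric sum \<open>2\<close>.\<close>

lemma stay_prob_le:
  assumes t: "t > 0" and r: "r > 0" and v: "v \<in> {0..r}"
  shows "prob (stay t v r) \<le> 4 * mode t r 0"
proof (cases "mode t r 0 \<le> 1 / 2")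
  case False
  then show ?thesis using prob_le_1[of "stay t v r"] by linarith
next
  case True
  define q where "q = mode t r 0"
  have q: "0 < q" "q \<le> 1 / 2" using True mode_pos by (auto simp: q_def)
  let ?e = "\<lambda>n. 1 / sqrt (2 * pi * t) * (LINT x:{0..r}|lborel. \<bar>1 - square_wave r n x\<bar>)"
  have summand: "4 / (pi * real (2 * i + 1)) * (mode t r i * odd_sine r i v) \<le> 2 * (q * (1 / 2) ^ i)" for i
  proof -
    \<comment> \<open>The true exponent grows quadratically; only this linear lower bound enters the
      geometric series.\<close>
    have "Suc i \<le> (2 * i + 1)\<^sup>2" by (simp add: power2_eq_square)
    then have "mode t r i \<le> q ^ Suc i"
      unfolding mode_eq_power[of t r i] q_def[symmetric] using q by (intro power_decreasing) auto
    also have "\<dots> \<le> q * (1 / 2) ^ i" using q by (auto intro!: mult_left_mono power_mono)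
    finally have m: "mode t r i \<le> q * (1 / 2) ^ i" .
    have c: "4 / (pi * real (2 * i + 1)) \<le> 2"
    proof -
      have "2 * 1 \<le> pi * real (2 * i + 1)" by (intro mult_mono pi_ge_two) auto
      then show ?thesis by (simp add: divide_le_eq)
    qed
    have "mode t r i * odd_sine r i v \<le> mode t r i * 1"
      using mode_pos[of t r i] by (intro mult_left_mono) (auto simp: odd_sine_def)
    then have "4 / (pi * real (2 * i + 1)) * (mode t r i * odd_sine r i v) \<le> 4 / (pi * real (2 * i + 1)) * (q * (1 / 2) ^ i)"
      using m by (intro mult_left_mono) auto
    also have "\<dots> \<le> 2 * (q * (1 / 2) ^ i)" using c q by (intro mult_right_mono) auto
    finally show ?thesis .
  qed
  have "prob (stay t v r) \<le> 4 * q + ?e n" for n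
  proof -
    define s where "s = (\<Sum>i<n. 4 / (pi * real (2 * i + 1)) * (mode t r i * odd_sine r i v))"
    have "s \<le> (\<Sum>i<n. 2 * (q * (1 / 2) ^ i))"
      unfolding s_def by (intro sum_mono summand)
    also have "\<dots> = 2 * q * (\<Sum>i<n. (1 / 2) ^ i)" by (simp add: sum_distrib_left mult.assoc)
    also have "(\<Sum>i<n. (1 / 2) ^ i) = 2 - 2 * (1 / 2 :: real) ^ n"
      by (induction n) (auto simp: field_simps)
    also have "2 * q * (2 - 2 * (1 / 2) ^ n) \<le> 2 * q * 2" using q by (intro mult_left_mono) auto
    finally have "s \<le> 4 * q" by simp
    moreover have "prob (stay t v r) - s \<le> ?e n"
      unfolding s_def by (rule abs_le_D1[OF stay_prob_approx[OF t r v]])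
    ultimately show ?thesis by linarith
  qed
  moreover have "(\<lambda>n. 4 * q + ?e n) \<longlonglongrightarrow> 4 * q + 0"
    by (intro tendsto_add tendsto_const stay_prob_approx_tendsto[OF r])
  ultimately show ?thesis unfolding q_def[symmetric]
    using LIMSEQ_le_const[of "\<lambda>n. 4 * q + ?e n" "4 * q" "prob (stay t v r)"] by auto
qed

text \<open>After integration over the starting point all terms become positive, with weights
  \<open>8 / (pi * (2 * i + 1))^2\<close> times \<open>r\<close>. So the first term alone is a lower
  bound, and the other terms together are at most \<open>r * mode t r 1\<close>, because the weights
  sum to at most \<open>1\<close> and the modes decrease.\<close>

lemma stay_prob_integral_bounds:
  assumes t: "t > 0" and r: "r > 0" and meas: "(\<lambda>v. prob (stay t v r)) \<in> borel_measurable borel"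
  shows "8 / pi\<^sup>2 * (r * mode t r 0) \<le> (LINT v:{0..r}|lborel. prob (stay t v r))" (is "?lower \<le> ?I")
    and "(LINT v:{0..r}|lborel. prob (stay t v r)) \<le> 8 / pi\<^sup>2 * (r * mode t r 0) + r * mode t r 1"
proof -
  let ?e = "\<lambda>n. 1 / sqrt (2 * pi * t) * (LINT x:{0..r}|lborel. \<bar>1 - square_wave r n x\<bar>)"
  define S where "S n v = (\<Sum>i<n. 4 / (pi * real (2 * i + 1)) * (mode t r i * odd_sine r i v))" for n v
  define d where "d i = 8 / (pi * real (2 * i + 1))\<^sup>2" for i :: nat
  have const: "(LINT x:{0..r}|lborel. c) = r * c" for c :: real
    using r by (simp add: set_lebesgue_integral_def)
  have contS: "continuous_on {0..r} (S n)" for n unfolding S_def[abs_def] by (intro continuous_intros)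
  have intS: "set_integrable lborel {0..r} (\<lambda>v. S n v + c)" for n c
    by (intro set_integrable_continuous_interval continuous_intros contS)
  have intp: "set_integrable lborel {0..r} (\<lambda>v. prob (stay t v r))"
  proof (rule set_integrable_bound[of lborel "{0..r}" "\<lambda>_. 1::real"])
    show "set_integrable lborel {0..r} (\<lambda>_. 1::real)" by (intro set_integrable_continuous_interval continuous_intros)
    show "set_borel_measurable lborel {0..r} (\<lambda>v. prob (stay t v r))"
      unfolding set_borel_measurable_def using meas by measurable
  qed auto
  have IS: "(LINT v:{0..r}|lborel. S n v) = r * (\<Sum>i<n. d i * mode t r i)" for n
  proof -
    have "(LINT v:{0..r}|lborel. S n v) = (\<Sum>i<n. LINT v:{0..r}|lborel. 4 / (pi * real (2 * i + 1)) * (mode t r i * odd_sine r i v))"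
      unfolding S_def by (intro set_integral_sum set_integrable_continuous_interval continuous_intros)
    also have "\<dots> = (\<Sum>i<n. r * (d i * mode t r i))"
      unfolding set_integral_mult_right LINT_odd_sine[OF r]
      by (intro sum.cong refl) (simp add: d_def power2_eq_square)
    finally show ?thesis by (simp add: sum_distrib_left)
  qed
  have ISc: "(LINT v:{0..r}|lborel. S n v + c) = r * (\<Sum>i<n. d i * mode t r i) + r * c" for n c
    using set_integral_add(2)[OF intS[of n 0] set_integrable_continuous_interval[of r "\<lambda>_. c"]] IS const by simp
  have up: "?I \<le> r * (\<Sum>i<n. d i * mode t r i) + r * ?e n" for n
    unfolding ISc[symmetric]
    by (rule set_integral_mono[OF intp intS]) (use stay_prob_approx[OF t r, of _ n] in \<open>fastforce simp: S_def abs_le_iff\<close>)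
  have low: "r * (\<Sum>i<n. d i * mode t r i) + r * (- ?e n) \<le> ?I" for n
    unfolding ISc[symmetric]
    by (rule set_integral_mono[OF intS intp]) (use stay_prob_approx[OF t r, of _ n] in \<open>fastforce simp: S_def abs_le_iff\<close>)
  have d0: "d 0 = 8 / pi\<^sup>2" by (simp add: d_def)
  have dpos: "d i \<ge> 0" for i by (simp add: d_def)
  have sum_eq: "(\<Sum>i<Suc n. d i * mode t r i) = 8 / pi\<^sup>2 * mode t r 0 + (\<Sum>i<n. d (Suc i) * mode t r (Suc i))" for n
    by (simp only: sum.lessThan_Suc_shift d0)
  have tail0: "0 \<le> (\<Sum>i<n. d (Suc i) * mode t r (Suc i))" for n
    by (intro sum_nonneg mult_nonneg_nonneg dpos less_imp_le[OF mode_pos])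
  have tail1: "(\<Sum>i<n. d (Suc i) * mode t r (Suc i)) \<le> mode t r 1" for n
  proof -
    have mono: "mode t r (Suc i) \<le> mode t r 1" for i
      unfolding mode_eq_power[of t r "Suc i"] mode_eq_power[of t r 1]
      using mode_pos[of t r 0] mode_le_1[of t r 0] t by (intro power_decreasing power_mono) auto
    have "(\<Sum>i<n. d (Suc i) * mode t r (Suc i)) \<le> (\<Sum>i<n. d (Suc i) * mode t r 1)"
      by (intro sum_mono mult_left_mono mono dpos)
    also have "\<dots> = (\<Sum>i<n. d (Suc i)) * mode t r 1" by (simp add: sum_distrib_right)
    also have "\<dots> \<le> 1 * mode t r 1"
    proof (intro mult_right_mono less_imp_le[OF mode_pos])
      have "(\<Sum>i<n. d (Suc i)) \<le> (\<Sum>i<Suc n. d i)" unfolding sum.lessThan_Suc_shift using dpos[of 0] by simp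
      also have "\<dots> \<le> 1" unfolding d_def by (rule inverse_odd_squares_partial_le)
      finally show "(\<Sum>i<n. d (Suc i)) \<le> 1" .
    qed
    finally show ?thesis by simp
  qed
  have e0: "(\<lambda>n. ?e (Suc n)) \<longlonglongrightarrow> 0" by (rule LIMSEQ_Suc[OF stay_prob_approx_tendsto[OF r]])
  show "?lower \<le> ?I"
  proof (rule LIMSEQ_le_const2)
    show "(\<lambda>n. r * (8 / pi\<^sup>2 * mode t r 0) + r * (- ?e (Suc n))) \<longlonglongrightarrow> ?lower"
      using tendsto_add[OF tendsto_const[of "r * (8 / pi\<^sup>2 * mode t r 0)"] tendsto_mult_left[OF tendsto_minus[OF e0], of r]]
      by (simp add: mult_ac)
    have "r * (8 / pi\<^sup>2 * mode t r 0) + r * (- ?e (Suc n)) \<le> ?I" for n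
    proof -
      have "r * (8 / pi\<^sup>2 * mode t r 0) \<le> r * (\<Sum>i<Suc n. d i * mode t r i)"
        unfolding sum_eq using r tail0[of n] by (intro mult_left_mono) auto
      then show ?thesis using low[of "Suc n"] by linarith
    qed
    then show "\<exists>N. \<forall>n\<ge>N. r * (8 / pi\<^sup>2 * mode t r 0) + r * (- ?e (Suc n)) \<le> ?I" by blast
  qed
  show "?I \<le> 8 / pi\<^sup>2 * (r * mode t r 0) + r * mode t r 1"
  proof (rule LIMSEQ_le_const)
    show "(\<lambda>n. r * (8 / pi\<^sup>2 * mode t r 0 + mode t r 1) + r * ?e (Suc n)) \<longlonglongrightarrow> 8 / pi\<^sup>2 * (r * mode t r 0) + r * mode t r 1"
      using tendsto_add[OF tendsto_const[of "r * (8 / pi\<^sup>2 * mode t r 0 + mode t r 1)"] tendsto_mult_left[OF e0, of r]]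
      by (simp add: algebra_simps)
    have "?I \<le> r * (8 / pi\<^sup>2 * mode t r 0 + mode t r 1) + r * ?e (Suc n)" for n
    proof -
      have "r * (\<Sum>i<Suc n. d i * mode t r i) \<le> r * (8 / pi\<^sup>2 * mode t r 0 + mode t r 1)"
        unfolding sum_eq using r tail1[of n] by (intro mult_left_mono) auto
      then show ?thesis using up[of "Suc n"] by linarith
    qed
    then show "\<exists>N. \<forall>n\<ge>N. ?I \<le> r * (8 / pi\<^sup>2 * mode t r 0 + mode t r 1) + r * ?e (Suc n)" by blast
  qed
qed

end

section \<open>The range of one-dimensional Brownian motion\<close>

lemma nn_integral_exp_tail:
  fixes lam a :: real assumes "lam > 0"
  shows "(\<integral>\<^sup>+u. ennreal (lam * exp (- (lam * u))) * indicator {a..} u \<partial>lborel) = ennreal (exp (- (lam * a)))"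
proof -
  have "((\<lambda>u. - exp (- (lam * u))) \<longlongrightarrow> 0) at_top" using assms by real_asymp
  then have "(\<integral>\<^sup>+u. ennreal (lam * exp (- (lam * u))) * indicator {a..} u \<partial>lborel) = ennreal (0 - - exp (- (lam * a)))"
    using assms by (intro nn_integral_FTC_atLeast) (auto intro!: derivative_eq_intros)
  then show ?thesis by simp
qed

lemma nn_integral_linear_exp_tail:
  fixes lam a :: real assumes "lam > 0"
  shows "(\<integral>\<^sup>+r. ennreal (lam\<^sup>2 * exp (- (lam * r)) * (r - a)) * indicator {a..} r \<partial>lborel) = ennreal (exp (- (lam * a)))"
proof -
  have "((\<lambda>r. - ((lam * (r - a) + 1) * exp (- (lam * r)))) \<longlongrightarrow> 0) at_top" using assms by real_asymp
  then have "(\<integral>\<^sup>+r. ennreal (lam\<^sup>2 * exp (- (lam * r)) * (r - a)) * indicator {a..} r \<partial>lborel) =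
      ennreal (0 - - ((lam * (a - a) + 1) * exp (- (lam * a))))"
    using assms
    by (intro nn_integral_FTC_atLeast) (auto intro!: derivative_eq_intros simp: power2_eq_square algebra_simps)
  then show ?thesis by simp
qed

context real_brownian_motion
begin

section \<open>The two one-sided maxima and the exponential moment of the range\<close>

definition hi :: "real \<Rightarrow> 'w \<Rightarrow> real" where "hi t w = (SUP s\<in>{0..t}. Y s w)"

definition lo :: "real \<Rightarrow> 'w \<Rightarrow> real" where "lo t w = (SUP s\<in>{0..t}. - Y s w)"

lemma path_bdd:
  assumes "w \<in> space M"
  shows "bdd_above ((\<lambda>s. Y s w) ` {0..t})" "bdd_above ((\<lambda>s. - Y s w) ` {0..t})"
proof -
  have "compact ((\<lambda>s. Y s w) ` {0..t})" "compact ((\<lambda>s. - Y s w) ` {0..t})"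
    using continuous_path[OF assms] by (auto intro!: compact_continuous_image continuous_intros)
  then show "bdd_above ((\<lambda>s. Y s w) ` {0..t})" "bdd_above ((\<lambda>s. - Y s w) ` {0..t})"
    by (auto intro: bounded_imp_bdd_above compact_imp_bounded)
qed

lemma hi_le_iff: "t \<ge> 0 \<Longrightarrow> w \<in> space M \<Longrightarrow> hi t w \<le> u \<longleftrightarrow> (\<forall>s\<in>{0..t}. Y s w \<le> u)"
  unfolding hi_def by (rule cSUP_le_iff) (use path_bdd in auto)

lemma lo_le_iff: "t \<ge> 0 \<Longrightarrow> w \<in> space M \<Longrightarrow> lo t w \<le> u \<longleftrightarrow> (\<forall>s\<in>{0..t}. - Y s w \<le> u)"
  unfolding lo_def by (rule cSUP_le_iff) (use path_bdd in auto)

lemma hi_lo_nonneg: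
  assumes "t \<ge> 0" "w \<in> space M" shows "0 \<le> hi t w" "0 \<le> lo t w"
proof -
  have "Y 0 w \<le> hi t w" "- Y 0 w \<le> lo t w"
    using hi_le_iff[OF assms, of "hi t w"] lo_le_iff[OF assms, of "lo t w"] assms(1) by auto
  then show "0 \<le> hi t w" "0 \<le> lo t w" using start_BM[OF assms(2)] by auto
qed

lemma hi_lo_process_measurable:
  assumes "t \<ge> 0"
  shows "hi t \<in> borel_measurable (sigma (space M) (process_events M Y))"
    and "lo t \<in> borel_measurable (sigma (space M) (process_events M Y))"
proof -
  have 1: "{w \<in> space M. hi t w \<le> u} = {w \<in> space M. \<forall>s\<in>{0..t}. Y s w \<in> {..u}}" for u
    using hi_le_iff[OF assms] by auto
  have 2: "{w \<in> space M. lo t w \<le> u} = {w \<in> space M. \<forall>s\<in>{0..t}. Y s w \<in> {- u..}}" for u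
    using lo_le_iff[OF assms] by (auto simp: minus_le_iff)
  show "hi t \<in> borel_measurable (sigma (space M) (process_events M Y))"
    unfolding borel_measurable_iff_le sets_sigma_process_events space_measure_of_conv 1
    by (intro allI closed_stay_process_event assms closed_atMost)
  show "lo t \<in> borel_measurable (sigma (space M) (process_events M Y))"
    unfolding borel_measurable_iff_le sets_sigma_process_events space_measure_of_conv 2
    by (intro allI closed_stay_process_event assms closed_atLeast)
qed

lemma hi_lo_measurable:
  assumes "t \<ge> 0" shows "random_variable borel (hi t)" "random_variable borel (lo t)"
  using hi_lo_process_measurable[OF assms] measurable_from_subalg[OF subalgebra_process_events] by auto

lemma stay_iff:
  assumes "t \<ge> 0" "w \<in> space M"
  shows "w \<in> stay t v r \<longleftrightarrow> lo t w \<le> v \<and> hi t w \<le> r - v"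
proof -
  have "v + y \<in> {0..r} \<longleftrightarrow> - y \<le> v \<and> y \<le> r - v" for y by auto
  then show ?thesis unfolding lo_le_iff[OF assms] hi_le_iff[OF assms] using assms(2) by (auto simp: stay_def)
qed

lemma stay_empty:
  assumes "t \<ge> 0" "v \<notin> {0..r}" shows "stay t v r = {}"
proof -
  have "w \<notin> stay t v r" for w
  proof
    assume w: "w \<in> stay t v r"
    then have sp: "w \<in> space M" by (simp add: stay_def)
    show False using w hi_lo_nonneg[OF assms(1) sp] assms(2) unfolding stay_iff[OF assms(1) sp] by auto
  qed
  then show ?thesis by blast
qed

lemma emeasure_stay_eq:
  assumes "t \<ge> 0"
  shows "emeasure M (stay t v r) = (\<integral>\<^sup>+w. (if lo t w \<le> v \<and> hi t w \<le> r - v then 1 else 0) \<partial>M)"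
proof -
  have "emeasure M (stay t v r) = (\<integral>\<^sup>+w. indicator (stay t v r) w \<partial>M)"
    by (rule nn_integral_indicator[symmetric, OF stay_measurable[OF assms]])
  also have "\<dots> = (\<integral>\<^sup>+w. (if lo t w \<le> v \<and> hi t w \<le> r - v then 1 else 0) \<partial>M)"
    by (intro nn_integral_cong) (simp add: indicator_def stay_iff[OF assms])
  finally show ?thesis .
qed

lemma emeasure_stay_measurable:
  assumes "t \<ge> 0"
  shows "(\<lambda>v. emeasure M (stay t v r)) \<in> borel_measurable borel"
proof -
  note [measurable] = hi_lo_measurable[OF assms]
  show ?thesis unfolding emeasure_stay_eq[OF assms] by measurable
qed

lemma prob_stay_measurable:
  assumes "t \<ge> 0"
  shows "(\<lambda>v. prob (stay t v r)) \<in> borel_measurable borel"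
  unfolding measure_def using emeasure_stay_measurable[OF assms] by measurable

lemma nn_integral_emeasure_stay:
  assumes t: "t \<ge> 0"
  shows "(\<integral>\<^sup>+v. emeasure M (stay t v r) \<partial>lborel) = ennreal (LINT v:{0..r}|lborel. prob (stay t v r))"
proof -
  have "integrable lborel (\<lambda>v. indicator {0..r} v *\<^sub>R prob (stay t v r))"
  proof (rule Bochner_Integration.integrable_bound)
    show "integrable lborel (indicator {0..r} :: real \<Rightarrow> real)"
      by (intro integrable_real_indicator) (auto simp: emeasure_lborel_Icc_eq)
    show "(\<lambda>v. indicator {0..r} v *\<^sub>R prob (stay t v r)) \<in> borel_measurable lborel"
      using prob_stay_measurable[OF t] by measurable
  qed (auto simp: indicator_def)
  then have "ennreal (LINT v:{0..r}|lborel. prob (stay t v r)) = (\<integral>\<^sup>+v. ennreal (indicator {0..r} v *\<^sub>R prob (stay t v r)) \<partial>lborel)"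
    unfolding set_lebesgue_integral_def by (intro nn_integral_eq_integral[symmetric]) auto
  also have "\<dots> = (\<integral>\<^sup>+v. emeasure M (stay t v r) \<partial>lborel)"
  proof (intro nn_integral_cong)
    fix v :: real
    show "ennreal (indicator {0..r} v *\<^sub>R prob (stay t v r)) = emeasure M (stay t v r)"
      by (cases "v \<in> {0..r}") (simp_all add: stay_empty[OF t] emeasure_eq_measure)
  qed
  finally show ?thesis ..
qed

text \<open>For a fixed path, the starting points \<open>v\<close> for which \<open>v + Y\<close>
  stays in \<open>[0, r]\<close> form the interval from \<open>lo\<close> to \<open>r - hi\<close>,
  of length \<open>r\<close> minus the range if this is nonnegative. Exchanging the integrals turns
  this length into staying probabilities.\<close>

lemma nn_integral_exp_range:
  assumes lam: "lam > 0" and t: "t \<ge> 0"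
  shows "(\<integral>\<^sup>+w. ennreal (exp (- (lam * (hi t w + lo t w)))) \<partial>M) =
    (\<integral>\<^sup>+r. ennreal (lam\<^sup>2 * exp (- (lam * r))) * ennreal (LINT v:{0..r}|lborel. prob (stay t v r)) \<partial>lborel)"
proof -
  interpret P: pair_sigma_finite M lborel ..
  note [measurable] = hi_lo_measurable[OF t]
  define f where "f r w v = (if lo t w \<le> v \<and> hi t w \<le> r - v then 1 else 0 :: ennreal)" for r w v
  have [measurable]: "(\<lambda>(w, v). f r w v) \<in> borel_measurable (M \<Otimes>\<^sub>M lborel)" for r
    unfolding f_def by measurable
  have inner: "(\<integral>\<^sup>+v. f r w v \<partial>lborel) = ennreal (r - (hi t w + lo t w)) * (if hi t w + lo t w \<le> r then 1 else 0)" for r w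
  proof -
    have "(\<integral>\<^sup>+v. f r w v \<partial>lborel) = (\<integral>\<^sup>+v. indicator {lo t w..r - hi t w} v \<partial>lborel)"
      by (intro nn_integral_cong) (auto simp: f_def indicator_def)
    also have "\<dots> = emeasure lborel {lo t w..r - hi t w}" by simp
    also have "\<dots> = ennreal (r - (hi t w + lo t w)) * (if hi t w + lo t w \<le> r then 1 else 0)"
      by (auto simp: emeasure_lborel_Icc_eq indicator_def algebra_simps)
    finally show ?thesis .
  qed
  have "(\<integral>\<^sup>+w. ennreal (exp (- (lam * (hi t w + lo t w)))) \<partial>M) =
    (\<integral>\<^sup>+w. \<integral>\<^sup>+r. ennreal (lam\<^sup>2 * exp (- (lam * r))) * (\<integral>\<^sup>+v. f r w v \<partial>lborel) \<partial>lborel \<partial>M)"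
  proof (intro nn_integral_cong)
    fix w
    show "ennreal (exp (- (lam * (hi t w + lo t w)))) =
      (\<integral>\<^sup>+r. ennreal (lam\<^sup>2 * exp (- (lam * r))) * (\<integral>\<^sup>+v. f r w v \<partial>lborel) \<partial>lborel)"
      unfolding nn_integral_linear_exp_tail[OF lam, symmetric] inner
      by (intro nn_integral_cong) (auto simp: indicator_def ennreal_mult)
  qed
  also have "\<dots> = (\<integral>\<^sup>+r. \<integral>\<^sup>+w. ennreal (lam\<^sup>2 * exp (- (lam * r))) * (\<integral>\<^sup>+v. f r w v \<partial>lborel) \<partial>M \<partial>lborel)"
    unfolding inner by (rule P.Fubini'[symmetric]) measurable
  also have "\<dots> = (\<integral>\<^sup>+r. ennreal (lam\<^sup>2 * exp (- (lam * r))) * (\<integral>\<^sup>+w. \<integral>\<^sup>+v. f r w v \<partial>lborel \<partial>M) \<partial>lborel)"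
    by (intro nn_integral_cong nn_integral_cmult) measurable
  also have "\<dots> = (\<integral>\<^sup>+r. ennreal (lam\<^sup>2 * exp (- (lam * r))) * (\<integral>\<^sup>+v. emeasure M (stay t v r) \<partial>lborel) \<partial>lborel)"
    unfolding emeasure_stay_eq[OF t] f_def[symmetric] by (subst P.Fubini') measurable
  finally show ?thesis unfolding nn_integral_emeasure_stay[OF t] .
qed

text \<open>Mode \<open>1\<close> has frequency \<open>3\<close>, whose square \<open>9\<close> acts
  like a change of time.\<close>

lemma mode_exit_kernel:
  "exp (- (lam * r)) * mode t r 0 = exit_kernel lam t r"
  "exp (- (lam * r)) * mode t r 1 = exit_kernel lam (9 * t) r"
  by (auto simp: mode_def exit_kernel_def exp_add[symmetric] power_mult_distrib power_divide)

lemma expectation_exp_range_bounds: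
  assumes lam: "lam > 0" and t: "t > 0"
  shows "lam\<^sup>2 * (8 / pi\<^sup>2) * (LINT r:{0<..}|lborel. r * exit_kernel lam t r)
      \<le> expectation (\<lambda>w. exp (- (lam * (hi t w + lo t w))))" (is "?L \<le> ?E")
    and "expectation (\<lambda>w. exp (- (lam * (hi t w + lo t w)))) \<le>
      lam\<^sup>2 * (8 / pi\<^sup>2) * (LINT r:{0<..}|lborel. r * exit_kernel lam t r)
      + lam\<^sup>2 * (LINT r:{0<..}|lborel. r * exit_kernel lam (9 * t) r)" (is "_ \<le> ?U")
proof -
  have t0: "t \<ge> 0" using t by simp
  note [measurable] = hi_lo_measurable[OF t0]
  define F where "F r = (LINT v:{0..r}|lborel. prob (stay t v r))" for r
  define k where "k s r = indicator {0<..} r * (r * exit_kernel lam s r)" for s r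
  have kint: "integrable lborel (k s)" if "s \<ge> 0" for s
    using exit_kernel_integrable[OF lam that, of 1] by (simp add: set_integrable_def k_def[abs_def])
  have k0: "0 \<le> k s r" for s r unfolding k_def using exit_kernel_pos[of lam s r] by (simp add: indicator_def less_imp_le)
  have kI: "(LINT r:{0<..}|lborel. r * exit_kernel lam s r) = (LINT r|lborel. k s r)" for s
    by (simp add: set_lebesgue_integral_def k_def)
  have intE: "integrable M (\<lambda>w. exp (- (lam * (hi t w + lo t w))))"
  proof (rule integrable_const_bound[of _ 1])
    show "AE w in M. norm (exp (- (lam * (hi t w + lo t w)))) \<le> 1"
      using hi_lo_nonneg[OF t0] lam by (intro AE_I2) simp
  qed measurable
  have E: "ennreal ?E = (\<integral>\<^sup>+r. ennreal (lam\<^sup>2 * exp (- (lam * r))) * ennreal (F r) \<partial>lborel)"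
    unfolding F_def nn_integral_exp_range[OF lam t0, symmetric] by (intro nn_integral_eq_integral[symmetric] intE) auto
  have Fb: "8 / pi\<^sup>2 * (r * mode t r 0) \<le> F r" "F r \<le> 8 / pi\<^sup>2 * (r * mode t r 0) + r * mode t r 1" if "r > 0" for r
    unfolding F_def using stay_prob_integral_bounds[OF t that prob_stay_measurable[OF t0]] by auto
  \<comment> \<open>For negative \<open>r\<close> the interval of starting points is empty, and for
    \<open>r = 0\<close> it is a null set.\<close>
  have F0: "F r = 0" if "r \<le> 0" for r
  proof -
    have "F r = integral\<^sup>L (lborel :: real measure) (\<lambda>_. 0)" unfolding F_def set_lebesgue_integral_def
    proof (rule Bochner_Integration.integral_cong_AE)
      show "AE v in lborel. indicator {0..r} v *\<^sub>R prob (stay t v r) = 0"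
        by (rule AE_I[of _ _ "{0}"]) (use that in \<open>auto simp: indicator_def\<close>)
      show "(\<lambda>v. indicator {0..r} v *\<^sub>R prob (stay t v r)) \<in> borel_measurable lborel"
        using prob_stay_measurable[OF t0] by measurable
    qed simp
    then show ?thesis by simp
  qed
  have U0: "0 \<le> (LINT r|lborel. lam\<^sup>2 * (8 / pi\<^sup>2) * k t r + lam\<^sup>2 * k (9 * t) r)"
    using k0 by (intro integral_nonneg_AE AE_I2) auto
  have U: "?U = (LINT r|lborel. lam\<^sup>2 * (8 / pi\<^sup>2) * k t r + lam\<^sup>2 * k (9 * t) r)"
    unfolding kI using kint[of t] kint[of "9 * t"] t by simp
  have Lk: "ennreal ?L = (\<integral>\<^sup>+r. ennreal (lam\<^sup>2 * (8 / pi\<^sup>2) * k t r) \<partial>lborel)"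
    unfolding kI integral_mult_right_zero[symmetric]
    using kint[OF t0] k0 by (intro nn_integral_eq_integral[symmetric]) auto
  have Uk: "ennreal ?U = (\<integral>\<^sup>+r. ennreal (lam\<^sup>2 * (8 / pi\<^sup>2) * k t r + lam\<^sup>2 * k (9 * t) r) \<partial>lborel)"
    unfolding U using kint[of t] kint[of "9 * t"] t k0 by (intro nn_integral_eq_integral[symmetric]) auto
  have E0: "0 \<le> ?E" by (intro integral_nonneg_AE) auto
  have pt: "lam\<^sup>2 * (8 / pi\<^sup>2) * k t r = lam\<^sup>2 * exp (- (lam * r)) * (8 / pi\<^sup>2 * (r * mode t r 0))"
    "lam\<^sup>2 * (8 / pi\<^sup>2) * k t r + lam\<^sup>2 * k (9 * t) r = lam\<^sup>2 * exp (- (lam * r)) * (8 / pi\<^sup>2 * (r * mode t r 0) + r * mode t r 1)"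
    if "r > 0" for r
    unfolding k_def mode_exit_kernel(1)[where t=t, symmetric] mode_exit_kernel(2)[symmetric] using that by (simp_all add: algebra_simps)
  have "ennreal ?L \<le> ennreal ?E" unfolding Lk E
  proof (intro nn_integral_mono)
    fix r :: real
    show "ennreal (lam\<^sup>2 * (8 / pi\<^sup>2) * k t r) \<le> ennreal (lam\<^sup>2 * exp (- (lam * r))) * ennreal (F r)"
    proof (cases "r > 0")
      case True
      have "0 \<le> F r" using Fb(1)[OF True] mode_pos[of t r 0] True
        by (meson divide_nonneg_nonneg less_imp_le mult_nonneg_nonneg order_trans zero_le_numeral zero_le_power2)
      then show ?thesis unfolding pt(1)[OF True]
        using Fb(1)[OF True] by (simp add: ennreal_mult[symmetric] del: times_divide_eq_left times_divide_eq_right) (intro ennreal_leI mult_left_mono, auto)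
    qed (simp add: k_def)
  qed
  then show "?L \<le> ?E" using E0 by (simp add: ennreal_le_iff)
  have "ennreal ?E \<le> ennreal ?U" unfolding Uk E
  proof (intro nn_integral_mono)
    fix r :: real
    show "ennreal (lam\<^sup>2 * exp (- (lam * r))) * ennreal (F r) \<le> ennreal (lam\<^sup>2 * (8 / pi\<^sup>2) * k t r + lam\<^sup>2 * k (9 * t) r)"
    proof (cases "r > 0")
      case True
      have "ennreal (F r) \<le> ennreal (8 / pi\<^sup>2 * (r * mode t r 0) + r * mode t r 1)" using Fb(2)[OF True] by (rule ennreal_leI)
      then have "ennreal (lam\<^sup>2 * exp (- (lam * r))) * ennreal (F r) \<le>
          ennreal (lam\<^sup>2 * exp (- (lam * r))) * ennreal (8 / pi\<^sup>2 * (r * mode t r 0) + r * mode t r 1)"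
        by (rule mult_left_mono) simp
      also have "\<dots> = ennreal (lam\<^sup>2 * exp (- (lam * r)) * (8 / pi\<^sup>2 * (r * mode t r 0) + r * mode t r 1))"
        using True mode_pos[of t r 0] mode_pos[of t r 1] by (intro ennreal_mult[symmetric] add_nonneg_nonneg mult_nonneg_nonneg) auto
      finally show ?thesis unfolding pt(2)[OF True] .
    qed (simp add: F0)
  qed
  moreover have "0 \<le> ?U" unfolding U by (rule U0)
  ultimately show "?E \<le> ?U" by (simp add: ennreal_le_iff)
qed

text \<open>With one side confined by \<open>K\<close> only the other contributes an exponential,
  and a single tail integral over \<open>u\<close> represents it. The event then amounts to staying
  in one interval of length \<open>u + K\<close> from one fixed starting point, so the substitution
  \<open>r = K + u\<close> yields the kernel with no weight \<open>r\<close>. The shift accounts for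
  \<open>exp (lam * K)\<close>.\<close>

lemma expectation_exp_one_sided:
  assumes lam: "lam > 0" and t: "t > 0" and K: "K > 0"
    and [measurable]: "random_variable borel X" "random_variable borel X'"
    and X0: "\<And>w. w \<in> space M \<Longrightarrow> 0 \<le> X w"
    and bound: "\<And>u. u \<ge> 0 \<Longrightarrow> prob {w \<in> space M. X w \<le> u \<and> X' w \<le> K} \<le> 4 * mode t (u + K) 0"
  shows "expectation (\<lambda>w. exp (- (lam * X w)) * (if X' w \<le> K then 1 else 0)) \<le>
    4 * lam * exp (lam * K) * (LINT r:{0<..}|lborel. exit_kernel lam t r)"
proof -
  interpret P: pair_sigma_finite M lborel ..
  define k where "k r = indicator {0<..} r * exit_kernel lam t r" for r
  have kint: "integrable lborel k"
    using exit_kernel_integrable[OF lam, of t 0] t by (simp add: set_integrable_def k_def[abs_def])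
  have k0: "0 \<le> k r" for r unfolding k_def using exit_kernel_pos[of lam t r] by (simp add: indicator_def less_imp_le)
  have kI: "(LINT r:{0<..}|lborel. exit_kernel lam t r) = (LINT r|lborel. k r)"
    by (simp add: set_lebesgue_integral_def k_def)
  define f where "f w u = (if X w \<le> u \<and> X' w \<le> K then 1 else 0 :: ennreal)" for w u
  have [measurable]: "(\<lambda>(w, u). f w u) \<in> borel_measurable (M \<Otimes>\<^sub>M lborel)" unfolding f_def by measurable
  have int: "integrable M (\<lambda>w. exp (- (lam * X w)) * (if X' w \<le> K then 1 else 0))"
  proof (rule integrable_const_bound[of _ 1])
    show "AE w in M. norm (exp (- (lam * X w)) * (if X' w \<le> K then 1 else 0)) \<le> 1"
      using X0 lam by (intro AE_I2) simp
  qed measurable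
  have "ennreal (expectation (\<lambda>w. exp (- (lam * X w)) * (if X' w \<le> K then 1 else 0))) =
      (\<integral>\<^sup>+w. ennreal (exp (- (lam * X w)) * (if X' w \<le> K then 1 else 0)) \<partial>M)"
    by (intro nn_integral_eq_integral[symmetric] int) auto
  also have "\<dots> = (\<integral>\<^sup>+w. \<integral>\<^sup>+u. ennreal (lam * exp (- (lam * u))) * f w u \<partial>lborel \<partial>M)"
  proof (intro nn_integral_cong)
    fix w
    show "ennreal (exp (- (lam * X w)) * (if X' w \<le> K then 1 else 0)) =
      (\<integral>\<^sup>+u. ennreal (lam * exp (- (lam * u))) * f w u \<partial>lborel)"
    proof (cases "X' w \<le> K")
      case True
      have "ennreal (exp (- (lam * X w))) = (\<integral>\<^sup>+u. ennreal (lam * exp (- (lam * u))) * f w u \<partial>lborel)"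
        unfolding nn_integral_exp_tail[OF lam, symmetric]
        by (intro nn_integral_cong) (use True in \<open>simp add: f_def indicator_def\<close>)
      then show ?thesis using True by simp
    qed (simp add: f_def)
  qed
  also have "\<dots> = (\<integral>\<^sup>+u. \<integral>\<^sup>+w. ennreal (lam * exp (- (lam * u))) * f w u \<partial>M \<partial>lborel)"
    by (rule P.Fubini'[symmetric]) measurable
  also have "\<dots> \<le> (\<integral>\<^sup>+u. ennreal (4 * lam * exp (lam * K) * k (K + 1 * u)) \<partial>lborel)"
  proof (intro nn_integral_mono)
    fix u :: real
    have ev: "{w \<in> space M. X w \<le> u \<and> X' w \<le> K} \<in> events" by measurable
    have "(\<integral>\<^sup>+w. f w u \<partial>M) = (\<integral>\<^sup>+w. indicator {w \<in> space M. X w \<le> u \<and> X' w \<le> K} w \<partial>M)"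
      by (intro nn_integral_cong) (simp add: f_def indicator_def)
    also have "\<dots> = ennreal (prob {w \<in> space M. X w \<le> u \<and> X' w \<le> K})"
      using ev by (simp add: emeasure_eq_measure)
    finally have fu: "(\<integral>\<^sup>+w. f w u \<partial>M) = ennreal (prob {w \<in> space M. X w \<le> u \<and> X' w \<le> K})" .
    have "(\<integral>\<^sup>+w. ennreal (lam * exp (- (lam * u))) * f w u \<partial>M) =
        ennreal (lam * exp (- (lam * u))) * ennreal (prob {w \<in> space M. X w \<le> u \<and> X' w \<le> K})"
      by (subst nn_integral_cmult) (auto simp: fu)
    also have "\<dots> \<le> ennreal (4 * lam * exp (lam * K) * k (K + 1 * u))"
    proof (cases "u \<ge> 0")
      case True
      have "prob {w \<in> space M. X w \<le> u \<and> X' w \<le> K} \<le> 4 * mode t (K + u) 0" using bound[OF True] by (simp add: add.commute)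
      then have "lam * exp (- (lam * u)) * prob {w \<in> space M. X w \<le> u \<and> X' w \<le> K} \<le> lam * exp (- (lam * u)) * (4 * mode t (K + u) 0)"
        using lam by (intro mult_left_mono) auto
      also have "\<dots> = 4 * lam * exp (lam * K) * (exp (- (lam * (K + u))) * mode t (K + u) 0)"
        by (simp add: distrib_left exp_add exp_diff exp_minus field_simps)
      also have "\<dots> = 4 * lam * exp (lam * K) * k (K + 1 * u)"
        unfolding mode_exit_kernel k_def using True K by simp
      finally show ?thesis using lam by (simp add: ennreal_mult[symmetric] ennreal_leI)
    next
      case False
      then have empty: "{w \<in> space M. X w \<le> u \<and> X' w \<le> K} = {}" using X0 by force
      show ?thesis unfolding empty by simp
    qed
    finally show "(\<integral>\<^sup>+w. ennreal (lam * exp (- (lam * u))) * f w u \<partial>M) \<le> ennreal (4 * lam * exp (lam * K) * k (K + 1 * u))" .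
  qed
  also have "\<dots> = (\<integral>\<^sup>+r. ennreal (4 * lam * exp (lam * K) * k r) \<partial>lborel)"
    using nn_integral_real_affine[of "\<lambda>r. ennreal (4 * lam * exp (lam * K) * k r)" 1 K] by (simp add: k_def)
  also have "\<dots> = ennreal (4 * lam * exp (lam * K) * (LINT r|lborel. k r))"
    unfolding integral_mult_right_zero[symmetric] using kint k0 lam by (intro nn_integral_eq_integral) auto
  finally show ?thesis unfolding kI
    using lam k0 by (subst (asm) ennreal_le_iff) (auto intro!: mult_nonneg_nonneg integral_nonneg_AE)
qed

text \<open>The exponential of the confined side is at most \<open>1\<close> and is dropped. The
  remaining event is \<open>stay t v (u + v)\<close> with the confined maximum bounded by
  \<open>v\<close> or by \<open>u\<close>, according to the side.\<close>

lemma expectation_exp_range_low_side: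
  assumes lam: "lam > 0" and t: "t > 0" and K: "K > 0"
  shows "expectation (\<lambda>w. exp (- (lam * (hi t w + lo t w))) * (if hi t w \<le> K then 1 else 0)) \<le>
      4 * lam * exp (lam * K) * (LINT r:{0<..}|lborel. exit_kernel lam t r)"
    and "expectation (\<lambda>w. exp (- (lam * (hi t w + lo t w))) * (if lo t w \<le> K then 1 else 0)) \<le>
      4 * lam * exp (lam * K) * (LINT r:{0<..}|lborel. exit_kernel lam t r)"
proof -
  have t0: "t \<ge> 0" using t by simp
  note [measurable] = hi_lo_measurable[OF t0]
  have int: "integrable M (\<lambda>w. exp (- (lam * Z w)) * (if X w \<le> K then 1 else 0))"
    if [measurable]: "random_variable borel Z" "random_variable borel X" and "\<And>w. w \<in> space M \<Longrightarrow> 0 \<le> Z w"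
    for Z X :: "'w \<Rightarrow> real"
  proof (rule integrable_const_bound[of _ 1])
    show "AE w in M. norm (exp (- (lam * Z w)) * (if X w \<le> K then 1 else 0)) \<le> 1"
      using that(3) lam by (intro AE_I2) simp
  qed measurable
  have stay: "prob {w \<in> space M. lo t w \<le> v \<and> hi t w \<le> u} \<le> 4 * mode t (u + v) 0" if "0 \<le> v" "0 \<le> u" "0 < u + v" for u v
  proof -
    have "{w \<in> space M. lo t w \<le> v \<and> hi t w \<le> u} = stay t v (u + v)"
      using stay_iff[OF t0, of _ v "u + v"] by (auto simp: stay_def)
    then show ?thesis using stay_prob_le[OF t that(3), of v] that by simp
  qed
  have "expectation (\<lambda>w. exp (- (lam * (hi t w + lo t w))) * (if hi t w \<le> K then 1 else 0)) \<le>
      expectation (\<lambda>w. exp (- (lam * lo t w)) * (if hi t w \<le> K then 1 else 0))"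
    using hi_lo_nonneg[OF t0] lam by (intro integral_mono int) auto
  also have "\<dots> \<le> 4 * lam * exp (lam * K) * (LINT r:{0<..}|lborel. exit_kernel lam t r)"
    using stay[of _ K] K hi_lo_nonneg[OF t0]
    by (intro expectation_exp_one_sided[OF lam t K]) (auto simp: add.commute)
  finally show "expectation (\<lambda>w. exp (- (lam * (hi t w + lo t w))) * (if hi t w \<le> K then 1 else 0)) \<le>
      4 * lam * exp (lam * K) * (LINT r:{0<..}|lborel. exit_kernel lam t r)" .
  have "expectation (\<lambda>w. exp (- (lam * (hi t w + lo t w))) * (if lo t w \<le> K then 1 else 0)) \<le>
      expectation (\<lambda>w. exp (- (lam * hi t w)) * (if lo t w \<le> K then 1 else 0))"
    using hi_lo_nonneg[OF t0] lam by (intro integral_mono int) auto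
  also have "\<dots> \<le> 4 * lam * exp (lam * K) * (LINT r:{0<..}|lborel. exit_kernel lam t r)"
    using stay[of K] K hi_lo_nonneg[OF t0]
    by (intro expectation_exp_one_sided[OF lam t K]) (auto simp: conj_commute)
  finally show "expectation (\<lambda>w. exp (- (lam * (hi t w + lo t w))) * (if lo t w \<le> K then 1 else 0)) \<le>
      4 * lam * exp (lam * K) * (LINT r:{0<..}|lborel. exit_kernel lam t r)" .
qed

lemma range_asymptotics:
  assumes lam: "lam > 0"
  shows "((\<lambda>t. ibm_scale lam t * expectation (\<lambda>w. exp (- (lam * (hi t w + lo t w)))))
    \<longlongrightarrow> 2 powr (7 / 2) * lam / sqrt (3 * pi)) at_top" (is "((\<lambda>t. ?s t * ?E t) \<longlongrightarrow> ?C) at_top")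
proof (rule tendsto_sandwich)
  let ?L = "\<lambda>t. lam\<^sup>2 * (8 / pi\<^sup>2) * (LINT r:{0<..}|lborel. r * exit_kernel lam t r)"
  let ?R = "\<lambda>t. LINT r:{0<..}|lborel. r * exit_kernel lam (9 * t) r"
  show "\<forall>\<^sub>F t in at_top. ?s t * ?L t \<le> ?s t * ?E t"
    using eventually_gt_at_top[of 0]
    by eventually_elim (intro mult_left_mono expectation_exp_range_bounds(1) lam ibm_scale_nonneg)
  show "((\<lambda>t. ?s t * ?L t) \<longlongrightarrow> ?C) at_top" by (rule exit_kernel_asymptotics[OF lam])
  show "\<forall>\<^sub>F t in at_top. ?s t * ?E t \<le> ?s t * ?L t + lam\<^sup>2 * (?s t * ?R t)"
    using eventually_gt_at_top[of 0]
  proof eventually_elim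
    fix t :: real assume "t > 0"
    then have "?s t * ?E t \<le> ?s t * (?L t + lam\<^sup>2 * ?R t)"
      by (intro mult_left_mono expectation_exp_range_bounds(2) lam ibm_scale_nonneg)
    then show "?s t * ?E t \<le> ?s t * ?L t + lam\<^sup>2 * (?s t * ?R t)" by (simp only: distrib_left mult.left_commute)
  qed
  have "((\<lambda>t. ?s t * ?L t + lam\<^sup>2 * (?s t * ?R t)) \<longlongrightarrow> ?C + lam\<^sup>2 * 0) at_top"
    by (intro tendsto_add tendsto_mult_left exit_kernel_asymptotics exit_kernel_asymptotics_9 lam)
  then show "((\<lambda>t. ?s t * ?L t + lam\<^sup>2 * (?s t * ?R t)) \<longlongrightarrow> ?C) at_top" by simp
qed

text \<open>These are the paths on which the asymptotics of the exit probability give no information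
  about one of the two factors.\<close>

lemma range_low_side_tendsto_0:
  assumes lam: "lam > 0" and K: "K > 0"
  shows "((\<lambda>t. ibm_scale lam t * expectation (\<lambda>w. exp (- (lam * (hi t w + lo t w))) * (if hi t w \<le> K then 1 else 0))) \<longlongrightarrow> 0) at_top"
    and "((\<lambda>t. ibm_scale lam t * expectation (\<lambda>w. exp (- (lam * (hi t w + lo t w))) * (if lo t w \<le> K then 1 else 0))) \<longlongrightarrow> 0) at_top"
proof -
  let ?J = "\<lambda>t. LINT r:{0<..}|lborel. exit_kernel lam t r"
  have "((\<lambda>t. 4 * lam * exp (lam * K) * (ibm_scale lam t * ?J t)) \<longlongrightarrow> 4 * lam * exp (lam * K) * 0) at_top"
    by (intro tendsto_mult_left exit_kernel_integral_0_tendsto lam)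
  then have lim: "((\<lambda>t. 4 * lam * exp (lam * K) * (ibm_scale lam t * ?J t)) \<longlongrightarrow> 0) at_top" by simp
  have *: "((\<lambda>t. ibm_scale lam t * F t) \<longlongrightarrow> 0) at_top"
    if F: "\<And>t. t > 0 \<Longrightarrow> F t \<le> 4 * lam * exp (lam * K) * ?J t" and F0: "\<And>t. 0 \<le> F t" for F
  proof (rule tendsto_sandwich)
    show "((\<lambda>_. 0) \<longlongrightarrow> (0::real)) at_top" by (rule tendsto_const)
    show "((\<lambda>t. 4 * lam * exp (lam * K) * (ibm_scale lam t * ?J t)) \<longlongrightarrow> 0) at_top" by (rule lim)
    show "\<forall>\<^sub>F t in at_top. 0 \<le> ibm_scale lam t * F t"
      using F0 ibm_scale_nonneg by simp
    show "\<forall>\<^sub>F t in at_top. ibm_scale lam t * F t \<le> 4 * lam * exp (lam * K) * (ibm_scale lam t * ?J t)"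
      using eventually_gt_at_top[of 0]
    proof eventually_elim
      fix t :: real assume "t > 0"
      then have "ibm_scale lam t * F t \<le> ibm_scale lam t * (4 * lam * exp (lam * K) * ?J t)"
        by (intro mult_left_mono F ibm_scale_nonneg)
      then show "ibm_scale lam t * F t \<le> 4 * lam * exp (lam * K) * (ibm_scale lam t * ?J t)"
        by (simp only: mult.left_commute)
    qed
  qed
  show "((\<lambda>t. ibm_scale lam t * expectation (\<lambda>w. exp (- (lam * (hi t w + lo t w))) * (if hi t w \<le> K then 1 else 0))) \<longlongrightarrow> 0) at_top"
    by (rule *[of "\<lambda>t. expectation (\<lambda>w. exp (- (lam * (hi t w + lo t w))) * (if hi t w \<le> K then 1 else 0))"])
       (rule expectation_exp_range_low_side(1)[OF lam _ K], assumption, rule integral_nonneg_AE, simp)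
  show "((\<lambda>t. ibm_scale lam t * expectation (\<lambda>w. exp (- (lam * (hi t w + lo t w))) * (if lo t w \<le> K then 1 else 0))) \<longlongrightarrow> 0) at_top"
    by (rule *[of "\<lambda>t. expectation (\<lambda>w. exp (- (lam * (hi t w + lo t w))) * (if lo t w \<le> K then 1 else 0))"])
       (rule expectation_exp_range_low_side(2)[OF lam _ K], assumption, rule integral_nonneg_AE, simp)
qed

text \<open>If both maxima exceed \<open>K\<close>, then
  \<open>a * b - c^2 = a * (b - c) + c * (a - c)\<close> gives an error of
  \<open>2 * B * \<eta>\<close>; otherwise both \<open>a * b\<close> and \<open>c^2\<close> lie
  between \<open>0\<close> and \<open>B^2\<close>. The exceptional set is covered by the two
  one-sided conditions.\<close>

lemma weighted_range_error:
  fixes g :: "real \<Rightarrow> real"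
  assumes lam: "lam > 0" and t: "t \<ge> 0" and [measurable]: "g \<in> borel_measurable borel"
    and g0: "\<And>u. 0 \<le> u \<Longrightarrow> 0 \<le> g u" and gB: "\<And>u. 0 \<le> u \<Longrightarrow> g u \<le> B" and c: "0 \<le> c" "c \<le> B"
    and \<eta>: "\<And>u. u > K \<Longrightarrow> 0 \<le> u \<Longrightarrow> \<bar>g u - c\<bar> \<le> \<eta>"
  defines "x \<equiv> \<lambda>w. exp (- (lam * (hi t w + lo t w)))"
  shows "\<bar>expectation (\<lambda>w. x w * (g (hi t w) * g (lo t w))) - c\<^sup>2 * expectation x\<bar> \<le>
    2 * B * \<eta> * expectation x + (B\<^sup>2 * expectation (\<lambda>w. x w * (if hi t w \<le> K then 1 else 0))
      + B\<^sup>2 * expectation (\<lambda>w. x w * (if lo t w \<le> K then 1 else 0)))"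
proof -
  note [measurable] = hi_lo_measurable[OF t]
  note nn = hi_lo_nonneg[OF t]
  let ?i = "\<lambda>X w. if X t w \<le> K then 1 else 0 :: real"
  have [measurable]: "random_variable borel x" unfolding x_def by measurable
  have x01: "0 \<le> x w" "w \<in> space M \<Longrightarrow> x w \<le> 1" for w using nn lam by (auto simp: x_def)
  have B: "0 \<le> B" using c by simp
  have gg: "0 \<le> g (hi t w) * g (lo t w)" "g (hi t w) * g (lo t w) \<le> B\<^sup>2" if "w \<in> space M" for w
    unfolding power2_eq_square using nn[OF that] B by (auto intro!: mult_nonneg_nonneg mult_mono g0 gB)
  have int_x: "integrable M x"
    by (rule integrable_const_bound[of _ 1]) (use x01 in auto)
  have int_i: "integrable M (\<lambda>w. x w * ?i X w)" if [measurable]: "random_variable borel (X t)" for X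
  proof (rule Bochner_Integration.integrable_bound[OF int_x])
    show "AE w in M. norm (x w * ?i X w) \<le> norm (x w)" by (intro AE_I2) simp
  qed measurable
  have int_g: "integrable M (\<lambda>w. x w * (g (hi t w) * g (lo t w)))"
  proof (rule Bochner_Integration.integrable_bound[OF integrable_mult_left[OF int_x, of "B\<^sup>2"]])
    show "AE w in M. norm (x w * (g (hi t w) * g (lo t w))) \<le> norm (x w * B\<^sup>2)"
    proof (rule AE_I2)
      fix w assume "w \<in> space M"
      then have "x w * (g (hi t w) * g (lo t w)) \<le> x w * B\<^sup>2" "0 \<le> x w * (g (hi t w) * g (lo t w))"
        using gg x01 by (auto intro!: mult_left_mono)
      then show "norm (x w * (g (hi t w) * g (lo t w))) \<le> norm (x w * B\<^sup>2)" by (simp only: real_norm_def abs_le_iff) linarith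
    qed
  qed measurable
  define R where "R w = 2 * B * \<eta> * x w + (B\<^sup>2 * (x w * ?i hi w) + B\<^sup>2 * (x w * ?i lo w))" for w
  have int_R: "integrable M R" unfolding R_def
    by (intro Bochner_Integration.integrable_add integrable_mult_right int_x int_i) measurable
  have ER: "expectation R = 2 * B * \<eta> * expectation x + (B\<^sup>2 * expectation (\<lambda>w. x w * ?i hi w) + B\<^sup>2 * expectation (\<lambda>w. x w * ?i lo w))"
    unfolding R_def using int_x int_i[of hi] int_i[of lo] by simp
  have int_d: "integrable M (\<lambda>w. x w * (g (hi t w) * g (lo t w)) - c\<^sup>2 * x w)"
    by (intro Bochner_Integration.integrable_diff integrable_mult_right int_x int_g)
  have pt: "\<bar>x w * (g (hi t w) * g (lo t w)) - c\<^sup>2 * x w\<bar> \<le> R w" if w: "w \<in> space M" for w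
  proof -
    define a b where "a = g (hi t w)" and "b = g (lo t w)"
    have ab: "0 \<le> a" "a \<le> B" "0 \<le> b" "b \<le> B" using nn[OF w] by (auto simp: a_def b_def g0 gB)
    have "x w * (a * b) - c\<^sup>2 * x w = x w * (a * b - c\<^sup>2)" by (simp add: algebra_simps)
    then have eq: "\<bar>x w * (a * b) - c\<^sup>2 * x w\<bar> = x w * \<bar>a * b - c\<^sup>2\<bar>" using x01(1)[of w] by (simp add: abs_mult)
    have "\<bar>a * b - c\<^sup>2\<bar> \<le> (if hi t w \<le> K \<or> lo t w \<le> K then B\<^sup>2 else 2 * B * \<eta>)"
    proof (cases "hi t w \<le> K \<or> lo t w \<le> K")
      case True
      have "0 \<le> a * b" "a * b \<le> B\<^sup>2" using gg[OF w] by (auto simp: a_def b_def)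
      moreover have "0 \<le> c\<^sup>2" "c\<^sup>2 \<le> B\<^sup>2" using c by (auto intro: power_mono)
      ultimately have "a * b - c\<^sup>2 \<le> B\<^sup>2" "- (a * b - c\<^sup>2) \<le> B\<^sup>2" by linarith+
      then show ?thesis using True by (simp only: abs_le_iff if_True)
    next
      case False
      then have \<eta>ab: "\<bar>a - c\<bar> \<le> \<eta>" "\<bar>b - c\<bar> \<le> \<eta>" using nn[OF w] by (auto simp: a_def b_def \<eta>)
      have "a * b - c\<^sup>2 = a * (b - c) + c * (a - c)" by (simp add: algebra_simps power2_eq_square)
      then have "\<bar>a * b - c\<^sup>2\<bar> \<le> \<bar>a * (b - c)\<bar> + \<bar>c * (a - c)\<bar>" by (metis abs_triangle_ineq)
      moreover have "\<bar>a * (b - c)\<bar> \<le> B * \<eta>" unfolding abs_mult using ab \<eta>ab B by (intro mult_mono) auto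
      moreover have "\<bar>c * (a - c)\<bar> \<le> B * \<eta>" unfolding abs_mult using c \<eta>ab B by (intro mult_mono) auto
      ultimately show ?thesis using False by simp
    qed
    then have "x w * \<bar>a * b - c\<^sup>2\<bar> \<le> x w * (if hi t w \<le> K \<or> lo t w \<le> K then B\<^sup>2 else 2 * B * \<eta>)"
      using x01(1) by (rule mult_left_mono)
    also have "\<dots> \<le> R w"
    proof (cases "hi t w \<le> K \<or> lo t w \<le> K")
      case True
      \<comment> \<open>Any nonnegative argument above \<open>K\<close> shows
        \<open>0 \<le> \<eta>\<close>, as \<open>\<eta>\<close> bounds an absolute value
        there.\<close>
      have "K < max 0 K + 1" "0 \<le> max 0 K + 1" by (auto simp: max_def)
      then have "0 \<le> \<eta>" by (rule order_trans[OF abs_ge_zero \<eta>])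
      then have "0 \<le> 2 * B * \<eta> * x w" using B x01(1)[of w] by simp
      moreover have "0 \<le> B\<^sup>2 * x w" using x01(1)[of w] by simp
      ultimately show ?thesis using True unfolding R_def by (auto simp: mult.commute)
    next
      case False
      then show ?thesis unfolding R_def by (simp add: mult.commute)
    qed
    finally show ?thesis using eq unfolding a_def b_def by simp
  qed
  have "expectation (\<lambda>w. x w * (g (hi t w) * g (lo t w))) - c\<^sup>2 * expectation x =
      expectation (\<lambda>w. x w * (g (hi t w) * g (lo t w)) - c\<^sup>2 * x w)"
    using int_g int_x by simp
  then have e1: "\<bar>expectation (\<lambda>w. x w * (g (hi t w) * g (lo t w))) - c\<^sup>2 * expectation x\<bar> =
      \<bar>expectation (\<lambda>w. x w * (g (hi t w) * g (lo t w)) - c\<^sup>2 * x w)\<bar>" by (rule arg_cong)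
  have e2: "\<bar>expectation (\<lambda>w. x w * (g (hi t w) * g (lo t w)) - c\<^sup>2 * x w)\<bar> \<le> expectation (\<lambda>w. \<bar>x w * (g (hi t w) * g (lo t w)) - c\<^sup>2 * x w\<bar>)" by (rule integral_abs_bound)
  have e3: "expectation (\<lambda>w. \<bar>x w * (g (hi t w) * g (lo t w)) - c\<^sup>2 * x w\<bar>) \<le> expectation R"
  proof (rule integral_mono[OF _ int_R])
    show "integrable M (\<lambda>w. \<bar>x w * (g (hi t w) * g (lo t w)) - c\<^sup>2 * x w\<bar>)" by (rule integrable_abs[OF int_d])
  qed (rule pt)
  show ?thesis unfolding ER[symmetric] e1 by (rule order_trans[OF e2 e3])
qed

text \<open>Factoring out \<open>exp (- (lam * R))\<close> leaves \<open>g (hi t) * g (lo t)\<close>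
  with \<open>g\<close> bounded and convergent to \<open>c\<close>. The error is then a small
  multiple of the main term plus two vanishing one-sided terms.\<close>

lemma weighted_range_asymptotics:
  fixes G :: "real \<Rightarrow> real"
  assumes lam: "lam > 0" and G [measurable]: "G \<in> borel_measurable borel"
    and G0: "\<And>u. 0 \<le> G u" and G1: "\<And>u. G u \<le> 1"
    and lim: "((\<lambda>u. exp (lam * u) * G u) \<longlongrightarrow> c) at_top"
  shows "((\<lambda>t. ibm_scale lam t * expectation (\<lambda>w. G (hi t w) * G (lo t w)))
    \<longlongrightarrow> 2 powr (7 / 2) * lam / sqrt (3 * pi) * c\<^sup>2) at_top"
proof -
  define C where "C = 2 powr (7 / 2) * lam / sqrt (3 * pi)"
  have C: "C > 0" using lam by (simp add: C_def)
  define g where "g u = exp (lam * u) * G u" for u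
  have [measurable]: "g \<in> borel_measurable borel" unfolding g_def[abs_def] by measurable
  have g0: "0 \<le> g u" for u using G0 by (simp add: g_def)
  have lim: "(g \<longlongrightarrow> c) at_top" using lim by (simp add: g_def[abs_def])
  have c: "0 \<le> c" using g0 by (intro tendsto_lowerbound[OF lim]) auto
  have "\<forall>\<^sub>F u in at_top. g u < c + 1" by (rule order_tendstoD(2)[OF lim]) simp
  then obtain U where U: "\<And>u. u \<ge> U \<Longrightarrow> g u < c + 1" by (auto simp: eventually_at_top_linorder)
  \<comment> \<open>Beyond \<open>U\<close> convergence bounds \<open>g\<close> by
    \<open>c + 1\<close>; before it \<open>G \<le> 1\<close> leaves only the exponential.\<close>
  define B where "B = max (c + 1) (exp (lam * \<bar>U\<bar>))"
  have cB: "c \<le> B" and B: "B > 0" using c by (auto simp: B_def max_def)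
  have gB: "g u \<le> B" for u
  proof (cases "u \<ge> U")
    case True then show ?thesis using U[OF True] by (simp add: B_def)
  next
    case False
    have "g u \<le> exp (lam * u) * 1" unfolding g_def using G1 by (intro mult_left_mono) auto
    also have "\<dots> \<le> exp (lam * \<bar>U\<bar>)" using False lam by simp
    finally show ?thesis by (simp add: B_def)
  qed
  define x where "x t w = exp (- (lam * (hi t w + lo t w)))" for t w
  define a where "a t = ibm_scale lam t * expectation (\<lambda>w. G (hi t w) * G (lo t w))" for t
  define b where "b t = ibm_scale lam t * expectation (x t)" for t
  have b: "(b \<longlongrightarrow> C) at_top"
    using range_asymptotics[OF lam] unfolding b_def x_def C_def .
  have "((\<lambda>t. a t - c\<^sup>2 * b t) \<longlongrightarrow> 0) at_top"
  proof (rule tendstoI)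
    fix e :: real assume e: "e > 0"
    \<comment> \<open>This makes \<open>2 * B * \<eta>\<close> equal to
      \<open>e / (2 * (C + 1))\<close>, whose product with the limit \<open>C\<close> of
      \<open>b\<close> is below \<open>e\<close>.\<close>
    define \<eta> where "\<eta> = e / (2 * (C + 1)) / (2 * B)"
    have \<eta>: "\<eta> > 0" using e B C by (simp add: \<eta>_def)
    have "\<forall>\<^sub>F u in at_top. dist (g u) c < \<eta>" by (rule tendstoD[OF lim \<eta>])
    then obtain K0 where K0: "\<And>u. u \<ge> K0 \<Longrightarrow> dist (g u) c < \<eta>" by (auto simp: eventually_at_top_linorder)
    define K where "K = max 1 K0"
    have K: "K > 0" by (simp add: K_def)
    have near: "\<bar>g u - c\<bar> \<le> \<eta>" if "u > K" for u
      using K0[of u] that by (simp add: K_def dist_real_def)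
    define p where "p t = ibm_scale lam t * expectation (\<lambda>w. x t w * (if hi t w \<le> K then 1 else 0))" for t
    define q where "q t = ibm_scale lam t * expectation (\<lambda>w. x t w * (if lo t w \<le> K then 1 else 0))" for t
    have pq: "(p \<longlongrightarrow> 0) at_top" "(q \<longlongrightarrow> 0) at_top"
      using range_low_side_tendsto_0[OF lam K] unfolding p_def x_def q_def by auto
    have "((\<lambda>t. 2 * B * \<eta> * b t + (B\<^sup>2 * p t + B\<^sup>2 * q t)) \<longlongrightarrow> 2 * B * \<eta> * C + (B\<^sup>2 * 0 + B\<^sup>2 * 0)) at_top"
      by (intro tendsto_intros b pq)
    moreover have "2 * B * \<eta> * C + (B\<^sup>2 * 0 + B\<^sup>2 * 0) < e"
    proof -
      have "2 * B * \<eta> = e / (2 * (C + 1))" using B by (simp add: \<eta>_def)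
      moreover have "e * C < e * (2 * (C + 1))" using e C by (intro mult_strict_left_mono) auto
      then have "e / (2 * (C + 1)) * C < e" using C by (simp add: pos_divide_less_eq)
      ultimately show ?thesis by (simp only: mult_zero_right add_0_right)
    qed
    ultimately have "\<forall>\<^sub>F t in at_top. 2 * B * \<eta> * b t + (B\<^sup>2 * p t + B\<^sup>2 * q t) < e"
      by (rule order_tendstoD(2))
    then show "\<forall>\<^sub>F t in at_top. dist (a t - c\<^sup>2 * b t) 0 < e"
      using eventually_ge_at_top[of 0]
    proof eventually_elim
      fix t :: real assume less: "2 * B * \<eta> * b t + (B\<^sup>2 * p t + B\<^sup>2 * q t) < e" and t: "t \<ge> 0"
      let ?s = "ibm_scale lam t"
      have G_eq: "G (hi t w) * G (lo t w) = x t w * (g (hi t w) * g (lo t w))" for w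
      proof -
        have "exp (- (lam * (hi t w + lo t w))) * (exp (lam * hi t w) * exp (lam * lo t w)) = 1"
          unfolding exp_add[symmetric] by (simp add: distrib_left)
        then have "x t w * (exp (lam * hi t w) * exp (lam * lo t w)) * (G (hi t w) * G (lo t w)) = G (hi t w) * G (lo t w)"
          unfolding x_def by (simp only: mult_1)
        then show ?thesis unfolding g_def by (simp only: mult_ac)
      qed
      define d where "d = expectation (\<lambda>w. x t w * (g (hi t w) * g (lo t w))) - c\<^sup>2 * expectation (x t)"
      have "\<bar>d\<bar> \<le> 2 * B * \<eta> * expectation (x t) + (B\<^sup>2 * expectation (\<lambda>w. x t w * (if hi t w \<le> K then 1 else 0))
          + B\<^sup>2 * expectation (\<lambda>w. x t w * (if lo t w \<le> K then 1 else 0)))"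
        unfolding d_def x_def by (rule weighted_range_error[OF lam t]) (use g0 gB c cB near in auto)
      from mult_left_mono[OF this ibm_scale_nonneg[of lam t]]
      have "?s * \<bar>d\<bar> \<le> 2 * B * \<eta> * b t + (B\<^sup>2 * p t + B\<^sup>2 * q t)"
        unfolding b_def p_def q_def by (simp only: distrib_left mult.left_commute mult.assoc)
      moreover have "a t - c\<^sup>2 * b t = ?s * d"
        unfolding a_def b_def G_eq d_def by (simp only: right_diff_distrib mult.left_commute)
      ultimately show "dist (a t - c\<^sup>2 * b t) 0 < e"
        using less ibm_scale_nonneg[of lam t] by (simp add: abs_mult)
    qed
  qed
  moreover have "((\<lambda>t. c\<^sup>2 * b t) \<longlongrightarrow> c\<^sup>2 * C) at_top" by (intro tendsto_mult_left b)
  ultimately have "((\<lambda>t. (a t - c\<^sup>2 * b t) + c\<^sup>2 * b t) \<longlongrightarrow> 0 + c\<^sup>2 * C) at_top" by (rule tendsto_add)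
  then show ?thesis by (simp add: a_def[abs_def] C_def mult.commute)
qed

text \<open>The supremum is attained on the compact time interval and the path starts at
  \<open>0\<close>, so the intermediate value theorem supplies every level in between.\<close>

lemma path_hits:
  assumes t: "t \<ge> 0" and w: "w \<in> space M" and u: "0 \<le> u"
  shows "u \<le> hi t w \<Longrightarrow> \<exists>s\<in>{0..t}. Y s w = u" and "u \<le> lo t w \<Longrightarrow> \<exists>s\<in>{0..t}. - Y s w = u"
proof -
  have *: "\<exists>s\<in>{0..t}. f s = u"
    if f: "continuous_on {0..t} f" "f 0 = 0" and m: "\<And>v. (\<forall>s\<in>{0..t}. f s \<le> v) \<Longrightarrow> m \<le> v" and um: "u \<le> m" for f m
  proof -
    obtain s where s: "s \<in> {0..t}" "\<And>s'. s' \<in> {0..t} \<Longrightarrow> f s' \<le> f s"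
      using continuous_attains_sup[OF _ _ f(1)] t by auto
    then have "u \<le> f s" using m[of "f s"] um by force
    then have "\<exists>s'\<ge>0. s' \<le> s \<and> f s' = u"
      using s(1) u f by (intro IVT') (auto intro: continuous_on_subset)
    then show ?thesis using s(1) by auto
  qed
  show "\<exists>s\<in>{0..t}. Y s w = u" if "u \<le> hi t w"
  proof (rule *[of "\<lambda>s. Y s w" "hi t w"])
    show "hi t w \<le> v" if "\<forall>s\<in>{0..t}. Y s w \<le> v" for v using that hi_le_iff[OF t w] by blast
  qed (use that continuous_path[OF w] start_BM[OF w] in simp_all)
  show "\<exists>s\<in>{0..t}. - Y s w = u" if "u \<le> lo t w"
  proof (rule *[of "\<lambda>s. - Y s w" "lo t w"])
    show "lo t w \<le> v" if "\<forall>s\<in>{0..t}. - Y s w \<le> v" for v using that lo_le_iff[OF t w] by blast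
  qed (use that continuous_on_minus[OF continuous_path[OF w]] start_BM[OF w] in simp_all)
qed

end

section \<open>Measurability and law of exit times from an open set\<close>

context brownian_motion
begin

lemma exit_event_eq:
  assumes D: "open D"
  shows "{w \<in> space M. exit_time D (\<lambda>s. z + B s w) > ereal t} =
    {w \<in> space M. \<forall>s\<in>{0..t}. B s w \<in> (\<lambda>x. z + x) -` D}"
proof -
  have "exit_time D (\<lambda>s. z + B s w) > ereal t \<longleftrightarrow> (\<forall>s\<in>{0..t}. z + B s w \<in> D)" if "w \<in> space M" for w
    using continuous_BM[OF that] by (intro exit_time_gt_iff D continuous_intros)
  then show ?thesis by auto
qed

lemma exit_time_process_measurable:
  assumes D: "open D"
  shows "(\<lambda>w. exit_time D (\<lambda>s. z + B s w)) \<in> borel_measurable (sigma (space M) (process_events M B))"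
proof (rule borel_measurableI_greater)
  interpret P: sigma_algebra "space M" "process_events M B" by (rule sigma_algebra_process_events)
  have nonneg: "0 \<le> exit_time D (\<lambda>s. z + B s w)" for w
    unfolding exit_time_def by (intro INF_greatest) auto
  have D': "open ((\<lambda>x. z + x) -` D)" by (intro open_vimage D continuous_intros)
  fix a :: ereal
  have "{w \<in> space M. a < exit_time D (\<lambda>s. z + B s w)} \<in> process_events M B"
  proof (cases "a < 0")
    case True
    then have "{w \<in> space M. a < exit_time D (\<lambda>s. z + B s w)} = space M"
      using nonneg by (auto intro: less_le_trans)
    then show ?thesis by simp
  next
    case False
    then consider t where "a = ereal t" "0 \<le> t" | "a = \<infinity>" by (cases a) auto
    then show ?thesis
    proof cases
      case 1
      then show ?thesis using exit_event_eq[OF D] open_stay_process_event[OF _ D'] by simp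
    qed simp
  qed
  then show "{w \<in> space (sigma (space M) (process_events M B)). a < exit_time D (\<lambda>s. z + B s w)} \<in> sets (sigma (space M) (process_events M B))"
    unfolding sets_sigma_process_events space_measure_of_conv .
qed

end

lemma exit_law_eq:
  assumes B: "brownian_motion M B" and W: "brownian_motion N W" and D: "open D" and t: "t \<ge> 0"
  shows "measure M {w \<in> space M. exit_time D (\<lambda>s. z + B s w) > ereal t} =
    measure N {w \<in> space N. exit_time D (\<lambda>s. z + W s w) > ereal t}"
  unfolding brownian_motion.exit_event_eq[OF B D] brownian_motion.exit_event_eq[OF W D]
  by (intro brownian_open_stay_law[OF B W t] open_vimage D continuous_intros)

section \<open>Iterated Brownian motion\<close>

text \<open>Independence of the generating sigma-algebras makes the joint law of \<open>X\<close>
  and \<open>Z\<close> a product, and Tonelli integrates out \<open>X\<close> with \<open>Z\<close>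
  frozen. Stating it for sigma-algebras allows \<open>X\<close> and \<open>Z\<close> to depend on
  whole paths.\<close>

lemma (in prob_space) indep_set_nn_integral:
  assumes ind: "indep_set A B" and A: "sigma_algebra (space M) A" and B: "sigma_algebra (space M) B"
    and X: "X \<in> measurable (sigma (space M) A) S" and Z: "Z \<in> measurable (sigma (space M) B) T"
    and f [measurable]: "f \<in> borel_measurable (S \<Otimes>\<^sub>M T)"
  shows "(\<integral>\<^sup>+w. f (X w, Z w) \<partial>M) = (\<integral>\<^sup>+w. (\<integral>\<^sup>+w'. f (X w', Z w) \<partial>M) \<partial>M)"
proof -
  have sA: "sets (sigma (space M) A) = A" and sB: "sets (sigma (space M) B) = B"
    using sigma_algebra.sets_measure_of_eq[OF A] sigma_algebra.sets_measure_of_eq[OF B] by auto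
  have sp: "space (sigma (space M) A) = space M" "space (sigma (space M) B) = space M"
    by (simp_all add: space_measure_of_conv)
  have ev: "A \<subseteq> events" "B \<subseteq> events" and AB: "\<And>a b. a \<in> A \<Longrightarrow> b \<in> B \<Longrightarrow> prob (a \<inter> b) = prob a * prob b"
    using ind by (auto simp: indep_sets2_eq)
  have [measurable]: "random_variable S X" "random_variable T Z"
    using measurable_from_subalg[of M "sigma (space M) A" X S] measurable_from_subalg[of M "sigma (space M) B" Z T]
      X Z ev by (auto simp: subalgebra_def sA sB sp)
  interpret X: prob_space "distr M S X" by (rule prob_space_distr) measurable
  interpret Z: prob_space "distr M T Z" by (rule prob_space_distr) measurable
  interpret P: pair_sigma_finite "distr M S X" "distr M T Z" ..
  have eq: "distr M S X \<Otimes>\<^sub>M distr M T Z = distr M (S \<Otimes>\<^sub>M T) (\<lambda>w. (X w, Z w))"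
  proof (rule pair_measure_eqI)
    fix U V assume "U \<in> sets (distr M S X)" "V \<in> sets (distr M T Z)"
    then have UV: "U \<in> sets S" "V \<in> sets T" by auto
    have "(\<lambda>w. (X w, Z w)) -` (U \<times> V) \<inter> space M = (X -` U \<inter> space M) \<inter> (Z -` V \<inter> space M)" by auto
    moreover have "prob ((X -` U \<inter> space M) \<inter> (Z -` V \<inter> space M)) = prob (X -` U \<inter> space M) * prob (Z -` V \<inter> space M)"
      using measurable_sets[OF X UV(1)] measurable_sets[OF Z UV(2)] unfolding sA sB sp by (rule AB)
    ultimately show "emeasure (distr M S X) U * emeasure (distr M T Z) V =
        emeasure (distr M (S \<Otimes>\<^sub>M T) (\<lambda>w. (X w, Z w))) (U \<times> V)"
      using UV by (simp add: emeasure_distr emeasure_eq_measure ennreal_mult)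
  qed (unfold_locales, simp_all cong: sets_pair_measure_cong)
  have "(\<integral>\<^sup>+w. f (X w, Z w) \<partial>M) = (\<integral>\<^sup>+p. f p \<partial>distr M (S \<Otimes>\<^sub>M T) (\<lambda>w. (X w, Z w)))"
    by (subst nn_integral_distr) auto
  also have "\<dots> = (\<integral>\<^sup>+z. \<integral>\<^sup>+x. f (x, z) \<partial>distr M S X \<partial>distr M T Z)"
    unfolding eq[symmetric] by (rule P.nn_integral_snd[symmetric]) simp
  also have "\<dots> = (\<integral>\<^sup>+w. (\<integral>\<^sup>+w'. f (X w', Z w) \<partial>M) \<partial>M)"
    by (subst nn_integral_distr) (auto intro!: nn_integral_cong nn_integral_distr)
  finally show ?thesis .
qed

context real_brownian_motion
begin

text \<open>The two halves fit together at time \<open>0\<close>, where both motions vanish.\<close>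

lemma two_sided_continuous:
  assumes "brownian_motion M Xp" "brownian_motion M Xm" "w \<in> space M"
  shows "continuous_on UNIV (\<lambda>u. two_sided Xp Xm u w)"
proof -
  interpret p: brownian_motion M Xp by fact
  interpret m: brownian_motion M Xm by fact
  have "continuous_on ({0..} \<union> {..0}) (\<lambda>u. if 0 \<le> u then Xp u w else Xm (- u) w)"
  proof (rule continuous_on_If)
    show "continuous_on {0..} (\<lambda>u. Xp u w)" by (rule p.continuous_BM[OF assms(3)])
    show "continuous_on {..0} (\<lambda>u. Xm (- u) w)"
      by (rule continuous_on_compose2[OF m.continuous_BM[OF assms(3)]]) (auto intro!: continuous_intros)
  qed (auto simp: p.start_BM[OF assms(3)] m.start_BM[OF assms(3)] dest: antisym)
  moreover have "{0..} \<union> {..0} = (UNIV :: real set)" by auto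
  ultimately show ?thesis by (simp add: two_sided_def)
qed

text \<open>By \<open>path_hits\<close> the inner path takes every value between \<open>- lo\<close>
  and \<open>hi\<close>, and no others. So staying in \<open>D\<close> splits into a condition on
  each half of the outer motion, and \<open>exit_time_gt_iff\<close> translates all three
  conditions.\<close>

lemma iterated_exit_iff:
  fixes Xp Xm :: "real \<Rightarrow> 'w \<Rightarrow> 'a :: euclidean_space"
  assumes Xp: "brownian_motion M Xp" and Xm: "brownian_motion M Xm" and D: "open D"
    and t: "t \<ge> 0" and w: "w \<in> space M"
  shows "exit_time D (\<lambda>s. iterated_process z Xp Xm Y s w) > ereal t \<longleftrightarrow>
    exit_time D (\<lambda>s. z + Xp s w) > ereal (hi t w) \<and> exit_time D (\<lambda>s. z + Xm s w) > ereal (lo t w)"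
proof -
  interpret p: brownian_motion M Xp by fact
  interpret m: brownian_motion M Xm by fact
  have cont: "continuous_on {0..} (\<lambda>s. iterated_process z Xp Xm Y s w)"
    unfolding iterated_process_def
    by (intro continuous_intros continuous_on_compose2[OF two_sided_continuous[OF Xp Xm w] continuous_BM[OF w]]) simp
  have "exit_time D (\<lambda>s. z + Xp s w) > ereal (hi t w) \<longleftrightarrow> (\<forall>u\<in>{0..hi t w}. z + Xp u w \<in> D)"
    using p.continuous_BM[OF w] by (intro exit_time_gt_iff D continuous_intros)
  moreover have "exit_time D (\<lambda>s. z + Xm s w) > ereal (lo t w) \<longleftrightarrow> (\<forall>u\<in>{0..lo t w}. z + Xm u w \<in> D)"
    using m.continuous_BM[OF w] by (intro exit_time_gt_iff D continuous_intros)
  moreover have "exit_time D (\<lambda>s. iterated_process z Xp Xm Y s w) > ereal t \<longleftrightarrow>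
      (\<forall>s\<in>{0..t}. z + two_sided Xp Xm (Y s w) w \<in> D)"
    using exit_time_gt_iff[OF cont D] by (simp add: iterated_process_def)
  moreover have "(\<forall>s\<in>{0..t}. z + two_sided Xp Xm (Y s w) w \<in> D) \<longleftrightarrow>
      (\<forall>u\<in>{0..hi t w}. z + Xp u w \<in> D) \<and> (\<forall>u\<in>{0..lo t w}. z + Xm u w \<in> D)"
  proof (intro iffI conjI ballI)
    fix u assume L: "\<forall>s\<in>{0..t}. z + two_sided Xp Xm (Y s w) w \<in> D" and u: "u \<in> {0..hi t w}"
    then obtain s where "s \<in> {0..t}" "Y s w = u" using path_hits(1)[OF t w, of u] by auto
    then show "z + Xp u w \<in> D" using L u by (force simp: two_sided_def)
  next
    fix u assume L: "\<forall>s\<in>{0..t}. z + two_sided Xp Xm (Y s w) w \<in> D" and u: "u \<in> {0..lo t w}"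
    then obtain s where s: "s \<in> {0..t}" "- Y s w = u" using path_hits(2)[OF t w, of u] by auto
    \<comment> \<open>At \<open>u = 0\<close> the two-sided motion follows \<open>Xp\<close>, but
      there both motions are \<open>0\<close>.\<close>
    then have "two_sided Xp Xm (Y s w) w = Xm u w"
      using u p.start_BM[OF w] m.start_BM[OF w] by (cases "u = 0") (auto simp: two_sided_def)
    then show "z + Xm u w \<in> D" using L s(1) by metis
  next
    fix s assume R: "(\<forall>u\<in>{0..hi t w}. z + Xp u w \<in> D) \<and> (\<forall>u\<in>{0..lo t w}. z + Xm u w \<in> D)"
      and s: "s \<in> {0..t}"
    have "Y s w \<le> hi t w" "- Y s w \<le> lo t w"
      using hi_le_iff[OF t w, of "hi t w"] lo_le_iff[OF t w, of "lo t w"] s by auto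
    then show "z + two_sided Xp Xm (Y s w) w \<in> D" using R by (simp add: two_sided_def)
  qed
  ultimately show ?thesis by blast
qed

text \<open>Two separations for integrating out the motions in turn: \<open>Xp\<close> against the
  pair of \<open>Xm\<close> and \<open>Y\<close>, then \<open>Xm\<close> against \<open>Y\<close>.
  Merging two of three independent families uses that each is stable under intersection.\<close>

lemma independent_processes_imp_indep_set:
  assumes Xp: "brownian_motion M Xp" and Xm: "brownian_motion M Xm" and ind: "independent_processes M Xp Xm Y"
  shows "indep_set (process_events M Xp) (sigma_sets (space M) (process_events M Xm \<union> process_events M Y))"
    and "indep_set (process_events M Xm) (process_events M Y)"
proof -
  interpret p: brownian_motion M Xp by fact
  interpret m: brownian_motion M Xm by fact
  let ?E = "\<lambda>i. [process_events M Xp, process_events M Xm, process_events M Y] ! i"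
  have ind: "indep_sets ?E {0, 1, 2}" using ind by (simp add: independent_processes_def)
  have stable: "Int_stable (process_events M Xp)" "Int_stable (process_events M Xm)" "Int_stable (process_events M Y)"
    using p.sigma_algebra_process_events m.sigma_algebra_process_events sigma_algebra_process_events
    by (auto simp: Int_stable_def sigma_algebra_iff2)
       (metis algebra.Int_stable Int_stable_def sigma_algebra.axioms(1)
         p.sigma_algebra_process_events m.sigma_algebra_process_events sigma_algebra_process_events)+
  have "indep_sets (\<lambda>j. sigma_sets (space M) (\<Union>i\<in>case_bool {0} {1, 2} j. ?E i)) (UNIV :: bool set)"
  proof (rule indep_sets_collect_sigma)
    have "(\<Union>j. case_bool {0} {1, 2} j) = {0, 1, 2 :: nat}" by (auto simp: UNIV_bool)
    then show "indep_sets ?E (\<Union>j. case_bool {0} {1, 2} j)" using ind by simp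
    show "Int_stable (?E i)" if "i \<in> case_bool {0} {1, 2} j" for i j
      using that stable by (auto split: bool.splits)
    show "disjoint_family (case_bool {0} {1, 2 :: nat})"
      by (auto simp: disjoint_family_on_def split: bool.splits)
  qed
  then show "indep_set (process_events M Xp) (sigma_sets (space M) (process_events M Xm \<union> process_events M Y))"
    unfolding indep_set_def by (rule indep_sets_mono_sets) (auto split: bool.splits)
  show "indep_set (process_events M Xm) (process_events M Y)"
    unfolding indep_sets2_eq
  proof (intro conjI ballI)
    fix a b assume ab: "a \<in> process_events M Xm" "b \<in> process_events M Y"
    \<comment> \<open>The empty set at index \<open>0\<close> is a placeholder that keeps the
      indices \<open>1\<close> and \<open>2\<close> aligned with the family.\<close>
    have "prob (\<Inter>j\<in>{1, 2}. [{}, a, b] ! j) = (\<Prod>j\<in>{1, 2}. prob ([{}, a, b] ! j))"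
      by (rule indep_setsD[OF ind]) (use ab in auto)
    then show "prob (a \<inter> b) = prob a * prob b" by simp
  qed (rule m.process_events_subset process_events_subset)+
qed

text \<open>First \<open>Xp\<close> is integrated out with \<open>Xm\<close> and \<open>Y\<close>
  frozen, giving \<open>G (hi t)\<close>; then \<open>Xm\<close> with \<open>Y\<close> frozen,
  giving \<open>G (lo t)\<close>. Independence permits treating the random times \<open>hi t\<close>
  and \<open>lo t\<close> as constants in each step.\<close>

lemma iterated_exit_probability:
  fixes Xp Xm :: "real \<Rightarrow> 'w \<Rightarrow> 'a :: euclidean_space" and G :: "real \<Rightarrow> real"
  assumes Xp: "brownian_motion M Xp" and Xm: "brownian_motion M Xm" and ind: "independent_processes M Xp Xm Y"
    and D: "open D" and t: "t \<ge> 0" and G [measurable]: "G \<in> borel_measurable borel" and G01: "\<And>u. 0 \<le> G u" "\<And>u. G u \<le> 1"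
    and Gp: "\<And>u. u \<ge> 0 \<Longrightarrow> prob {w \<in> space M. exit_time D (\<lambda>s. z + Xp s w) > ereal u} = G u"
    and Gm: "\<And>u. u \<ge> 0 \<Longrightarrow> prob {w \<in> space M. exit_time D (\<lambda>s. z + Xm s w) > ereal u} = G u"
  shows "prob {w \<in> space M. exit_time D (\<lambda>s. iterated_process z Xp Xm Y s w) > ereal t} =
    expectation (\<lambda>w. G (hi t w) * G (lo t w))"
proof -
  interpret p: brownian_motion M Xp by fact
  interpret m: brownian_motion M Xm by fact
  define \<tau>p where "\<tau>p w = exit_time D (\<lambda>s. z + Xp s w)" for w
  define \<tau>m where "\<tau>m w = exit_time D (\<lambda>s. z + Xm s w)" for w
  let ?\<sigma> = "\<lambda>A. sigma (space M) A"
  define BC where "BC = sigma_sets (space M) (process_events M Xm \<union> process_events M Y)"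
  have sub: "process_events M Xm \<union> process_events M Y \<subseteq> Pow (space M)"
    using m.process_events_subset process_events_subset sets.space_closed by blast
  have BC: "sigma_algebra (space M) BC" unfolding BC_def by (rule sigma_algebra_sigma_sets[OF sub])
  have sets_BC: "sets (?\<sigma> BC) = BC" using sigma_algebra.sets_measure_of_eq[OF BC] by simp
  have subalg: "subalgebra (?\<sigma> BC) (?\<sigma> (process_events M Xm))" "subalgebra (?\<sigma> BC) (?\<sigma> (process_events M Y))"
    unfolding subalgebra_def sets_BC m.sets_sigma_process_events sets_sigma_process_events space_measure_of_conv
    by (auto simp: BC_def)
  have \<tau>p_meas: "\<tau>p \<in> borel_measurable (?\<sigma> (process_events M Xp))"
    unfolding \<tau>p_def[abs_def] by (rule p.exit_time_process_measurable[OF D])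
  have \<tau>m_meas: "\<tau>m \<in> borel_measurable (?\<sigma> (process_events M Xm))"
    unfolding \<tau>m_def[abs_def] by (rule m.exit_time_process_measurable[OF D])
  have hl_meas: "(\<lambda>w. (hi t w, lo t w)) \<in> measurable (?\<sigma> (process_events M Y)) (borel \<Otimes>\<^sub>M borel)"
    by (intro measurable_Pair hi_lo_process_measurable t)
  have mhl_meas: "(\<lambda>w. (\<tau>m w, (hi t w, lo t w))) \<in> measurable (?\<sigma> BC) (borel \<Otimes>\<^sub>M (borel \<Otimes>\<^sub>M borel))"
    by (intro measurable_Pair measurable_from_subalg[OF subalg(1) \<tau>m_meas]
        measurable_from_subalg[OF subalg(2)] hi_lo_process_measurable t)
  note split1 = indep_set_nn_integral[OF independent_processes_imp_indep_set(1)[OF Xp Xm ind, folded BC_def]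
      p.sigma_algebra_process_events BC \<tau>p_meas mhl_meas]
  note split2 = indep_set_nn_integral[OF independent_processes_imp_indep_set(2)[OF Xp Xm ind]
      m.sigma_algebra_process_events sigma_algebra_process_events \<tau>m_meas hl_meas]
  note [measurable] = hi_lo_measurable[OF t] measurable_from_subalg[OF p.subalgebra_process_events \<tau>p_meas]
    measurable_from_subalg[OF m.subalgebra_process_events \<tau>m_meas]
  have G_hi: "(\<integral>\<^sup>+w'. (if ereal u < X w' then 1 else 0) \<partial>M) = ennreal (G u)"
    if [measurable]: "random_variable borel X" and GX: "prob {w \<in> space M. X w > ereal u} = G u" for X u
  proof -
    have "(\<integral>\<^sup>+w'. (if ereal u < X w' then 1 else 0) \<partial>M) = (\<integral>\<^sup>+w'. indicator {w \<in> space M. X w > ereal u} w' \<partial>M)"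
      by (intro nn_integral_cong) (simp add: indicator_def)
    also have "\<dots> = emeasure M {w \<in> space M. X w > ereal u}" by (rule nn_integral_indicator) measurable
    finally show ?thesis by (simp add: emeasure_eq_measure GX)
  qed
  let ?f = "\<lambda>(x, y, h, l). (if ereal h < x then 1 else 0) * (if ereal l < y then 1 else 0) :: ennreal"
  let ?g = "\<lambda>(y, h, l). ennreal (G h) * (if ereal l < y then 1 else 0)"
  let ?ev = "{w \<in> space M. exit_time D (\<lambda>s. iterated_process z Xp Xm Y s w) > ereal t}"
  have ev_eq: "?ev = {w \<in> space M. ereal (hi t w) < \<tau>p w \<and> ereal (lo t w) < \<tau>m w}"
    using iterated_exit_iff[OF Xp Xm D t] by (auto simp: \<tau>p_def \<tau>m_def)
  have int: "integrable M (\<lambda>w. G (hi t w) * G (lo t w))"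
  proof (rule integrable_bounded_by_1)
    show "\<bar>G (hi t w) * G (lo t w)\<bar> \<le> 1" for w
      using G01[of "hi t w"] G01[of "lo t w"] by (simp add: mult_le_one)
  qed measurable
  have "ennreal (prob ?ev) = emeasure M {w \<in> space M. ereal (hi t w) < \<tau>p w \<and> ereal (lo t w) < \<tau>m w}"
    unfolding ev_eq by (rule emeasure_eq_measure[symmetric])
  also have "\<dots> = (\<integral>\<^sup>+w. indicator {w \<in> space M. ereal (hi t w) < \<tau>p w \<and> ereal (lo t w) < \<tau>m w} w \<partial>M)"
    by (rule nn_integral_indicator[symmetric]) measurable
  also have "\<dots> = (\<integral>\<^sup>+w. ?f (\<tau>p w, (\<tau>m w, (hi t w, lo t w))) \<partial>M)"
    by (intro nn_integral_cong) (simp add: indicator_def)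
  also have "\<dots> = (\<integral>\<^sup>+w. \<integral>\<^sup>+w'. ?f (\<tau>p w', (\<tau>m w, (hi t w, lo t w))) \<partial>M \<partial>M)"
    by (rule split1[of ?f]) measurable
  also have "\<dots> = (\<integral>\<^sup>+w. ?g (\<tau>m w, (hi t w, lo t w)) \<partial>M)"
  proof (intro nn_integral_cong)
    fix w assume w: "w \<in> space M"
    have "(\<integral>\<^sup>+w'. ?f (\<tau>p w', (\<tau>m w, (hi t w, lo t w))) \<partial>M) =
        (\<integral>\<^sup>+w'. (if ereal (hi t w) < \<tau>p w' then 1 else 0) \<partial>M) * (if ereal (lo t w) < \<tau>m w then 1 else 0)"
      unfolding prod.case by (rule nn_integral_multc) measurable
    also have "(\<integral>\<^sup>+w'. (if ereal (hi t w) < \<tau>p w' then 1 else 0) \<partial>M) = ennreal (G (hi t w))"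
    proof (rule G_hi)
      show "random_variable borel \<tau>p" by measurable
      show "prob {w' \<in> space M. ereal (hi t w) < \<tau>p w'} = G (hi t w)"
        unfolding \<tau>p_def by (rule Gp[OF hi_lo_nonneg(1)[OF t w]])
    qed
    finally show "(\<integral>\<^sup>+w'. ?f (\<tau>p w', (\<tau>m w, (hi t w, lo t w))) \<partial>M) = ?g (\<tau>m w, (hi t w, lo t w))" by simp
  qed
  also have "\<dots> = (\<integral>\<^sup>+w. \<integral>\<^sup>+w'. ?g (\<tau>m w', (hi t w, lo t w)) \<partial>M \<partial>M)"
    by (rule split2[of ?g]) measurable
  also have "\<dots> = (\<integral>\<^sup>+w. ennreal (G (hi t w) * G (lo t w)) \<partial>M)"
  proof (intro nn_integral_cong)
    fix w assume w: "w \<in> space M"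
    have "(\<integral>\<^sup>+w'. ?g (\<tau>m w', (hi t w, lo t w)) \<partial>M) =
        ennreal (G (hi t w)) * (\<integral>\<^sup>+w'. (if ereal (lo t w) < \<tau>m w' then 1 else 0) \<partial>M)"
      unfolding prod.case by (rule nn_integral_cmult) measurable
    also have "(\<integral>\<^sup>+w'. (if ereal (lo t w) < \<tau>m w' then 1 else 0) \<partial>M) = ennreal (G (lo t w))"
    proof (rule G_hi)
      show "random_variable borel \<tau>m" by measurable
      show "prob {w' \<in> space M. ereal (lo t w) < \<tau>m w'} = G (lo t w)"
        unfolding \<tau>m_def by (rule Gm[OF hi_lo_nonneg(2)[OF t w]])
    qed
    finally show "(\<integral>\<^sup>+w'. ?g (\<tau>m w', (hi t w, lo t w)) \<partial>M) = ennreal (G (hi t w) * G (lo t w))"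
      by (simp add: ennreal_mult G01)
  qed
  also have "\<dots> = ennreal (expectation (\<lambda>w. G (hi t w) * G (lo t w)))"
    by (intro nn_integral_eq_integral int AE_I2 mult_nonneg_nonneg G01)
  finally show ?thesis
    by (subst (asm) ennreal_inj) (auto intro!: integral_nonneg_AE mult_nonneg_nonneg G01)
qed

end

text \<open>The survival probability decreases in \<open>u\<close>, and monotone functions are
  Borel.\<close>

lemma exit_probability_measurable:
  assumes "brownian_motion N W" "open D"
  shows "(\<lambda>u. measure N {w \<in> space N. exit_time D (\<lambda>s. z + W s w) > ereal u}) \<in> borel_measurable borel"
    (is "?G \<in> _")
proof -
  interpret brownian_motion N W by fact
  from measurable_from_subalg[OF subalgebra_process_events exit_time_process_measurable[OF assms(2), of z]]
  have [measurable]: "random_variable borel (\<lambda>w. exit_time D (\<lambda>s. z + W s w))" .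
  have "mono (\<lambda>u. - ?G u)"
  proof (intro monoI)
    fix u v :: real assume "u \<le> v"
    then have "?G v \<le> ?G u"
      by (intro finite_measure_mono) (auto elim: le_less_trans[rotated])
    then show "- ?G u \<le> - ?G v" by simp
  qed
  then have "(\<lambda>u. - (- ?G u)) \<in> borel_measurable borel"
    by (intro borel_measurable_uminus borel_measurable_mono)
  then show ?thesis by simp
qed

theorem theorem1p1:
  fixes D :: "(real ^ 'n) set"
    and lam :: real
    and \<psi> :: "real ^ 'n \<Rightarrow> real"
    and N :: "'v measure" and W :: "real \<Rightarrow> 'v \<Rightarrow> real ^ 'n"
    and M :: "'w measure" and Xp Xm :: "real \<Rightarrow> 'w \<Rightarrow> real ^ 'n" and Y :: "real \<Rightarrow> 'w \<Rightarrow> real"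
  assumes domain: "open D" "connected D" "D \<noteq> {}"
    and eigenvalue: "first_dirichlet_eigenvalue D lam"
    and eigenfunction: "dirichlet_eigenfunction D lam \<psi>"
    and integrable: "set_integrable lborel D \<psi>"
    and W: "brownian_motion N W"
    and exit_asymptotics: "\<forall>z\<in>D.
      ((\<lambda>t. exp (lam * t) *
          measure N {\<omega> \<in> space N. exit_time D (\<lambda>s. z + W s \<omega>) > ereal t})
        \<longlongrightarrow> \<psi> z * (LINT y:D|lborel. \<psi> y)) at_top"
    and Xp: "brownian_motion M Xp"
    and Xm: "brownian_motion M Xm"
    and Y: "brownian_motion M Y"
    and independent: "independent_processes M Xp Xm Y"
  shows "\<forall>z\<in>D.
      ((\<lambda>t. t powr (- 1 / 2) * exp (3 / 2 * pi powr (2 / 3) * lam powr (2 / 3) * t powr (1 / 3)) *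
          measure M {\<omega> \<in> space M. exit_time D (\<lambda>s. iterated_process z Xp Xm Y s \<omega>) > ereal t})
        \<longlongrightarrow> 2 powr (7 / 2) * lam / sqrt (3 * pi) * (\<psi> z * (LINT y:D|lborel. \<psi> y))\<^sup>2) at_top"
proof
  fix z assume z: "z \<in> D"
  interpret Y: real_brownian_motion M Y unfolding real_brownian_motion_def by (rule Y)
  interpret W: brownian_motion N W by (rule W)
  define P where "P t = measure M {\<omega> \<in> space M. exit_time D (\<lambda>s. iterated_process z Xp Xm Y s \<omega>) > ereal t}" for t
  define c where "c = \<psi> z * (LINT y:D|lborel. \<psi> y)"
  have "((\<lambda>t. ibm_scale lam t * P t) \<longlongrightarrow> 2 powr (7 / 2) * lam / sqrt (3 * pi) * c\<^sup>2) at_top"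
  proof (cases "lam = 0")
    \<comment> \<open>Here the exponential in the scale is \<open>1\<close>, so
      \<open>t^(-1/2)\<close> alone drives the product to \<open>0\<close>; the claimed constant
      vanishes through its factor \<open>lam\<close>.\<close>
    case True
    have "((\<lambda>t::real. t powr (- 1 / 2)) \<longlongrightarrow> 0) at_top" by real_asymp
    moreover have "\<bar>t powr (- 1 / 2) * P t\<bar> \<le> t powr (- 1 / 2)" for t
      using Y.prob_le_1 by (simp add: P_def abs_mult mult_left_le)
    ultimately have "((\<lambda>t. t powr (- 1 / 2) * P t) \<longlongrightarrow> 0) at_top"
      by (rule_tac Lim_null_comparison) (auto intro!: always_eventually)
    then show ?thesis using True by (simp add: ibm_scale_def)
  next
    case False
    then have lam: "lam > 0" using dirichlet_eigenvalue_nonneg[OF domain(1) eigenfunction] by simp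
    define G where "G u = measure N {\<omega> \<in> space N. exit_time D (\<lambda>s. z + W s \<omega>) > ereal u}" for u
    have G: "G \<in> borel_measurable borel" "\<And>u. 0 \<le> G u" "\<And>u. G u \<le> 1"
      unfolding G_def[abs_def] using exit_probability_measurable[OF W domain(1)] by auto
    have "((\<lambda>t. ibm_scale lam t * Y.expectation (\<lambda>\<omega>. G (Y.hi t \<omega>) * G (Y.lo t \<omega>)))
        \<longlongrightarrow> 2 powr (7 / 2) * lam / sqrt (3 * pi) * c\<^sup>2) at_top"
      using exit_asymptotics z unfolding G_def c_def
      by (intro Y.weighted_range_asymptotics[OF lam G, unfolded G_def]) auto
    moreover have "\<forall>\<^sub>F t in at_top. ibm_scale lam t * Y.expectation (\<lambda>\<omega>. G (Y.hi t \<omega>) * G (Y.lo t \<omega>)) = ibm_scale lam t * P t"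
      using eventually_ge_at_top[of 0]
    proof eventually_elim
      fix t :: real assume t: "t \<ge> 0"
      have "P t = Y.expectation (\<lambda>\<omega>. G (Y.hi t \<omega>) * G (Y.lo t \<omega>))"
        unfolding P_def using exit_law_eq[OF Xp W domain(1)] exit_law_eq[OF Xm W domain(1)]
        by (intro Y.iterated_exit_probability[OF Xp Xm independent domain(1) t G]) (simp_all add: G_def)
      then show "ibm_scale lam t * Y.expectation (\<lambda>\<omega>. G (Y.hi t \<omega>) * G (Y.lo t \<omega>)) = ibm_scale lam t * P t" by simp
    qed
    ultimately show ?thesis by (rule Lim_transform_eventually)
  qed
  then show "((\<lambda>t. t powr (- 1 / 2) * exp (3 / 2 * pi powr (2 / 3) * lam powr (2 / 3) * t powr (1 / 3)) *
          measure M {\<omega> \<in> space M. exit_time D (\<lambda>s. iterated_process z Xp Xm Y s \<omega>) > ereal t})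
        \<longlongrightarrow> 2 powr (7 / 2) * lam / sqrt (3 * pi) * (\<psi> z * (LINT y:D|lborel. \<psi> y))\<^sup>2) at_top"
    unfolding ibm_scale_def P_def c_def .
qed

end
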